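(* Fix $0<c_m<c_M$, $\varepsilon>0$ and $V>0$, and let $$\mathscr{K}_V=\{c:(0,H)\to\mathbb{R}\ :\ c_m\le c(y)\le c_M \text{ for } 0<y<H,\ TV(c)\le V\}.$$ For every $c\in\mathscr{K}_V$ consider the set of spectral pairs $$\mathscr{A}^c_\varepsilon=\{(\mu_k,\lambda):\ k\ge 1,\ \lambda \text{ an eigenvalue of } A_k,\ \lambda\ge (c_M+\varepsilon)\mu_k^2\}$$ and the associated eigenfunctions $v_\lambda(x',y)=\phi_k(x')u_{\lambda,k}(y)$ of $A=-\tilde c\,\Delta$. Let $(a,b)\subseteq(0,H)$ be an interval, let $\omega'\subseteq\Omega'$ be a nonempty open set, and let $\omega=\omega'\times(a,b)$. If $\omega'\ne\Omega'$, assume that the family $\{\phi_k\}_{k\ge1}$ does not concentrate in $\Omega'\setminus\omega'$. Then there exists $\mathfrak{f}_\omega>0$ such that $$\mathfrak{f}_\omega\le\frac{\|v_\lambda\|_{L^2(\omega)}}{\|v_\lambda\|_{L^2(\Omega)}}\le 1$$ uniformly for all $c\in\mathscr{K}_V$ and all $(\mu_k,\lambda)\in\mathscr{A}^c_\varepsilon$.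
   Context: Let $d\ge 1$, let $\Omega'\subset\mathbb{R}^d$ be an open bounded smooth domain, $H>0$, and $\Omega=\Omega'\times(0,H)$ with points $x=(x',y)$. Let $(\mu_k^2,\phi_k)_{k\ge1}$, $\mu_k>0$, be the eigenvalues (nondecreasing, counted with multiplicity) and corresponding orthonormal eigenfunctions of $-\Delta_{x'}$ in $L^2(\Omega')$ with domain $H^2(\Omega')\cap H^1_0(\Omega')$. For a coefficient $c$ put $\tilde c(x',y)=c(y)$; $A=-\tilde c\,\Delta$ acts in $L^2(\Omega;\tilde c^{-1}dx)$ with domain $H^2(\Omega)\cap H^1_0(\Omega)$, and $A_k=c(y)\big(\mu_k^2-\frac{d^2}{dy^2}\big)$ acts in $L^2((0,H),c(y)^{-1}dy)$ with domain $H^2(0,H)\cap H^1_0(0,H)$. The eigenvalues of each $A_k$ are simple, and the eigenvalues of $A$ are exactly the eigenvalues of the $A_k$, $k\ge1$. For an eigenvalue $\lambda$ of $A_k$, $u_{\lambda,k}$ is the real eigenfunction of $A_k$ with $\int_0^H u_{\lambda,k}^2c^{-1}dy=1$. $TV(c)$ denotes the total variation of $c$. The family $\{\phi_k\}$ "does not concentrate in $\Omega'\setminus\omega'$" means that no subsequence satisfies $\|\phi_{k_j}\|^2_{L^2(\omega')}/\|\phi_{k_j}\|^2_{L^2(\Omega')}\to0$, i.e. $\liminf_{k\to\infty}\|\phi_k\|^2_{L^2(\omega')}/\|\phi_k\|^2_{L^2(\Omega')}>0$. *)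

theory Defs
  imports "HOL-Analysis.Analysis"
begin

section \<open>Smooth functions and smooth domains\<close>

primrec Ck :: "nat \<Rightarrow> ('a::euclidean_space \<Rightarrow> real) \<Rightarrow> bool" where
  "Ck 0 f \<longleftrightarrow> continuous_on UNIV f"
| "Ck (Suc n) f \<longleftrightarrow> (\<forall>x. f differentiable (at x)) \<and>
     (\<forall>i\<in>Basis. Ck n (\<lambda>x. frechet_derivative f (at x) i))"

definition smooth :: "('a::euclidean_space \<Rightarrow> real) \<Rightarrow> bool" where
  "smooth f \<longleftrightarrow> (\<forall>n. Ck n f)"

text \<open>The boundary is locally the graph of a smooth function over a hyperplane:
  after a rotation of the axes, the unit vector \<open>n\<close> plays the role of the last
  coordinate direction and \<open>x - (x \<bullet> n) n\<close> that of the remaining coordinates.\<close>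

definition smooth_boundary :: "'a::euclidean_space set \<Rightarrow> bool" where
  "smooth_boundary U \<longleftrightarrow> (\<forall>p\<in>frontier U. \<exists>r n \<gamma>. r > 0 \<and> norm n = 1 \<and> smooth \<gamma> \<and>
     U \<inter> ball p r = {x \<in> ball p r. x \<bullet> n > \<gamma> (x - (x \<bullet> n) *\<^sub>R n)})"

definition bounded_smooth_domain :: "'a::euclidean_space set \<Rightarrow> bool" where
  "bounded_smooth_domain U \<longleftrightarrow>
     open U \<and> connected U \<and> U \<noteq> {} \<and> bounded U \<and> smooth_boundary U"

section \<open>Lebesgue and Sobolev spaces\<close>

text \<open>Elements of the spaces are represented by functions on the whole type; only the
  values on \<open>U\<close>, up to null sets, matter.\<close>

definition L2_on :: "'a::euclidean_space set \<Rightarrow> ('a \<Rightarrow> real) \<Rightarrow> bool" where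
  "L2_on U f \<longleftrightarrow> set_borel_measurable lebesgue U f \<and> set_integrable lebesgue U (\<lambda>x. (f x)\<^sup>2)"

definition L2_norm_on :: "'a::euclidean_space set \<Rightarrow> ('a \<Rightarrow> real) \<Rightarrow> real" where
  "L2_norm_on U f = sqrt (LINT x:U|lebesgue. (f x)\<^sup>2)"

definition test_function :: "'a::euclidean_space set \<Rightarrow> ('a \<Rightarrow> real) \<Rightarrow> bool" where
  "test_function U \<psi> \<longleftrightarrow> smooth \<psi> \<and> (\<exists>K. compact K \<and> K \<subseteq> U \<and> (\<forall>x. x \<notin> K \<longrightarrow> \<psi> x = 0))"

text \<open>\<open>g \<in> L\<^sup>2(U)\<close> is the weak derivative of \<open>f \<in> L\<^sup>2(U)\<close> in direction \<open>i\<close>.\<close>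

definition weak_deriv ::
  "'a::euclidean_space set \<Rightarrow> 'a \<Rightarrow> ('a \<Rightarrow> real) \<Rightarrow> ('a \<Rightarrow> real) \<Rightarrow> bool" where
  "weak_deriv U i f g \<longleftrightarrow> L2_on U f \<and> L2_on U g \<and>
     (\<forall>\<psi>. test_function U \<psi> \<longrightarrow>
        (LINT x:U|lebesgue. f x * frechet_derivative \<psi> (at x) i) =
        - (LINT x:U|lebesgue. g x * \<psi> x))"

definition H1_on :: "'a::euclidean_space set \<Rightarrow> ('a \<Rightarrow> real) \<Rightarrow> bool" where
  "H1_on U f \<longleftrightarrow> L2_on U f \<and> (\<forall>i\<in>Basis. \<exists>g. weak_deriv U i f g)"

definition H2_on :: "'a::euclidean_space set \<Rightarrow> ('a \<Rightarrow> real) \<Rightarrow> bool" where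
  "H2_on U f \<longleftrightarrow> L2_on U f \<and> (\<forall>i\<in>Basis. \<exists>g. weak_deriv U i f g \<and> H1_on U g)"

text \<open>The closure in \<open>H\<^sup>1(U)\<close> of the test functions.\<close>

definition H10_on :: "'a::euclidean_space set \<Rightarrow> ('a \<Rightarrow> real) \<Rightarrow> bool" where
  "H10_on U f \<longleftrightarrow> H1_on U f \<and>
     (\<exists>D \<psi>. (\<forall>i\<in>Basis. weak_deriv U i f (D i)) \<and> (\<forall>n. test_function U (\<psi> n)) \<and>
        (\<lambda>n. L2_norm_on U (\<lambda>x. \<psi> n x - f x)) \<longlonglongrightarrow> 0 \<and>
        (\<forall>i\<in>Basis.
          (\<lambda>n. L2_norm_on U (\<lambda>x. frechet_derivative (\<psi> n) (at x) i - D i x)) \<longlonglongrightarrow> 0))"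

section \<open>The Dirichlet Laplacian on the cross section\<close>

definition dirichlet_eigenfunction ::
  "'a::euclidean_space set \<Rightarrow> real \<Rightarrow> ('a \<Rightarrow> real) \<Rightarrow> bool" where
  "dirichlet_eigenfunction U lam f \<longleftrightarrow> H2_on U f \<and> H10_on U f \<and>
     \<not> (AE x in lebesgue. x \<in> U \<longrightarrow> f x = 0) \<and>
     (\<exists>D D2. (\<forall>i\<in>Basis. weak_deriv U i f (D i) \<and> weak_deriv U i (D i) (D2 i)) \<and>
        (AE x in lebesgue. x \<in> U \<longrightarrow> - (\<Sum>i\<in>Basis. D2 i x) = lam * f x))"

text \<open>Sequences are indexed by \<open>k \<ge> 1\<close>; the entries at \<open>0\<close> are irrelevant. The last clause
  says that the list is complete and counts multiplicities: every eigenspace is spanned by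
  the \<open>\<phi> k\<close> listed with that eigenvalue.\<close>

definition dirichlet_eigensystem ::
  "'a::euclidean_space set \<Rightarrow> (nat \<Rightarrow> real) \<Rightarrow> (nat \<Rightarrow> 'a \<Rightarrow> real) \<Rightarrow> bool" where
  "dirichlet_eigensystem U \<mu> \<phi> \<longleftrightarrow>
     (\<forall>k\<ge>1. \<mu> k > 0) \<and> (\<forall>k\<ge>1. \<mu> k \<le> \<mu> (Suc k)) \<and>
     (\<forall>k\<ge>1. dirichlet_eigenfunction U ((\<mu> k)\<^sup>2) (\<phi> k)) \<and>
     (\<forall>j\<ge>1. \<forall>k\<ge>1. (LINT x:U|lebesgue. \<phi> j x * \<phi> k x) = (if j = k then 1 else 0)) \<and>
     (\<forall>lam f. dirichlet_eigenfunction U lam f \<longrightarrow>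
        (\<exists>K a. finite K \<and> K \<subseteq> {k. k \<ge> 1 \<and> (\<mu> k)\<^sup>2 = lam} \<and>
           (AE x in lebesgue. x \<in> U \<longrightarrow> f x = (\<Sum>k\<in>K. a k * \<phi> k x))))"

definition non_concentrating ::
  "'a::euclidean_space set \<Rightarrow> 'a set \<Rightarrow> (nat \<Rightarrow> 'a \<Rightarrow> real) \<Rightarrow> bool" where
  "non_concentrating U W \<phi> \<longleftrightarrow>
     \<not> (\<exists>r. strict_mono r \<and>
          (\<lambda>j. (L2_norm_on W (\<phi> (r j)))\<^sup>2 / (L2_norm_on U (\<phi> (r j)))\<^sup>2) \<longlonglongrightarrow> 0)"

section \<open>The operators \<open>A\<^sub>k\<close> on the interval\<close>

text \<open>Eigenfunctions of \<open>A\<^sub>k = c(y) (m\<^sup>2 - d\<^sup>2/dy\<^sup>2)\<close> with \<open>m = \<mu>\<^sub>k\<close>. For \<open>c\<close> measurable and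
  bounded between positive constants, \<open>L\<^sup>2((0,H), c\<^sup>-\<^sup>1 dy)\<close> and \<open>L\<^sup>2(0,H)\<close> are the same set.
  On the real line \<open>Basis = {1}\<close>.\<close>

definition Ak_eigenfunction ::
  "real \<Rightarrow> (real \<Rightarrow> real) \<Rightarrow> real \<Rightarrow> real \<Rightarrow> (real \<Rightarrow> real) \<Rightarrow> bool" where
  "Ak_eigenfunction H c m lam u \<longleftrightarrow> H2_on {0<..<H} u \<and> H10_on {0<..<H} u \<and>
     \<not> (AE y in lebesgue. y \<in> {0<..<H} \<longrightarrow> u y = 0) \<and>
     (\<exists>u' u''. weak_deriv {0<..<H} 1 u u' \<and> weak_deriv {0<..<H} 1 u' u'' \<and>
        (AE y in lebesgue. y \<in> {0<..<H} \<longrightarrow> c y * (m\<^sup>2 * u y - u'' y) = lam * u y))"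

definition normalized_Ak_eigenfunction ::
  "real \<Rightarrow> (real \<Rightarrow> real) \<Rightarrow> real \<Rightarrow> real \<Rightarrow> (real \<Rightarrow> real) \<Rightarrow> bool" where
  "normalized_Ak_eigenfunction H c m lam u \<longleftrightarrow>
     Ak_eigenfunction H c m lam u \<and> (LINT y:{0<..<H}|lebesgue. (u y)\<^sup>2 / c y) = 1"

definition Ak_eigenvalue :: "real \<Rightarrow> (real \<Rightarrow> real) \<Rightarrow> real \<Rightarrow> real \<Rightarrow> bool" where
  "Ak_eigenvalue H c m lam \<longleftrightarrow> (\<exists>u. Ak_eigenfunction H c m lam u)"

definition total_variation :: "real set \<Rightarrow> (real \<Rightarrow> real) \<Rightarrow> ereal" where
  "total_variation S c = (SUP xs\<in>{xs. sorted xs \<and> set xs \<subseteq> S}.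
     ereal (\<Sum>i<length xs - 1. \<bar>c (xs ! Suc i) - c (xs ! i)\<bar>))"

definition K_class :: "real \<Rightarrow> real \<Rightarrow> real \<Rightarrow> real \<Rightarrow> (real \<Rightarrow> real) set" where
  "K_class H cm cM V =
     {c. (\<forall>y\<in>{0<..<H}. cm \<le> c y \<and> c y \<le> cM) \<and> total_variation {0<..<H} c \<le> ereal V}"

text \<open>A pair \<open>(\<mu>\<^sub>k, \<lambda>)\<close> is recorded as \<open>(k, \<lambda>)\<close>: a multiple eigenvalue \<open>\<mu>\<^sub>k\<^sup>2\<close> carries several
  \<open>\<phi>\<^sub>k\<close>, and each of them gives an eigenfunction of \<open>A\<close>.\<close>

definition spectral_pairs ::
  "real \<Rightarrow> (nat \<Rightarrow> real) \<Rightarrow> real \<Rightarrow> real \<Rightarrow> (real \<Rightarrow> real) \<Rightarrow> (nat \<times> real) set" where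
  "spectral_pairs H \<mu> cM \<epsilon> c =
     {(k, lam). k \<ge> 1 \<and> Ak_eigenvalue H c (\<mu> k) lam \<and> lam \<ge> (cM + \<epsilon>) * (\<mu> k)\<^sup>2}"

definition product_eigenfunction ::
  "('a \<Rightarrow> real) \<Rightarrow> (real \<Rightarrow> real) \<Rightarrow> 'a \<times> real \<Rightarrow> real" where
  "product_eigenfunction f u = (\<lambda>(x, y). f x * u y)"

end

theory Submission
  imports Defs
begin

text \<open>
  An eigenfunction \<open>v = \<phi>\<^sub>k u\<close> is a product, so by \<open>L2_norm_on_product\<close> the quotient of the norms is
  the product of the cross-sectional quotient for \<open>\<phi>\<^sub>k\<close> and of the vertical quotient for \<open>u\<close>, and the
  two factors are bounded from below independently.

  \<^emph>\<open>Vertical factor.\<close> Put \<open>p = 1/c - \<mu>\<^sub>k\<^sup>2/\<lambda>\<close>. The equation for \<open>u\<close> reads \<open>u'' = - \<lambda> p u\<close>, and the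
  condition \<open>\<lambda> \<ge> (c\<^sub>M + \<epsilon>) \<mu>\<^sub>k\<^sup>2\<close> gives \<open>p \<ge> \<kappa> = 1/c\<^sub>M - 1/(c\<^sub>M + \<epsilon>) > 0\<close>, so \<open>u\<close> oscillates on the whole
  interval and has no evanescent zone. If \<open>p\<close> were constant, the energy \<open>E = u'\<^sup>2/\<lambda> + p u\<^sup>2\<close> would be
  conserved; since \<open>p\<close> has variation at most \<open>V/c\<^sub>m\<^sup>2\<close>, the energies at any two points differ at most by
  the factor \<open>exp (V/(c\<^sub>m\<^sup>2 \<kappa>))\<close> (\<open>energy_comparable\<close>), whatever \<open>\<lambda>\<close> is. A Caccioppoli inequality on
  \<open>(a, b)\<close> bounds the derivative part of the energy there by the integral of \<open>u\<^sup>2\<close>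
  (\<open>weighted_derivative_bound\<close>); its constant only needs a positive lower bound for \<open>\<lambda>\<close>, which
  \<open>\<lambda> \<ge> (c\<^sub>M + \<epsilon>) \<mu>\<^sub>1\<^sup>2\<close> provides. Together they bound \<open>u\<^sup>2\<close> at every point of \<open>(0, H)\<close> by the integral of
  \<open>u\<^sup>2\<close> over \<open>(a, b)\<close> (\<open>pointwise_observability\<close>). The Sobolev solution \<open>u\<close> is brought into this classical
  form by the lemma of du Bois-Reymond (\<open>weak_deriv_primitive\<close>).

  \<^emph>\<open>Cross-sectional factor.\<close> The non-concentration hypothesis excludes a subsequence tending to \<open>0\<close>;
  what remains is that no single \<open>\<phi>\<^sub>k\<close> vanishes on \<open>\<omega>'\<close> (\<open>positive_sequence_bounded_below\<close>). This
  is unique continuation for \<open>- \<Delta> f = \<lambda> f\<close> on a connected open set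
  (\<open>dirichlet_eigenfunction_unique_continuation\<close>), proved by analyticity. Convolving \<open>f\<close> with a test
  function gives a smooth solution \<open>J\<close>. Iterating the Caccioppoli inequality with the weights
  \<open>(R\<^sup>2 - |x - c|\<^sup>2)\<^sup>2\<^sup>m\<close>, whose power grows with the order of the derivative, bounds the \<open>m\<close>-th
  directional derivatives of \<open>J\<close> in a mean-square sense by \<open>C\<^sup>m m!\<close> (\<open>weighted_energy_bound\<close>). If \<open>f\<close>
  vanishes near a point, Taylor's formula then makes \<open>J\<close> vanish at a distance which depends only on
  \<open>\<lambda>\<close> and \<open>R\<close> (\<open>conv_vanishes_at\<close>), and connectedness finishes the argument.
\<close>

section \<open>Calculus of smooth functions and test functions\<close>

text \<open>The recursive clause would unfold \<open>Ck (Suc n)\<close> into its partial derivatives before the closure lemmas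
below can be applied.\<close>

declare Ck.simps(2) [simp del]

lemma Ck_SucI:
  assumes "\<And>x. (f has_derivative f' x) (at x)" "\<And>i. i \<in> Basis \<Longrightarrow> Ck n (\<lambda>x. f' x i)"
  shows "Ck (Suc n) f"
proof -
  have "frechet_derivative f (at x) = f' x" for x
    using assms(1) frechet_derivative_at by metis
  thus ?thesis
    using assms by (auto simp: Ck.simps(2) differentiable_def)
qed

lemma Ck_Suc_deriv:
  assumes "Ck (Suc n) f"
  shows "(f has_derivative frechet_derivative f (at x)) (at x)"
  using assms by (auto simp: Ck.simps(2) frechet_derivative_works[symmetric])

lemma Ck_Suc_imp: "Ck (Suc n) f \<Longrightarrow> Ck n f"
proof (induction n arbitrary: f)
  case 0
  thus ?case
    by (auto simp: Ck.simps(2) continuous_on_eq_continuous_at intro: differentiable_imp_continuous_within)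
next
  case (Suc n)
  show ?case
    by (rule Ck_SucI[OF Ck_Suc_deriv[OF Suc.prems]]) (use Suc Ck.simps(2) in blast)
qed

lemma Ck_imp_continuous: "Ck n f \<Longrightarrow> continuous_on UNIV f"
  by (induction n) (simp, blast dest: Ck_Suc_imp)

lemma Ck_const: "Ck n (\<lambda>x. c)"
  by (induction n arbitrary: c) (simp, rule Ck_SucI[where f'="\<lambda>_ _. 0"], auto)

lemma Ck_linear:
  fixes f :: "'a::euclidean_space \<Rightarrow> real"
  assumes "bounded_linear f" shows "Ck n f"
proof (cases n)
  case 0
  thus ?thesis using assms by (auto intro: linear_continuous_on)
next
  case (Suc m)
  show ?thesis unfolding Suc
    by (rule Ck_SucI[OF bounded_linear_imp_has_derivative[OF assms] Ck_const])
qed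

lemma Ck_add: "Ck n f \<Longrightarrow> Ck n g \<Longrightarrow> Ck n (\<lambda>x. f x + g x)"
proof (induction n arbitrary: f g)
  case 0
  thus ?case by (auto intro: continuous_intros)
next
  case (Suc n)
  have "Ck n (\<lambda>x. frechet_derivative f (at x) i + frechet_derivative g (at x) i)" if "i \<in> Basis" for i
    using Suc.prems that by (intro Suc.IH) (simp_all add: Ck.simps(2))
  with has_derivative_add[OF Ck_Suc_deriv[OF Suc.prems(1)] Ck_Suc_deriv[OF Suc.prems(2)]] show ?case
    by (rule Ck_SucI)
qed

lemma Ck_mult: "Ck n f \<Longrightarrow> Ck n g \<Longrightarrow> Ck n (\<lambda>x. f x * g x)"
proof (induction n arbitrary: f g)
  case 0
  thus ?case by (auto intro: continuous_intros)
next
  case (Suc n)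
  have fg: "Ck n f" "Ck n g" using Suc.prems Ck_Suc_imp by blast+
  have "Ck n (\<lambda>x. f x * frechet_derivative g (at x) i + frechet_derivative f (at x) i * g x)" if "i \<in> Basis" for i
    using Suc.prems that by (intro Ck_add Suc.IH fg) (simp_all add: Ck.simps(2))
  with has_derivative_mult[OF Ck_Suc_deriv[OF Suc.prems(1)] Ck_Suc_deriv[OF Suc.prems(2)]] show ?case
    by (rule Ck_SucI)
qed

text \<open>Stated for an outer function of one variable only: this is what is needed to build bump functions from
\<open>exp (- 1/t)\<close>, and it keeps the chain rule down to a single product.\<close>

lemma Ck_compose:
  fixes h :: "real \<Rightarrow> real" and q :: "'a::euclidean_space \<Rightarrow> real"
  shows "Ck n h \<Longrightarrow> Ck n q \<Longrightarrow> Ck n (\<lambda>x. h (q x))"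
proof (induction n arbitrary: h)
  case 0
  thus ?case using continuous_on_compose2[of UNIV h UNIV q] by simp
next
  case (Suc n)
  let ?h' = "\<lambda>t. frechet_derivative h (at t) 1"
  have q: "Ck n q" using Suc.prems Ck_Suc_imp by blast
  have lin: "frechet_derivative h (at t) s = ?h' t * s" for t s
  proof -
    have "linear (frechet_derivative h (at t))"
      using Suc.prems(1) linear_frechet_derivative Ck.simps(2) by blast
    from linear.scaleR[OF this, of s 1] show ?thesis by (simp add: mult.commute)
  qed
  have "((\<lambda>x. h (q x)) has_derivative (\<lambda>i. ?h' (q x) * frechet_derivative q (at x) i)) (at x)" for x
    using has_derivative_compose[OF Ck_Suc_deriv[OF Suc.prems(2)] Ck_Suc_deriv[OF Suc.prems(1)], of x]
    by (subst (asm) lin) simp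
  moreover have "Ck n (\<lambda>x. ?h' (q x) * frechet_derivative q (at x) i)" if "i \<in> Basis" for i
    using Suc.IH[of ?h', OF _ q] Suc.prems that by (intro Ck_mult) (simp_all add: Ck.simps(2))
  ultimately show ?case
    by (rule Ck_SucI)
qed

lemma Ck_compose_affine:
  fixes f :: "'a::euclidean_space \<Rightarrow> real"
  shows "Ck n f \<Longrightarrow> Ck n (\<lambda>x. f (z + s *\<^sub>R x))"
proof (induction n arbitrary: f)
  case 0
  have "continuous_on UNIV (\<lambda>x. z + s *\<^sub>R x)" by (intro continuous_intros)
  with 0 show ?case using continuous_on_compose2[of UNIV f UNIV "\<lambda>x. z + s *\<^sub>R x"] by simp
next
  case (Suc n)
  have "((\<lambda>x. f (z + s *\<^sub>R x)) has_derivative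
      (\<lambda>i. s * frechet_derivative f (at (z + s *\<^sub>R x)) i)) (at x)" for x
  proof -
    have "((\<lambda>x. z + s *\<^sub>R x) has_derivative (\<lambda>i. s *\<^sub>R i)) (at x)"
      by (auto intro!: derivative_eq_intros)
    from has_derivative_compose[OF this Ck_Suc_deriv[OF Suc.prems]] 
    have "((\<lambda>x. f (z + s *\<^sub>R x)) has_derivative
      (\<lambda>i. frechet_derivative f (at (z + s *\<^sub>R x)) (s *\<^sub>R i))) (at x)" .
    moreover have "linear (frechet_derivative f (at y))" for y
      using Suc.prems(1) linear_frechet_derivative Ck.simps(2) by blast
    ultimately show ?thesis by (simp add: linear.scaleR)
  qed
  moreover have "Ck n (\<lambda>x. s * frechet_derivative f (at (z + s *\<^sub>R x)) i)" if "i \<in> Basis" for i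
    using Suc.IH[of "\<lambda>y. frechet_derivative f (at y) i"] Suc.prems that
    by (intro Ck_mult Ck_const) (auto simp: Ck.simps(2))
  ultimately show ?case
    by (rule Ck_SucI)
qed

abbreviation vanishes_on :: "('a::euclidean_space \<Rightarrow> real) \<Rightarrow> 'a set \<Rightarrow> bool" where
  "vanishes_on f S \<equiv> AE x in lebesgue. x \<in> S \<longrightarrow> f x = 0"

lemma AE_lebesgue_negligibleE:
  assumes "AE x in lebesgue. P x"
  obtains N where "negligible N" "\<And>x. x \<notin> N \<Longrightarrow> P x"
proof -
  obtain N where N: "\<And>x. x \<in> space lebesgue - N \<Longrightarrow> P x" "N \<in> null_sets lebesgue"
    using AE_E3[OF assms] by blast
  show ?thesis
  proof (rule that[of N])
    show "negligible N" using N(2) by (simp only: negligible_iff_null_sets)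
    show "P x" if "x \<notin> N" for x using N(1) that by simp
  qed
qed

lemma lebesgue_integrable_borel_version:
  fixes h :: "'a::euclidean_space \<Rightarrow> real"
  assumes h: "integrable lebesgue h"
  obtains h1 where "h1 \<in> borel_measurable borel" "integrable lborel h1"
    "integral\<^sup>L lborel h1 = integral\<^sup>L lebesgue h" "AE x in lebesgue. h x = h1 x"
proof -
  obtain h1 where h1: "h1 \<in> borel_measurable lborel" "AE x in lborel. h x = h1 x"
    using completion_ex_borel_measurable_real[OF borel_measurable_integrable[OF h]] by metis
  have m: "h1 \<in> borel_measurable lebesgue" using h1(1) by (auto intro: measurable_completion)
  have ae: "AE x in lebesgue. h x = h1 x" using h1(2) by (rule AE_completion)
  note hm = borel_measurable_integrable[OF h]
  show ?thesis
    using h1(1) integrable_cong_AE[OF hm m ae] Bochner_Integration.integral_cong_AE[OF hm m ae]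
      integrable_completion[OF h1(1)] integral_completion[OF h1(1)] h ae
    by (intro that[of h1]) auto
qed

definition partial :: "'a::euclidean_space \<Rightarrow> ('a \<Rightarrow> real) \<Rightarrow> 'a \<Rightarrow> real" where
  "partial v f = (\<lambda>x. frechet_derivative f (at x) v)"

lemma smooth_has_derivative:
  assumes "smooth f"
  shows "(f has_derivative (\<lambda>v. partial v f x)) (at x)"
  using Ck_Suc_deriv[of 0 f] assms unfolding partial_def smooth_def by blast

lemma smooth_linear_partial: "smooth f \<Longrightarrow> linear (\<lambda>v. partial v f x)"
  using smooth_has_derivative has_derivative_linear by blast

lemma smooth_continuous: "smooth f \<Longrightarrow> continuous_on UNIV f"
  unfolding smooth_def using Ck_imp_continuous by blast

lemma partial_sum_Basis:
  assumes "smooth f"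
  shows "partial v f x = (\<Sum>i\<in>Basis. (v \<bullet> i) * partial i f x)"
  using euclidean_representation[of v] 
    linear_sum[OF smooth_linear_partial[OF assms], of "\<lambda>i. (v \<bullet> i) *\<^sub>R i" Basis x]
  by (simp add: linear_cmul[OF smooth_linear_partial[OF assms]])

lemma Ck_sum: "finite I \<Longrightarrow> (\<And>i. i \<in> I \<Longrightarrow> Ck n (f i)) \<Longrightarrow> Ck n (\<lambda>x. \<Sum>i\<in>I. f i x)"
  by (induction I rule: finite_induct) (simp_all add: Ck_const Ck_add)

lemma Ck_prod: "finite I \<Longrightarrow> (\<And>i. i \<in> I \<Longrightarrow> Ck n (f i)) \<Longrightarrow> Ck n (\<lambda>x. \<Prod>i\<in>I. f i x)"
  by (induction I rule: finite_induct) (simp_all add: Ck_const Ck_mult)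

lemma smooth_partial:
  assumes "smooth f" shows "smooth (partial v f)"
proof -
  have Ck: "Ck n (partial i f)" if "i \<in> Basis" for n i
  proof -
    have "Ck (Suc n) f" using assms smooth_def by blast
    thus ?thesis using that by (simp add: partial_def Ck.simps(2))
  qed
  have "Ck n (\<lambda>x. \<Sum>i\<in>Basis. (v \<bullet> i) * partial i f x)" for n
    by (rule Ck_sum[OF finite_Basis]) (rule Ck_mult[OF Ck_const Ck])
  moreover have "partial v f = (\<lambda>x. \<Sum>i\<in>Basis. (v \<bullet> i) * partial i f x)"
    by (rule ext) (rule partial_sum_Basis[OF assms])
  ultimately show ?thesis by (simp add: smooth_def)
qed

lemma partial_eqI: "(f has_derivative f') (at x) \<Longrightarrow> partial v f x = f' v"
  unfolding partial_def by (simp flip: frechet_derivative_at)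

lemma partial_eq_0_outside:
  assumes "compact K" "\<And>x. x \<notin> K \<Longrightarrow> f x = 0" "x \<notin> K"
  shows "partial v f x = 0"
proof -
  have "(f has_derivative (\<lambda>_. 0)) (at x)"
  proof (rule has_derivative_transform_within_open[of "\<lambda>_. 0" _ _ _ "- K"])
    show "open (- K)" using open_Compl[OF compact_imp_closed[OF assms(1)]] .
  qed (use assms in auto)
  thus ?thesis by (simp add: partial_eqI)
qed

lemma test_function_partial:
  assumes "test_function U f" shows "test_function U (partial v f)"
proof -
  obtain K where K: "compact K" "K \<subseteq> U" "\<And>x. x \<notin> K \<Longrightarrow> f x = 0" and s: "smooth f"
    using assms unfolding test_function_def by metis
  have "partial v f x = 0" if "x \<notin> K" for x
    by (rule partial_eq_0_outside[OF K(1) _ that]) (rule K(3))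
  thus ?thesis
    unfolding test_function_def using K smooth_partial[OF s] by (intro conjI exI[of _ K]) auto
qed

lemma test_function_bounded:
  assumes "test_function U f"
  obtains B where "\<And>x. \<bar>f x\<bar> \<le> B"
proof -
  obtain K where K: "compact K" "\<And>x. x \<notin> K \<Longrightarrow> f x = 0" and s: "smooth f"
    using assms unfolding test_function_def by metis
  obtain B where "B \<ge> 0" "\<And>x. x \<in> K \<Longrightarrow> norm (f x) \<le> B"
    using continuous_on_compact_bound[OF K(1) continuous_on_subset[OF smooth_continuous[OF s]]] by blast
  hence "\<bar>f x\<bar> \<le> B" for x
    using K(2)[of x] by (cases "x \<in> K") auto
  thus ?thesis using that by blast
qed

lemma test_function_reflect:
  assumes "test_function U f" "\<And>x. x \<in> U \<Longrightarrow> z - x \<in> V"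
  shows "test_function V (\<lambda>x. f (z - x))"
proof -
  obtain K where K: "compact K" "K \<subseteq> U" "\<And>x. x \<notin> K \<Longrightarrow> f x = 0" and s: "smooth f"
    using assms unfolding test_function_def by metis
  have "compact ((\<lambda>x. z - x) ` K)"
    by (intro compact_continuous_image K continuous_intros)
  moreover have "(\<lambda>x. z - x) ` K \<subseteq> V" using assms K by blast
  moreover have "f (z - x) = 0" if "x \<notin> (\<lambda>x. z - x) ` K" for x
    using that by (intro K) (force simp: image_iff)
  moreover have "smooth (\<lambda>x. f (z - x))"
    using Ck_compose_affine[of _ f z "-1"] s unfolding smooth_def by simp
  ultimately show ?thesis unfolding test_function_def by blast
qed

lemma partial_reflect:
  assumes "smooth f"
  shows "partial v (\<lambda>x. f (z - x)) = (\<lambda>x. - partial v f (z - x))"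
proof
  fix x
  have "((\<lambda>x. z - x) has_derivative uminus) (at x)"
    by (auto intro!: derivative_eq_intros)
  from has_derivative_compose[OF this smooth_has_derivative[OF assms]]
  have "partial v (\<lambda>x. f (z - x)) x = partial (- v) f (z - x)"
    by (rule partial_eqI)
  also have "\<dots> = - partial v f (z - x)"
    using linear_neg[OF smooth_linear_partial[OF assms]] by blast
  finally show "partial v (\<lambda>x. f (z - x)) x = - partial v f (z - x)" .
qed

lemma partial_minus: "smooth f \<Longrightarrow> partial v (\<lambda>x. - f x) = (\<lambda>x. - partial v f x)"
  by (rule ext, rule partial_eqI) (auto intro!: derivative_eq_intros smooth_has_derivative)

section \<open>Bump functions and the fundamental lemma of the calculus of variations\<close>

text \<open>The functions \<open>exp (- 1/t) t\<^sup>-\<^sup>k\<close>, cut off at \<open>0\<close>. With all negative powers included the family is closed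
under differentiation, so that smoothness at the origin is a plain induction.\<close>

definition flat_exp :: "nat \<Rightarrow> real \<Rightarrow> real" where
  "flat_exp k t = (if t > 0 then exp (- 1 / t) / t ^ k else 0)"

lemma flat_exp_deriv:
  "(flat_exp k has_real_derivative flat_exp (k + 2) t - k * flat_exp (k + 1) t) (at t)"
proof -
  consider "t > 0" | "t < 0" | "t = 0" by linarith
  thus ?thesis
  proof cases
    case 1
    have "((\<lambda>t. exp (- 1 / t) / t ^ k) has_real_derivative flat_exp (k + 2) t - k * flat_exp (k + 1) t) (at t)"
      using 1 apply (auto intro!: derivative_eq_intros simp: flat_exp_def)
      apply (cases k)
       apply (auto simp: field_simps power2_eq_square)
      done
    thus ?thesis
      by (rule has_field_derivative_transform_within_open[of _ _ _ "{0<..}"])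
         (use 1 in \<open>auto simp: flat_exp_def\<close>)
  next
    case 2
    have "((\<lambda>t. 0) has_real_derivative flat_exp (k + 2) t - k * flat_exp (k + 1) t) (at t)"
      using 2 by (auto simp: flat_exp_def)
    thus ?thesis
      by (rule has_field_derivative_transform_within_open[of _ _ _ "{..<0}"])
         (use 2 in \<open>auto simp: flat_exp_def\<close>)
  next
    case 3
    have *: "((\<lambda>h. flat_exp k h / h) \<longlongrightarrow> 0) (at_right 0)"
    proof -
      have "((\<lambda>x::real. x ^ (k+1) / exp x) \<longlongrightarrow> 0) at_top" 
        by (rule tendsto_power_div_exp_0)
      hence "((\<lambda>h::real. (inverse h) ^ (k+1) / exp (inverse h)) \<longlongrightarrow> 0) (at_right 0)"
        by (rule filterlim_compose) (rule filterlim_inverse_at_top_right)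
      thus ?thesis
        by (rule Lim_transform_eventually)
           (auto simp: eventually_at_filter flat_exp_def field_simps exp_minus)
    qed
    moreover have "((\<lambda>h. flat_exp k h / h) \<longlongrightarrow> 0) (at_left 0)"
      by (rule Lim_transform_eventually[of "\<lambda>_. 0"])
         (auto simp: eventually_at_filter flat_exp_def)
    ultimately have "((\<lambda>h. flat_exp k h / h) \<longlongrightarrow> 0) (at 0)"
      by (simp add: filterlim_at_split)
    thus ?thesis using 3 by (simp add: DERIV_def flat_exp_def)
  qed
qed

lemma Ck_flat_exp: "Ck n (flat_exp k)"
proof (induction n arbitrary: k)
  case 0
  thus ?case
    by (auto simp: continuous_on_eq_continuous_at intro: DERIV_isCont[OF flat_exp_deriv])
next
  case (Suc n)
  have "(flat_exp k has_derivative (\<lambda>i. (flat_exp (k + 2) t + (- real k) * flat_exp (k + 1) t) * i)) (at t)" for t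
    using flat_exp_deriv[of k t] by (simp add: has_field_derivative_def)
  moreover have "Ck n (\<lambda>t. (flat_exp (k + 2) t + (- real k) * flat_exp (k + 1) t) * i)" for i
    by (rule Ck_mult[OF Ck_add[OF Suc Ck_mult[OF Ck_const Suc]] Ck_const])
  ultimately show ?case by (rule Ck_SucI)
qed

text \<open>The parameter \<open>n\<close> steepens the bump: since \<open>flat_exp 0 (n t) \<longrightarrow> 1\<close> for \<open>t > 0\<close>, these test functions
increase to the indicator of the open box.\<close>

definition box_bump :: "real \<Rightarrow> 'a::euclidean_space \<Rightarrow> 'a \<Rightarrow> 'a \<Rightarrow> real" where
  "box_bump n a b x = (\<Prod>i\<in>Basis. flat_exp 0 (n * (x \<bullet> i - a \<bullet> i)) * flat_exp 0 (n * (b \<bullet> i - x \<bullet> i)))"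

lemma flat_exp_0_bounds: "0 \<le> flat_exp 0 t" "flat_exp 0 t \<le> 1"
  by (auto simp: flat_exp_def)

lemma flat_exp_0_pos: "t > 0 \<Longrightarrow> 0 < flat_exp 0 t"
  by (auto simp: flat_exp_def)

lemma box_bump_bounds: "0 \<le> box_bump n a b x" "box_bump n a b x \<le> 1"
  unfolding box_bump_def
  by (auto intro!: prod_nonneg prod_le_1 mult_nonneg_nonneg mult_le_one flat_exp_0_bounds)

lemma box_bump_pos: "n > 0 \<Longrightarrow> x \<in> box a b \<Longrightarrow> box_bump n a b x > 0"
  unfolding box_bump_def
  by (auto intro!: prod_pos mult_pos_pos flat_exp_0_pos simp: mem_box)

lemma box_bump_eq_0:
  assumes "x \<notin> box a b" "n \<ge> 0" shows "box_bump n a b x = 0"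
proof -
  obtain i where i: "i \<in> Basis" "x \<bullet> i \<le> a \<bullet> i \<or> b \<bullet> i \<le> x \<bullet> i"
    using assms by (auto simp: mem_box not_less)
  hence "n * (x \<bullet> i - a \<bullet> i) \<le> 0 \<or> n * (b \<bullet> i - x \<bullet> i) \<le> 0"
    using \<open>n \<ge> 0\<close> by (auto intro: mult_nonneg_nonpos)
  hence "flat_exp 0 (n * (x \<bullet> i - a \<bullet> i)) * flat_exp 0 (n * (b \<bullet> i - x \<bullet> i)) = 0"
    by (auto simp: flat_exp_def)
  thus ?thesis unfolding box_bump_def using i(1) by (auto simp: prod_zero_iff)
qed

lemma smooth_box_bump: "smooth (box_bump n a b)"
proof -
  have lin: "Ck m (\<lambda>x::'a. s * (x \<bullet> i) + d)" for m s d and i :: 'a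
    by (intro Ck_add Ck_const Ck_mult Ck_linear bounded_linear_intros)
  have "Ck m (\<lambda>x. \<Prod>i\<in>Basis. flat_exp 0 (n * (x \<bullet> i) + (- n * (a \<bullet> i))) * flat_exp 0 ((- n) * (x \<bullet> i) + n * (b \<bullet> i)))" for m
    by (intro Ck_prod Ck_mult Ck_compose[OF Ck_flat_exp] lin) auto
  moreover have "(\<lambda>x. \<Prod>i\<in>Basis. flat_exp 0 (n * (x \<bullet> i) + (- n * (a \<bullet> i))) * flat_exp 0 ((- n) * (x \<bullet> i) + n * (b \<bullet> i)))
     = box_bump n a b"
    by (auto simp: box_bump_def algebra_simps)
  ultimately show ?thesis unfolding smooth_def by metis
qed

lemma test_function_box_bump:
  assumes "cbox a b \<subseteq> U" "n \<ge> 0" shows "test_function U (box_bump n a b)"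
  unfolding test_function_def
proof (intro conjI exI[of _ "cbox a b"] allI impI)
  fix x assume "x \<notin> cbox a b"
  thus "box_bump n a b x = 0"
    using box_bump_eq_0 assms(2) box_subset_cbox by blast
qed (use assms smooth_box_bump in auto)

lemma box_bump_tendsto:
  assumes "x \<in> box a b"
  shows "(\<lambda>n. box_bump (real n) a b x) \<longlonglongrightarrow> 1"
proof -
  have *: "(\<lambda>n. flat_exp 0 (real n * t)) \<longlonglongrightarrow> 1" if "t > 0" for t
  proof -
    have "(\<lambda>n. exp (- (inverse (real n) / t))) \<longlonglongrightarrow> exp (- (0 / t))"
      by (intro tendsto_intros lim_inverse_n) (use that in auto)
    hence "(\<lambda>n. exp (- (inverse (real n) / t))) \<longlonglongrightarrow> 1" by simp
    thus ?thesis
      by (rule Lim_transform_eventually)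
         (use that in \<open>auto intro!: eventually_mono[OF eventually_gt_at_top[of 0]] simp: flat_exp_def field_simps\<close>)
  qed
  have "(\<lambda>n. box_bump (real n) a b x) \<longlonglongrightarrow> (\<Prod>i\<in>(Basis::'a set). 1 * 1)"
    unfolding box_bump_def
    by (intro tendsto_prod tendsto_mult *) (use assms in \<open>auto simp: mem_box\<close>)
  thus ?thesis by simp
qed

lemma test_function_measurable:
  "test_function U f \<Longrightarrow> f \<in> borel_measurable borel"
  unfolding test_function_def by (auto intro!: borel_measurable_continuous_onI smooth_continuous)

text \<open>Bumps converge boundedly to indicators of boxes, so \<open>f\<close> integrates to \<open>0\<close> over all boxes inside \<open>U\<close>; at
almost every point \<open>f\<close> is the limit of its means over small cubes.\<close>

lemma AE_eq_0_if_test_integrals_0: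
  fixes f :: "'a::euclidean_space \<Rightarrow> real"
  assumes f: "integrable lebesgue f" and "open U"
    and 0: "\<And>\<psi>. test_function U \<psi> \<Longrightarrow> (LINT x|lebesgue. f x * \<psi> x) = 0"
  shows "vanishes_on f U"
proof -
  have box0: "integral (cbox a b) f = 0" if ab: "cbox a b \<subseteq> U" for a b
  proof -
    have [measurable]: "f \<in> borel_measurable lebesgue" using f by auto
    have "(\<lambda>n. LINT x|lebesgue. f x * box_bump (real n) a b x) \<longlonglongrightarrow> (LINT x|lebesgue. f x * indicator (box a b) x)"
    proof (rule integral_dominated_convergence[where w="\<lambda>x. \<bar>f x\<bar>"])
      show "(\<lambda>x. f x * box_bump (real n) a b x) \<in> borel_measurable lebesgue" for n
        using test_function_measurable[OF test_function_box_bump[of a b UNIV "real n"]] 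
        by (intro borel_measurable_times) (auto intro: measurable_completion)
      show "AE x in lebesgue. (\<lambda>n. f x * box_bump (real n) a b x) \<longlonglongrightarrow> f x * indicator (box a b) x"
      proof (intro AE_I2 tendsto_mult tendsto_const)
        fix x show "(\<lambda>n. box_bump (real n) a b x) \<longlonglongrightarrow> indicator (box a b) x"
          using box_bump_tendsto[of x a b] box_bump_eq_0[of x a b] by (cases "x \<in> box a b") auto
      qed
      show "AE x in lebesgue. norm (f x * box_bump (real n) a b x) \<le> \<bar>f x\<bar>" for n
      proof (intro AE_I2)
        fix x
        have "\<bar>f x\<bar> * \<bar>box_bump (real n) a b x\<bar> \<le> \<bar>f x\<bar> * 1"
          using box_bump_bounds[of "real n" a b x] by (intro mult_left_mono) auto
        thus "norm (f x * box_bump (real n) a b x) \<le> \<bar>f x\<bar>" by (simp add: abs_mult)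
      qed
      show "(\<lambda>x. f x * indicator (box a b) x) \<in> borel_measurable lebesgue"
        by (intro borel_measurable_times borel_measurable_indicator) auto
    qed (use f in auto)
    moreover have "(LINT x|lebesgue. f x * box_bump (real n) a b x) = 0" for n
      using ab by (intro 0 test_function_box_bump) auto
    ultimately have "(LINT x|lebesgue. f x * indicator (box a b) x) = 0"
      by (simp add: LIMSEQ_const_iff)
    moreover have "set_integrable lebesgue (box a b) f"
      using f unfolding set_integrable_def by (intro integrable_mult_indicator) auto
    ultimately have "integral (box a b) f = 0"
      using set_lebesgue_integral_eq_integral(2)[of "box a b" f]
      by (simp add: set_lebesgue_integral_def mult.commute)
    thus ?thesis by (simp add: integral_open_interval)
  qed
  have "f absolutely_integrable_on UNIV" using f by (simp add: set_integrable_def)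
  hence "f integrable_on cbox a b" for a b
    by (intro set_lebesgue_integral_eq_integral(1) set_integrable_subset[where A=UNIV and B="cbox a b"]) auto
  from integrable_ccontinuous_explicit[OF this] obtain N where N: "negligible N"
    "\<And>x e. \<lbrakk>x \<notin> N; 0 < e\<rbrakk> \<Longrightarrow> \<exists>d>0. \<forall>h. 0 < h \<and> h < d \<longrightarrow>
       norm(integral (cbox x (x + h *\<^sub>R One)) f /\<^sub>R h ^ DIM('a) - f x) < e" by metis
  have "f x = 0" if x: "x \<in> U" "x \<notin> N" for x
  proof (rule ccontr)
    assume nz: "f x \<noteq> 0"
    obtain d where d: "d > 0" "\<And>h. 0 < h \<Longrightarrow> h < d \<Longrightarrow> 
      norm(integral (cbox x (x + h *\<^sub>R One)) f /\<^sub>R h ^ DIM('a) - f x) < \<bar>f x\<bar>"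
      using N(2)[OF x(2), of "\<bar>f x\<bar>"] nz by auto
    obtain e where e: "e > 0" "cball x e \<subseteq> U" 
      using \<open>open U\<close> x(1) open_contains_cball by blast
    define h where "h = min (d/2) (e / DIM('a))"
    have h: "0 < h" "h < d" "h * DIM('a) \<le> e"
      using d e by (auto simp: h_def field_simps min_def)
    have "cbox x (x + h *\<^sub>R One) \<subseteq> cball x e"
    proof
      fix y assume y: "y \<in> cbox x (x + h *\<^sub>R One)"
      have "norm (y - x) \<le> (\<Sum>i\<in>Basis. \<bar>(y - x) \<bullet> i\<bar>)" by (rule norm_le_l1)
      also have "\<dots> \<le> (\<Sum>i\<in>(Basis::'a set). h)"
        using y by (intro sum_mono) (auto simp: mem_box algebra_simps abs_if)
      also have "\<dots> \<le> e" using h by (simp add: mult.commute)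
      finally show "y \<in> cball x e" by (simp add: dist_norm norm_minus_commute)
    qed
    hence "integral (cbox x (x + h *\<^sub>R One)) f = 0" using box0 e by blast
    with d(2)[OF h(1,2)] show False by simp
  qed
  hence "{x. \<not> (x \<in> U \<longrightarrow> f x = 0)} \<subseteq> N" by auto
  thus ?thesis
    using N(1) negligible_subset by (intro AE_I'[of N]) (auto simp: negligible_iff_null_sets)
qed

section \<open>Directional derivatives and convolutions\<close>

text \<open>Derivatives along lines suffice for the integrations by parts and for Taylor's formula, and they pass
through an integral without any discussion of total differentiability.\<close>

definition dir_deriv :: "'a::euclidean_space \<Rightarrow> ('a \<Rightarrow> real) \<Rightarrow> ('a \<Rightarrow> real) \<Rightarrow> bool" where
  "dir_deriv v g g' \<longleftrightarrow> (\<forall>x. ((\<lambda>t. g (x + t *\<^sub>R v)) has_real_derivative g' x) (at 0))"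

lemma dir_deriv_line:
  assumes "dir_deriv v g g'"
  shows "((\<lambda>t. g (x + t *\<^sub>R v)) has_real_derivative g' (x + t *\<^sub>R v)) (at t)"
proof -
  have "((\<lambda>s. g ((x + t *\<^sub>R v) + s *\<^sub>R v)) has_real_derivative g' (x + t *\<^sub>R v)) (at 0)"
    using assms unfolding dir_deriv_def by blast
  hence "((\<lambda>s. g (x + (s + t) *\<^sub>R v)) has_real_derivative g' (x + t *\<^sub>R v)) (at 0)"
    by (simp add: algebra_simps)
  thus ?thesis
    using DERIV_shift[of "\<lambda>t. g (x + t *\<^sub>R v)" "g' (x + t *\<^sub>R v)" 0 t] by simp
qed

lemma dir_deriv_smooth:
  assumes "smooth f" shows "dir_deriv v f (partial v f)"
  unfolding dir_deriv_def
proof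
  fix x
  have "((\<lambda>t. x + t *\<^sub>R v) has_derivative (\<lambda>t. t *\<^sub>R v)) (at (0::real))"
    by (auto intro!: derivative_eq_intros)
  moreover have "(f has_derivative (\<lambda>w. partial w f x)) (at (x + 0 *\<^sub>R v))"
    using smooth_has_derivative[OF assms] by simp
  ultimately have "((\<lambda>t. f (x + t *\<^sub>R v)) has_derivative (\<lambda>t. partial (t *\<^sub>R v) f x)) (at 0)"
    by (rule has_derivative_compose)
  thus "((\<lambda>t. f (x + t *\<^sub>R v)) has_real_derivative partial v f x) (at 0)"
    by (simp add: has_field_derivative_def linear_cmul[OF smooth_linear_partial[OF assms]] mult.commute[of _ "partial v f x"])
qed

lemma dir_deriv_quadratic_bound:
  assumes g: "dir_deriv v g g1" "dir_deriv v g1 g2" and B: "\<And>x. \<bar>g2 x\<bar> \<le> B"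
  shows "\<bar>g (x + s *\<^sub>R v) - g x - s * g1 x\<bar> \<le> B * s\<^sup>2"
proof -
  have mv: "\<bar>g1 (x + r *\<^sub>R v) - g1 x\<bar> \<le> B * \<bar>r\<bar>" for r
  proof -
    have "norm (g1 (x + r *\<^sub>R v) - g1 (x + 0 *\<^sub>R v)) \<le> B * norm (r - 0)"
    proof (rule field_differentiable_bound[where S=UNIV and f="\<lambda>t. g1 (x + t *\<^sub>R v)"])
      show "((\<lambda>t. g1 (x + t *\<^sub>R v)) has_field_derivative g2 (x + t *\<^sub>R v)) (at t within UNIV)" for t
        using dir_deriv_line[OF g(2)] by simp
    qed (use B in auto)
    thus ?thesis by simp
  qed
  define S where "S = {- \<bar>s\<bar> .. \<bar>s\<bar>}"
  have "norm ((g (x + s *\<^sub>R v) - s * g1 x) - (g (x + 0 *\<^sub>R v) - 0 * g1 x)) \<le> (B * \<bar>s\<bar>) * norm (s - 0)"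
  proof (rule field_differentiable_bound[where S=S and f="\<lambda>t. g (x + t *\<^sub>R v) - t * g1 x"])
    show "((\<lambda>t. g (x + t *\<^sub>R v) - t * g1 x) has_field_derivative g1 (x + t *\<^sub>R v) - g1 x) (at t within S)" for t
      using has_field_derivative_at_within[OF dir_deriv_line[OF g(1)]]
      by (auto intro!: derivative_eq_intros)
    show "norm (g1 (x + t *\<^sub>R v) - g1 x) \<le> B * \<bar>s\<bar>" if "t \<in> S" for t
    proof -
      have "B \<ge> 0" using B[of x] by linarith
      hence "B * \<bar>t\<bar> \<le> B * \<bar>s\<bar>" using that by (intro mult_left_mono) (auto simp: S_def)
      with mv[of t] show ?thesis by simp
    qed
  qed (auto simp: S_def)
  thus ?thesis by (simp add: power2_eq_square algebra_simps abs_mult_self_eq) 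
qed

lemma has_derivative_if_quadratic_bound:
  fixes F :: "real \<Rightarrow> real"
  assumes "\<And>y. y \<in> S \<Longrightarrow> \<bar>F y - F x - (y - x) * D\<bar> \<le> C * (y - x)\<^sup>2"
  shows "(F has_real_derivative D) (at x within S)"
proof -
  have "((\<lambda>y. (F y - F x) / (y - x) - D) \<longlongrightarrow> 0) (at x within S)"
  proof (rule Lim_null_comparison[where g="\<lambda>y. C * \<bar>y - x\<bar>"])
    show "\<forall>\<^sub>F y in at x within S. norm ((F y - F x) / (y - x) - D) \<le> C * \<bar>y - x\<bar>"
    proof (unfold eventually_at_filter, intro always_eventually allI impI)
      fix y assume y: "y \<noteq> x" "y \<in> S"
      hence "(F y - F x) / (y - x) - D = (F y - F x - (y - x) * D) / (y - x)"
        by (simp add: field_simps)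
      also have "\<bar>\<dots>\<bar> \<le> C * (y - x)\<^sup>2 / \<bar>y - x\<bar>"
        unfolding abs_divide using assms[OF y(2)] by (intro divide_right_mono) auto
      also have "\<dots> = C * \<bar>y - x\<bar>" using y by (simp add: power2_eq_square abs_if field_simps)
      finally show "norm ((F y - F x) / (y - x) - D) \<le> C * \<bar>y - x\<bar>" by simp
    qed
    show "((\<lambda>y. C * \<bar>y - x\<bar>) \<longlongrightarrow> 0) (at x within S)"
      by (auto intro!: tendsto_eq_intros)
  qed
  thus ?thesis
    unfolding has_field_derivative_iff by (rule Lim_null[THEN iffD2])
qed

definition conv :: "('a::euclidean_space \<Rightarrow> real) \<Rightarrow> ('a \<Rightarrow> real) \<Rightarrow> 'a \<Rightarrow> real" where
  "conv f g z = (LINT x|lebesgue. f x * g (z - x))"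

lemma continuous_measurable_lebesgue:
  fixes g :: "'a::euclidean_space \<Rightarrow> real"
  assumes "continuous_on UNIV g"
  shows "(\<lambda>x. g (z - x)) \<in> borel_measurable lebesgue" "g \<in> borel_measurable lebesgue"
proof -
  have "g \<in> borel_measurable borel" using assms by (rule borel_measurable_continuous_onI)
  hence "g \<in> borel_measurable lborel" "(\<lambda>x. g (z - x)) \<in> borel_measurable lborel" by simp_all
  thus "(\<lambda>x. g (z - x)) \<in> borel_measurable lebesgue" "g \<in> borel_measurable lebesgue"
    by (auto intro: measurable_completion)
qed

lemma integrable_mult_bounded_continuous:
  fixes f :: "'a::euclidean_space \<Rightarrow> real"
  assumes f: "integrable lebesgue f" and g: "continuous_on UNIV g" "\<And>x. \<bar>g x\<bar> \<le> B"
  shows "integrable lebesgue (\<lambda>x. f x * g (z - x))"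
proof (rule Bochner_Integration.integrable_bound)
  show "integrable lebesgue (\<lambda>x. B * \<bar>f x\<bar>)" using f by auto
  show "(\<lambda>x. f x * g (z - x)) \<in> borel_measurable lebesgue"
    using continuous_measurable_lebesgue[OF g(1)] f by (intro borel_measurable_times) auto
  have "\<bar>f x\<bar> * \<bar>g (z - x)\<bar> \<le> \<bar>f x\<bar> * B" for x by (intro mult_left_mono g) auto
  moreover have "B \<ge> 0" using g(2)[of 0] by linarith
  ultimately show "AE x in lebesgue. norm (f x * g (z - x)) \<le> norm (B * \<bar>f x\<bar>)"
    by (simp add: abs_mult mult.commute)
qed

lemma conv_bounded:
  assumes f: "integrable lebesgue f" and g: "continuous_on UNIV g" "\<And>x. \<bar>g x\<bar> \<le> B"
  shows "\<bar>conv f g z\<bar> \<le> B * (LINT x|lebesgue. \<bar>f x\<bar>)"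
proof -
  have "\<bar>conv f g z\<bar> \<le> (LINT x|lebesgue. \<bar>f x * g (z - x)\<bar>)"
    unfolding conv_def by (rule integral_abs_bound)
  also have "\<dots> \<le> (LINT x|lebesgue. B * \<bar>f x\<bar>)"
  proof (rule integral_mono)
    show "\<bar>f x * g (z - x)\<bar> \<le> B * \<bar>f x\<bar>" for x
      using mult_right_mono[OF g(2), of "\<bar>f x\<bar>" "z - x"] by (simp add: abs_mult mult.commute)
  qed (use integrable_mult_bounded_continuous[OF assms] f in auto)
  finally show ?thesis by simp
qed

lemma continuous_conv:
  assumes f: "integrable lebesgue f" and g: "continuous_on UNIV g" "\<And>x. \<bar>g x\<bar> \<le> B"
  shows "continuous_on UNIV (conv f g)"
  unfolding continuous_on_sequentially comp_def
proof (intro allI ballI impI)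
  fix X :: "nat \<Rightarrow> 'a" and z assume X: "(\<forall>n. X n \<in> UNIV) \<and> X \<longlonglongrightarrow> z"
  show "(\<lambda>n. conv f g (X n)) \<longlonglongrightarrow> conv f g z"
    unfolding conv_def
  proof (rule integral_dominated_convergence[where w="\<lambda>x. B * \<bar>f x\<bar>"])
    show "(\<lambda>x. f x * g (z - x)) \<in> borel_measurable lebesgue" for z
      using integrable_mult_bounded_continuous[OF assms] by auto
    show "(\<lambda>x. f x * g (X n - x)) \<in> borel_measurable lebesgue" for n
      using integrable_mult_bounded_continuous[OF assms] by auto
    show "AE x in lebesgue. (\<lambda>n. f x * g (X n - x)) \<longlonglongrightarrow> f x * g (z - x)"
    proof (intro AE_I2 tendsto_mult tendsto_const)
      fix x
      have "isCont g (z - x)" using g(1) by (simp add: continuous_on_eq_continuous_at)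
      moreover have "(\<lambda>n. X n - x) \<longlonglongrightarrow> z - x" using X by (intro tendsto_diff) auto
      ultimately show "(\<lambda>n. g (X n - x)) \<longlonglongrightarrow> g (z - x)" by (rule isCont_tendsto_compose)
    qed
    show "AE x in lebesgue. norm (f x * g (X n - x)) \<le> B * \<bar>f x\<bar>" for n
    proof (intro AE_I2)
      fix x show "norm (f x * g (X n - x)) \<le> B * \<bar>f x\<bar>"
        using mult_right_mono[OF g(2), of "\<bar>f x\<bar>" "X n - x"] by (simp add: abs_mult mult.commute)
    qed
  qed (use f in auto)
qed

text \<open>The second derivative of \<open>g\<close> gives an error term quadratic in the step, uniformly in \<open>x\<close>; integrated
against \<open>f\<close> it stays quadratic. The lemma is used twice: for \<open>f\<close> integrated
against a test function and for a cut-off function integrated against the resulting smooth function.\<close>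

lemma dir_deriv_conv:
  assumes f: "integrable lebesgue f"
    and g: "continuous_on UNIV g" "\<And>x. \<bar>g x\<bar> \<le> B" 
    and g1: "continuous_on UNIV g1" "\<And>x. \<bar>g1 x\<bar> \<le> B1" 
    and g2: "\<And>x. \<bar>g2 x\<bar> \<le> B2" 
    and d: "dir_deriv v g g1" "dir_deriv v g1 g2"
  shows "dir_deriv v (conv f g) (conv f g1)"
  unfolding dir_deriv_def
proof
  fix z
  let ?F = "\<lambda>s. conv f g (z + s *\<^sub>R v)"
  have "\<bar>?F s - ?F 0 - s * conv f g1 z\<bar> \<le> (B2 * (LINT x|lebesgue. \<bar>f x\<bar>)) * s\<^sup>2" for s
  proof -
    note i = integrable_mult_bounded_continuous[OF f g] integrable_mult_bounded_continuous[OF f g1]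
    have eq: "?F s - ?F 0 - s * conv f g1 z =
       (LINT x|lebesgue. f x * g (z + s *\<^sub>R v - x) - f x * g (z - x) - s * (f x * g1 (z - x)))"
      using i by (simp add: conv_def)
    have "\<bar>?F s - ?F 0 - s * conv f g1 z\<bar> \<le> (LINT x|lebesgue. \<bar>f x * g (z + s *\<^sub>R v - x) - f x * g (z - x) - s * (f x * g1 (z - x))\<bar>)"
      unfolding eq by (rule integral_abs_bound)
    also have "\<dots> \<le> (LINT x|lebesgue. B2 * s\<^sup>2 * \<bar>f x\<bar>)"
    proof (rule integral_mono)
      fix x
      have "f x * g (z + s *\<^sub>R v - x) - f x * g (z - x) - s * (f x * g1 (z - x)) = 
         f x * (g ((z - x) + s *\<^sub>R v) - g (z - x) - s * g1 (z - x))"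
        by (simp add: algebra_simps)
      also have "\<bar>\<dots>\<bar> \<le> \<bar>f x\<bar> * (B2 * s\<^sup>2)"
        unfolding abs_mult by (intro mult_left_mono dir_deriv_quadratic_bound[OF d g2]) auto
      finally show "\<bar>f x * g (z + s *\<^sub>R v - x) - f x * g (z - x) - s * (f x * g1 (z - x))\<bar> \<le> B2 * s\<^sup>2 * \<bar>f x\<bar>"
        by (simp add: mult.commute)
    qed (use i f in auto)
    finally show ?thesis by (simp add: algebra_simps)
  qed
  hence "(?F has_real_derivative conv f g1 z) (at 0 within UNIV)"
    by (intro has_derivative_if_quadratic_bound) simp
  thus "(?F has_real_derivative conv f g1 z) (at 0)" by simp
qed

section \<open>A weighted Caccioppoli inequality\<close>

lemma lborel_integral_reflect:
  fixes f :: "'a::euclidean_space \<Rightarrow> real"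
  assumes [measurable]: "f \<in> borel_measurable borel"
  shows "(LBINT x. f (z - x)) = (LBINT x. f x)"
proof -
  have "(lborel :: 'a measure) = density (distr lborel borel (\<lambda>x. z + (-1) *\<^sub>R x)) (\<lambda>_. 1)"
    using lborel_affine[of "-1" z] by simp
  hence eq: "distr lborel borel (\<lambda>x. z - x) = (lborel :: 'a measure)"
    by (simp add: density_1)
  have "(LBINT x. f x) = (LINT x|distr lborel borel (\<lambda>x. z - x). f x)"
    unfolding eq ..
  also have "\<dots> = (LBINT x. f (z - x))" by (rule integral_distr) auto
  finally show ?thesis by simp
qed

lemma lborel_integral_translate:
  fixes f :: "'a::euclidean_space \<Rightarrow> real"
  assumes [measurable]: "f \<in> borel_measurable borel"
  shows "(LBINT x. f (x + a)) = (LBINT x. f x)"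
  using lborel_integral_reflect[of "\<lambda>y. f (a - y)" 0] lborel_integral_reflect[of f a]
  by (simp add: add.commute)

lemma integrable_cball_support:
  fixes f :: "'a::euclidean_space \<Rightarrow> real"
  assumes "continuous_on UNIV f" "\<And>x. x \<notin> cball c R \<Longrightarrow> f x = 0"
  shows "integrable lborel f"
proof -
  have "integrable lborel (\<lambda>x. indicator (cball c R) x *\<^sub>R f x)"
    by (intro borel_integrable_compact continuous_on_subset[OF assms(1)]) auto
  moreover have "(\<lambda>x. indicator (cball c R) x *\<^sub>R f x) = f"
  proof
    fix x show "indicator (cball c R) x *\<^sub>R f x = f x"
      using assms(2)[of x] by (cases "x \<in> cball c R") auto
  qed
  ultimately show ?thesis by (simp only:)
qed

lemma integrable_ball_continuous:
  fixes f :: "'a::euclidean_space \<Rightarrow> real"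
  assumes "continuous_on UNIV f"
  shows "integrable lborel (\<lambda>x. indicator (ball c R) x * f x)"
proof -
  have "integrable lborel (\<lambda>x. indicator (cball c R) x *\<^sub>R f x)"
    by (intro borel_integrable_compact continuous_on_subset[OF assms(1)]) auto
  hence "integrable lborel (\<lambda>x. indicator (ball c R) x *\<^sub>R (indicator (cball c R) x *\<^sub>R f x))"
    by (rule integrable_mult_indicator[rotated]) simp
  moreover have "(\<lambda>x. indicator (ball c R) x *\<^sub>R (indicator (cball c R) x *\<^sub>R f x)) = (\<lambda>x. indicator (ball c R) x * f x)"
  proof
    fix x show "indicator (ball c R) x *\<^sub>R (indicator (cball c R) x *\<^sub>R f x) = indicator (ball c R) x * f x"
      by (cases "x \<in> ball c R") auto
  qed
  ultimately show ?thesis by (simp only:)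
qed

text \<open>The integral of \<open>F\<close> is invariant under translation along \<open>v\<close>, hence the difference quotients of \<open>F\<close> all
have integral \<open>0\<close>.\<close>

lemma integral_dir_deriv_eq_0:
  fixes F F' :: "'a::euclidean_space \<Rightarrow> real"
  assumes d: "dir_deriv v F F'" and cont: "continuous_on UNIV F" "continuous_on UNIV F'"
    and supp: "\<And>x. x \<notin> cball c R \<Longrightarrow> F x = 0" "\<And>x. x \<notin> cball c R \<Longrightarrow> F' x = 0"
  shows "(LBINT x. F' x) = 0"
proof -
  obtain K where K0: "K \<ge> 0" "\<And>x. x \<in> cball c R \<Longrightarrow> norm (F' x) \<le> K"
    using continuous_on_compact_bound[OF compact_cball continuous_on_subset[OF cont(2)]] by blast
  have K: "\<bar>F' x\<bar> \<le> K" for x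
    using K0 supp(2)[of x] by (cases "x \<in> cball c R") auto
  have [measurable]: "F \<in> borel_measurable borel" "F' \<in> borel_measurable borel"
    using cont by (auto intro: borel_measurable_continuous_onI)
  define e where "e n = inverse (real (Suc n))" for n
  have e: "0 < e n" "e n \<le> 1" for n by (auto simp: e_def field_simps)
  define h where "h n x = (F (x + e n *\<^sub>R v) - F x) / e n" for n x
  have "(\<lambda>n. LBINT x. h n x) \<longlonglongrightarrow> (LBINT x. F' x)"
  proof (rule integral_dominated_convergence[where w="\<lambda>x. K * indicator (cball c (R + norm v)) x"])
    show "h n \<in> borel_measurable lborel" for n unfolding h_def by measurable
    show "integrable lborel (\<lambda>x. K * indicator (cball c (R + norm v)) x)"
      by (intro integrable_mult_right integrable_real_indicator emeasure_bounded_finite) auto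
    show "AE x in lborel. (\<lambda>n. h n x) \<longlonglongrightarrow> F' x"
    proof (intro AE_I2)
      fix x
      have "((\<lambda>s. (F (x + s *\<^sub>R v) - F x) / s) \<longlongrightarrow> F' x) (at 0)"
        using d unfolding dir_deriv_def DERIV_def by simp
      moreover have "filterlim e (at 0) sequentially"
        unfolding filterlim_at using e LIMSEQ_inverse_real_of_nat by (auto simp: e_def[abs_def])
      ultimately show "(\<lambda>n. h n x) \<longlonglongrightarrow> F' x"
        unfolding h_def by (rule filterlim_compose)
    qed
    show "AE x in lborel. norm (h n x) \<le> K * indicator (cball c (R + norm v)) x" for n
    proof (intro AE_I2)
      fix x
      show "norm (h n x) \<le> K * indicator (cball c (R + norm v)) x"
      proof (cases "x \<in> cball c (R + norm v)")
        case True
        have "norm (F (x + e n *\<^sub>R v) - F (x + 0 *\<^sub>R v)) \<le> K * norm (e n - 0)"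
        proof (rule field_differentiable_bound[where S=UNIV and f="\<lambda>t. F (x + t *\<^sub>R v)"])
          show "((\<lambda>t. F (x + t *\<^sub>R v)) has_field_derivative F' (x + t *\<^sub>R v)) (at t within UNIV)" for t
            using dir_deriv_line[OF d] by simp
        qed (use K in auto)
        thus ?thesis using True e[of n] by (simp add: h_def field_simps)
      next
        case False
        have "norm (e n *\<^sub>R v) \<le> norm v" using e[of n] by (simp add: mult_left_le_one_le)
        moreover have "norm (x - c) \<le> norm (x + e n *\<^sub>R v - c) + norm (e n *\<^sub>R v)"
          using norm_triangle_ineq4[of "x + e n *\<^sub>R v - c" "e n *\<^sub>R v"] by (simp add: algebra_simps)
        ultimately have "x \<notin> cball c R" "x + e n *\<^sub>R v \<notin> cball c R"
          using False norm_ge_zero[of v] by (auto simp: dist_norm norm_minus_commute simp del: norm_ge_zero)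
        thus ?thesis using supp False by (simp add: h_def)
      qed
    qed
  qed measurable
  moreover have "(LBINT x. h n x) = 0" for n
  proof -
    have F: "integrable lborel F" by (rule integrable_cball_support[OF cont(1) supp(1)])
    have "integrable lborel (\<lambda>x. F (x + e n *\<^sub>R v))"
    proof (rule integrable_cball_support)
      show "continuous_on UNIV (\<lambda>x. F (x + e n *\<^sub>R v))"
        by (rule continuous_on_compose2[OF cont(1)]) (auto intro!: continuous_intros)
      show "F (x + e n *\<^sub>R v) = 0" if "x \<notin> cball (c - e n *\<^sub>R v) R" for x
        using that by (intro supp) (auto simp: dist_norm algebra_simps)
    qed
    thus ?thesis
      using F by (simp add: h_def lborel_integral_translate)
  qed
  ultimately show ?thesis by (simp add: LIMSEQ_const_iff)
qed

text \<open>Powers of this weight serve as cut-off functions. The gradient of \<open>ball_weight\<^sup>m\<close> costs exactly one power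
of the weight and a factor \<open>m\<close>, so no nested sequence of balls has to be chosen.\<close>

definition ball_weight :: "'a::euclidean_space \<Rightarrow> real \<Rightarrow> 'a \<Rightarrow> real" where
  "ball_weight c R x = max 0 (R\<^sup>2 - (norm (x - c))\<^sup>2)"

lemma continuous_ball_weight: "continuous_on UNIV (ball_weight c R)"
  unfolding ball_weight_def by (intro continuous_intros)

lemma ball_weight_nonneg: "0 \<le> ball_weight c R x"
  by (simp add: ball_weight_def)

lemma ball_weight_le: "ball_weight c R x \<le> R\<^sup>2"
  by (simp add: ball_weight_def)

lemma ball_weight_eq_0: "R > 0 \<Longrightarrow> x \<notin> ball c R \<Longrightarrow> ball_weight c R x = 0"
  using power_mono[of R "norm (x - c)" 2]
  by (auto simp: ball_weight_def dist_norm norm_minus_commute)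

lemma DERIV_max_power:
  "((\<lambda>s. (max 0 s) ^ (n + 2)) has_real_derivative real (n + 2) * (max 0 s) ^ (n + 1)) (at s)"
proof -
  consider "s > 0" | "s < 0" | "s = 0" by linarith
  thus ?thesis
  proof cases
    case 1
    have "((\<lambda>s. s ^ (n + 2)) has_real_derivative real (n + 2) * (max 0 s) ^ (n + 1)) (at s)"
      using 1 DERIV_pow[of "n + 2" s] by simp
    thus ?thesis
      by (rule has_field_derivative_transform_within_open[of _ _ _ "{0<..}"]) (use 1 in auto)
  next
    case 2
    have "((\<lambda>s. 0) has_real_derivative real (n + 2) * (max 0 s) ^ (n + 1)) (at s)"
      using 2 by simp
    thus ?thesis
      by (rule has_field_derivative_transform_within_open[of _ _ _ "{..<0}"]) (use 2 in auto)
  next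
    case 3
    have "((\<lambda>h. (max 0 (0 + h) ^ (n + 2) - max 0 0 ^ (n + 2)) / h) \<longlongrightarrow> 0) (at (0::real))"
    proof (rule Lim_null_comparison[where g="\<lambda>h. \<bar>h\<bar> ^ (n + 1)"])
      show "\<forall>\<^sub>F h in at 0. norm ((max 0 (0 + h) ^ (n + 2) - max 0 0 ^ (n + 2)) / h) \<le> \<bar>h\<bar> ^ (n + 1)"
        by (rule always_eventually) (auto simp: max_def abs_mult power_abs intro!: mult_nonpos_nonneg)
      show "((\<lambda>h. \<bar>h\<bar> ^ (n + 1)) \<longlongrightarrow> 0) (at (0::real))"
        by (auto intro!: tendsto_eq_intros)
    qed
    thus ?thesis using 3 by (simp add: DERIV_def)
  qed
qed

lemma dir_deriv_ball_weight_power: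
  "dir_deriv v (\<lambda>x. ball_weight c R x ^ (n + 2))
     (\<lambda>x. real (n + 2) * ball_weight c R x ^ (n + 1) * (- 2 * ((x - c) \<bullet> v)))"
  unfolding dir_deriv_def
proof
  fix x
  let ?q = "\<lambda>t. R\<^sup>2 - (norm (x + t *\<^sub>R v - c))\<^sup>2"
  have "?q = (\<lambda>t. R\<^sup>2 - ((x - c) \<bullet> (x - c) + 2 * t * ((x - c) \<bullet> v) + t\<^sup>2 * (v \<bullet> v)))"
    unfolding power2_norm_eq_inner
    by (rule ext) (simp add: inner_simps inner_commute power2_eq_square algebra_simps)
  moreover have "(\<dots> has_real_derivative - 2 * ((x - c) \<bullet> v)) (at 0)"
    by (auto intro!: derivative_eq_intros)
  ultimately have q: "(?q has_real_derivative - 2 * ((x - c) \<bullet> v)) (at 0)" by simp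
  show "((\<lambda>t. ball_weight c R (x + t *\<^sub>R v) ^ (n + 2)) has_real_derivative
     real (n + 2) * ball_weight c R x ^ (n + 1) * (- 2 * ((x - c) \<bullet> v))) (at 0)"
    using DERIV_chain2[OF DERIV_max_power q, of n] by (simp add: ball_weight_def)
qed

text \<open>The algebra behind the energy estimate. Here \<open>r\<close> stands for the weight, \<open>Q\<close> for the squared gradient of
\<open>u\<close>, and \<open>X\<close> for its product with the position vector relative to the centre; the cross term is
absorbed by \<open>2 s t \<le> s\<^sup>2 + t\<^sup>2\<close>.\<close>

lemma caccioppoli_pointwise:
  fixes u R r X Q lam m :: real
  assumes R: "R > 0" and r: "0 \<le> r" "r \<le> R\<^sup>2" and X: "X\<^sup>2 \<le> R\<^sup>2 * Q" and lam: "lam \<ge> 0"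
  shows "r\<^sup>2 * Q / 2 \<le> (- 4 * m * r * u * X + r\<^sup>2 * (Q - lam * u\<^sup>2)) + (lam * R ^ 4 + 8 * m\<^sup>2 * R\<^sup>2) * u\<^sup>2"
proof -
  have "0 \<le> (r * X / R - 4 * m * R * u)\<^sup>2" by simp
  also have "\<dots> = r\<^sup>2 * (X\<^sup>2 / R\<^sup>2) - 8 * m * r * u * X + 16 * m\<^sup>2 * R\<^sup>2 * u\<^sup>2"
    using R by (simp add: power2_eq_square field_simps)
  also have "r\<^sup>2 * (X\<^sup>2 / R\<^sup>2) \<le> r\<^sup>2 * Q"
    using X R by (intro mult_left_mono) (auto simp: field_simps)
  finally have 1: "4 * m * r * u * X \<le> r\<^sup>2 * Q / 2 + 8 * m\<^sup>2 * R\<^sup>2 * u\<^sup>2" by simp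
  have "r\<^sup>2 \<le> (R\<^sup>2)\<^sup>2" using r by (intro power_mono)
  hence "lam * u\<^sup>2 * r\<^sup>2 \<le> lam * u\<^sup>2 * R ^ 4"
    using lam by (intro mult_left_mono) auto
  with 1 show ?thesis by (simp add: algebra_simps)
qed

text \<open>Testing the equation with \<open>ball_weight\<^sup>2\<^sup>k\<^sup>+\<^sup>2 u\<close>. For \<open>k = 0\<close> the weight on the
right has power \<open>0\<close> and does not localise to the ball by itself, hence the indicator.\<close>

lemma caccioppoli:
  fixes u :: "'a::euclidean_space \<Rightarrow> real" and u1 u2 :: "'a \<Rightarrow> 'a \<Rightarrow> real"
  assumes cont: "continuous_on UNIV u" "\<And>i. i \<in> Basis \<Longrightarrow> continuous_on UNIV (u1 i)" 
      "\<And>i. i \<in> Basis \<Longrightarrow> continuous_on UNIV (u2 i)"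
    and d: "\<And>i. i \<in> Basis \<Longrightarrow> dir_deriv i u (u1 i)" "\<And>i. i \<in> Basis \<Longrightarrow> dir_deriv i (u1 i) (u2 i)"
    and pde: "\<And>x. x \<in> ball c R \<Longrightarrow> (\<Sum>i\<in>Basis. u2 i x) = - lam * u x"
    and lam: "lam \<ge> 0" and R: "R > 0"
  shows "(LBINT x. ball_weight c R x ^ (2 * k + 2) * (\<Sum>i\<in>Basis. (u1 i x)\<^sup>2))
    \<le> (2 * lam * R ^ 4 + 16 * (real (k + 1))\<^sup>2 * R\<^sup>2) *
      (LBINT x. indicator (ball c R) x * (ball_weight c R x ^ (2 * k) * (u x)\<^sup>2))"
proof -
  let ?\<rho> = "ball_weight c R" and ?m = "real (k + 1)"
  define F where "F i x = ?\<rho> x ^ (2 * k + 2) * (u x * u1 i x)" for i x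
  define F' where "F' i x = ?\<rho> x ^ (2 * k + 2) * (u1 i x * u1 i x + u x * u2 i x) +
     real (2 * k + 2) * ?\<rho> x ^ (2 * k + 1) * (- 2 * ((x - c) \<bullet> i)) * (u x * u1 i x)" for i x
  let ?e = "\<lambda>x. indicator (ball c R) x * (?\<rho> x ^ (2 * k) * (u x)\<^sup>2)"
  let ?C = "lam * R ^ 4 + 8 * ?m\<^sup>2 * R\<^sup>2"
  have F'cont: "continuous_on UNIV (F' i)" if "i \<in> Basis" for i
    unfolding F'_def using cont that by (intro continuous_intros continuous_ball_weight) auto
  have out: "F i x = 0" "F' i x = 0" if "x \<notin> cball c R" for i x
    using that ball_weight_eq_0[OF R, of x c] by (auto simp: F_def F'_def)
  have F'0: "(LBINT x. F' i x) = 0" if i: "i \<in> Basis" for i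
  proof (rule integral_dir_deriv_eq_0)
    show "dir_deriv i (F i) (F' i)"
      unfolding dir_deriv_def
    proof
      fix x
      have "((\<lambda>t. ?\<rho> (x + t *\<^sub>R i) ^ (2 * k + 2) * (u (x + t *\<^sub>R i) * u1 i (x + t *\<^sub>R i))) has_real_derivative
         (real (2 * k + 2) * ?\<rho> x ^ (2 * k + 1) * (- 2 * ((x - c) \<bullet> i))) * (u (x + 0 *\<^sub>R i) * u1 i (x + 0 *\<^sub>R i))
         + (u1 i x * u1 i (x + 0 *\<^sub>R i) + u2 i x * u (x + 0 *\<^sub>R i)) * ?\<rho> (x + 0 *\<^sub>R i) ^ (2 * k + 2)) (at 0)"
        using dir_deriv_ball_weight_power[of i c R "2 * k"] d[OF i]
        unfolding dir_deriv_def by (intro DERIV_mult) auto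
      thus "((\<lambda>t. F i (x + t *\<^sub>R i)) has_real_derivative F' i x) (at 0)"
        by (simp add: F_def F'_def algebra_simps)
    qed
    show "continuous_on UNIV (F i)"
      unfolding F_def using cont i by (intro continuous_intros continuous_ball_weight) auto
  qed (use out F'cont i in auto)
  have F'int: "integrable lborel (F' i)" if "i \<in> Basis" for i
    by (rule integrable_cball_support[OF F'cont[OF that] out(2)])
  have pw: "?\<rho> x ^ (2 * k + 2) * (\<Sum>i\<in>Basis. (u1 i x)\<^sup>2) / 2 \<le>
      (\<Sum>i\<in>Basis. F' i x) + ?C * ?e x" for x
  proof (cases "x \<in> ball c R")
    case False
    thus ?thesis using ball_weight_eq_0[OF R False] by (simp add: F'_def)
  next
    case True
    define Q where "Q = (\<Sum>i\<in>Basis. (u1 i x)\<^sup>2)"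
    define X where "X = (\<Sum>i\<in>Basis. ((x - c) \<bullet> i) * u1 i x)"
    have "X\<^sup>2 \<le> (\<Sum>i\<in>Basis. ((x - c) \<bullet> i)\<^sup>2) * Q"
      unfolding X_def Q_def by (rule Cauchy_Schwarz_ineq_sum)
    also have "(\<Sum>i\<in>Basis. ((x - c) \<bullet> i)\<^sup>2) = (norm (x - c))\<^sup>2"
      unfolding power2_norm_eq_inner by (subst euclidean_inner) (simp add: power2_eq_square)
    also have "(norm (x - c))\<^sup>2 * Q \<le> R\<^sup>2 * Q"
      using True by (intro mult_right_mono power_mono) (auto simp: Q_def dist_norm norm_minus_commute intro: sum_nonneg)
    finally have X: "X\<^sup>2 \<le> R\<^sup>2 * Q" .
    have "(\<Sum>i\<in>Basis. F' i x) = ?\<rho> x ^ (2 * k + 2) * (Q + u x * (\<Sum>i\<in>Basis. u2 i x))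
       - 4 * ?m * ?\<rho> x ^ (2 * k + 1) * u x * X"
      unfolding F'_def Q_def X_def
      by (simp add: sum.distrib sum_distrib_left sum_distrib_right sum_subtractf power2_eq_square algebra_simps
            flip: sum_negf)
    also have "\<dots> = ?\<rho> x ^ (2 * k) * (- 4 * ?m * ?\<rho> x * u x * X + (?\<rho> x)\<^sup>2 * (Q - lam * (u x)\<^sup>2))"
      using pde[OF True] by (simp add: power2_eq_square algebra_simps)
    finally have F': "(\<Sum>i\<in>Basis. F' i x) = \<dots>" .
    have "?\<rho> x ^ (2 * k) * ((?\<rho> x)\<^sup>2 * Q / 2) \<le> ?\<rho> x ^ (2 * k) *
       ((- 4 * ?m * ?\<rho> x * u x * X + (?\<rho> x)\<^sup>2 * (Q - lam * (u x)\<^sup>2)) + ?C * (u x)\<^sup>2)"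
      using ball_weight_nonneg ball_weight_le R X lam
      by (intro mult_left_mono caccioppoli_pointwise) auto
    thus ?thesis
      using True unfolding F' by (simp add: Q_def power2_eq_square algebra_simps)
  qed
  have intL: "integrable lborel (\<lambda>x. ?\<rho> x ^ (2 * k + 2) * (\<Sum>i\<in>Basis. (u1 i x)\<^sup>2))"
  proof (rule integrable_cball_support[where c=c and R=R])
    show "continuous_on UNIV (\<lambda>x. ?\<rho> x ^ (2 * k + 2) * (\<Sum>i\<in>Basis. (u1 i x)\<^sup>2))"
      using cont by (intro continuous_intros continuous_ball_weight) auto
    show "?\<rho> x ^ (2 * k + 2) * (\<Sum>i\<in>Basis. (u1 i x)\<^sup>2) = 0" if "x \<notin> cball c R" for x
      using that ball_weight_eq_0[OF R, of x c] by simp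
  qed
  have intR: "integrable lborel (\<lambda>x. ?e x)"
    using cont by (intro integrable_ball_continuous continuous_intros continuous_ball_weight) auto
  have "(LBINT x. ?\<rho> x ^ (2 * k + 2) * (\<Sum>i\<in>Basis. (u1 i x)\<^sup>2) / 2)
     \<le> (LBINT x. (\<Sum>i\<in>Basis. F' i x) + ?C * ?e x)"
    using intL intR F'int pw by (intro integral_mono) auto
  also have "\<dots> = ?C * (LBINT x. ?e x)"
    using intR F'int F'0 by (simp add: Bochner_Integration.integral_add Bochner_Integration.integral_sum)
  finally show ?thesis by (simp add: algebra_simps)
qed

section \<open>Analyticity estimates for the Helmholtz equation\<close>

text \<open>The very weak form of \<open>\<Delta> f = - lam f\<close>, with all derivatives on the test function. The function \<open>f\<close> is
required to be integrable on the whole space so that it can be convolved; the equation concerns \<open>U\<close>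
only.\<close>

definition weak_helmholtz :: "'a::euclidean_space set \<Rightarrow> real \<Rightarrow> ('a \<Rightarrow> real) \<Rightarrow> bool" where
  "weak_helmholtz U lam f \<longleftrightarrow> integrable lebesgue f \<and> (\<forall>\<psi>. test_function U \<psi> \<longrightarrow>
     (LINT x|lebesgue. f x * (\<Sum>i\<in>Basis. partial i (partial i \<psi>) x)) = - lam * (LINT x|lebesgue. f x * \<psi> x))"

lemma test_function_smooth: "test_function U g \<Longrightarrow> smooth g"
  by (simp add: test_function_def)

lemma conv_test_function:
  assumes f: "integrable lebesgue f" and g: "test_function W g"
  shows "continuous_on UNIV (conv f g)" "dir_deriv v (conv f g) (conv f (partial v g))"
    "\<exists>B. \<forall>x. \<bar>conv f g x\<bar> \<le> B"
    "integrable lebesgue (\<lambda>x. f x * g (z - x))"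
proof -
  obtain B0 where B0: "\<And>x. \<bar>g x\<bar> \<le> B0" using test_function_bounded[OF g] by metis
  obtain B1 where B1: "\<And>x. \<bar>partial v g x\<bar> \<le> B1"
    using test_function_bounded[OF test_function_partial[OF g]] by metis
  obtain B2 where B2: "\<And>x. \<bar>partial v (partial v g) x\<bar> \<le> B2"
    using test_function_bounded[OF test_function_partial[OF test_function_partial[OF g]]] by metis
  have s: "smooth g" "smooth (partial v g)" using test_function_smooth[OF g] smooth_partial by auto
  note c = s[THEN smooth_continuous]
  show "continuous_on UNIV (conv f g)" by (rule continuous_conv[OF f c(1) B0])
  show "dir_deriv v (conv f g) (conv f (partial v g))"
    by (rule dir_deriv_conv[OF f c(1) B0 c(2) B1 B2 s[THEN dir_deriv_smooth]])
  show "\<exists>B. \<forall>x. \<bar>conv f g x\<bar> \<le> B" using conv_bounded[OF f c(1) B0] by blast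
  show "integrable lebesgue (\<lambda>x. f x * g (z - x))"
    by (rule integrable_mult_bounded_continuous[OF f c(1) B0])
qed

lemma integrable_mult_test_function:
  assumes h: "integrable lebesgue h" and \<psi>: "test_function U \<psi>"
  shows "integrable lebesgue (\<lambda>x. h x * \<psi> x)"
proof -
  have "test_function UNIV (\<lambda>x. \<psi> (0 - x))" by (rule test_function_reflect[OF \<psi>]) simp
  from conv_test_function(4)[OF h this, of 0] show ?thesis by simp
qed

lemma conv_partial_sum:
  assumes f: "integrable lebesgue f" and g: "test_function W g"
  shows "conv f (partial v g) z = (\<Sum>i\<in>Basis. (v \<bullet> i) * conv f (partial i g) z)"
proof -
  have "conv f (partial v g) z = (LINT x|lebesgue. (\<Sum>i\<in>Basis. (v \<bullet> i) * (f x * partial i g (z - x))))"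
    unfolding conv_def partial_sum_Basis[OF test_function_smooth[OF g], of v]
    by (simp add: sum_distrib_left algebra_simps)
  also have "\<dots> = (\<Sum>i\<in>Basis. (v \<bullet> i) * conv f (partial i g) z)"
    unfolding conv_def
    using conv_test_function(4)[OF f test_function_partial[OF g]]
    by (simp add: Bochner_Integration.integral_sum)
  finally show ?thesis .
qed

lemma conv_helmholtz:
  assumes f: "weak_helmholtz U lam f" and g: "test_function (ball 0 r) g" and z: "ball z r \<subseteq> U"
  shows "(\<Sum>i\<in>Basis. conv f (partial i (partial i g)) z) = - lam * conv f g z"
proof -
  have fi: "integrable lebesgue f" using f by (simp add: weak_helmholtz_def)
  have s: "smooth g" "smooth (partial i g)" for i using test_function_smooth[OF g] smooth_partial by auto
  have "test_function U (\<lambda>x. g (z - x))"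
    by (rule test_function_reflect[OF g]) (use z in \<open>auto simp: dist_norm\<close>)
  hence "(LINT x|lebesgue. f x * (\<Sum>i\<in>Basis. partial i (partial i (\<lambda>x. g (z - x))) x)) = - lam * conv f g z"
    using f unfolding weak_helmholtz_def conv_def by blast
  moreover have "partial i (partial i (\<lambda>x. g (z - x))) x = partial i (partial i g) (z - x)" for i x
  proof -
    have "smooth (\<lambda>x. partial i g (z - x))"
      using Ck_compose_affine[of _ "partial i g" z "-1"] s(2)[of i] unfolding smooth_def by simp
    thus ?thesis
      by (simp add: partial_reflect[OF s(1)] partial_reflect[OF s(2)] partial_minus)
  qed
  moreover have "(LINT x|lebesgue. f x * (\<Sum>i\<in>Basis. partial i (partial i g) (z - x))) =
     (\<Sum>i\<in>Basis. conv f (partial i (partial i g)) z)"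
    unfolding conv_def sum_distrib_left
    using conv_test_function(4)[OF fi test_function_partial[OF test_function_partial[OF g]]]
    by (intro Bochner_Integration.integral_sum) auto
  ultimately show ?thesis by simp
qed

lemma test_function_partial_iterate:
  "test_function W g \<Longrightarrow> test_function W ((partial v ^^ m) g)"
  by (induction m) (auto intro: test_function_partial)

definition weighted_energy where
  "weighted_energy c R f v g m = (LBINT x. indicator (ball c R) x *
     (ball_weight c R x ^ (2 * m) * (conv f ((partial v ^^ m) g) x)\<^sup>2))"

lemma weighted_energy_integrable:
  assumes f: "integrable lebesgue f" and g: "test_function W g"
  shows "integrable lborel (\<lambda>x. indicator (ball c R) x *
     (ball_weight c R x ^ (2 * m) * (conv f ((partial v ^^ m) g) x)\<^sup>2))"
  by (intro integrable_ball_continuous continuous_intros continuous_ball_weight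
      conv_test_function(1)[OF f test_function_partial_iterate[OF g]])

text \<open>Derivatives of a solution are again solutions, and a derivative in a unit direction is dominated by the
gradient, so the Caccioppoli inequality turns order \<open>k\<close> into order \<open>k + 1\<close>.\<close>

lemma weighted_energy_Suc:
  assumes f: "weak_helmholtz U lam f" and g: "test_function (ball 0 r) g"
    and U: "\<And>z. z \<in> ball c R \<Longrightarrow> ball z r \<subseteq> U"
    and lam: "lam \<ge> 0" and R: "R > 0" and v: "norm v = 1"
  shows "weighted_energy c R f v g (Suc k) \<le>
     (2 * lam * R ^ 4 + 16 * (real (k + 1))\<^sup>2 * R\<^sup>2) * weighted_energy c R f v g k"
proof -
  define h where "h = (partial v ^^ k) g"
  have fi: "integrable lebesgue f" using f by (simp add: weak_helmholtz_def)
  have h: "test_function (ball 0 r) h" unfolding h_def by (rule test_function_partial_iterate[OF g])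
  note h1 = test_function_partial[OF h] note h2 = test_function_partial[OF h1]
  note cont = conv_test_function(1)[OF fi h1]
  let ?Q = "\<lambda>x. \<Sum>i\<in>Basis. (conv f (partial i h) x)\<^sup>2"
  have "weighted_energy c R f v g (Suc k) \<le> (LBINT x. ball_weight c R x ^ (2 * k + 2) * ?Q x)"
    unfolding weighted_energy_def
  proof (rule integral_mono)
    show "integrable lborel (\<lambda>x. ball_weight c R x ^ (2 * k + 2) * ?Q x)"
    proof (rule integrable_cball_support[where c=c and R=R])
      show "continuous_on UNIV (\<lambda>x. ball_weight c R x ^ (2 * k + 2) * ?Q x)"
        using cont by (intro continuous_intros continuous_ball_weight) auto
      show "ball_weight c R x ^ (2 * k + 2) * ?Q x = 0" if "x \<notin> cball c R" for x
        using that ball_weight_eq_0[OF R, of x c] by simp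
    qed
    fix x
    have "(conv f (partial v h) x)\<^sup>2 \<le> (\<Sum>i\<in>Basis. (v \<bullet> i)\<^sup>2) * ?Q x"
      unfolding conv_partial_sum[OF fi h, of v] by (rule Cauchy_Schwarz_ineq_sum)
    also have "(\<Sum>i\<in>Basis. (v \<bullet> i)\<^sup>2) = (norm v)\<^sup>2"
      unfolding power2_norm_eq_inner by (subst euclidean_inner) (simp add: power2_eq_square)
    finally have "(conv f ((partial v ^^ Suc k) g) x)\<^sup>2 \<le> ?Q x" using v by (simp add: h_def)
    hence "ball_weight c R x ^ (2 * k + 2) * (conv f ((partial v ^^ Suc k) g) x)\<^sup>2 \<le> ball_weight c R x ^ (2 * k + 2) * ?Q x"
      by (intro mult_left_mono) (auto simp: ball_weight_nonneg)
    moreover have "0 \<le> ball_weight c R x ^ (2 * k + 2) * ?Q x"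
      by (intro mult_nonneg_nonneg sum_nonneg) (auto simp: ball_weight_nonneg)
    ultimately show "indicator (ball c R) x * (ball_weight c R x ^ (2 * Suc k) * (conv f ((partial v ^^ Suc k) g) x)\<^sup>2)
       \<le> ball_weight c R x ^ (2 * k + 2) * ?Q x"
      by (cases "x \<in> ball c R") simp_all
  qed (rule weighted_energy_integrable[OF fi g])
  also have "\<dots> \<le> (2 * lam * R ^ 4 + 16 * (real (k + 1))\<^sup>2 * R\<^sup>2) * weighted_energy c R f v g k"
    unfolding weighted_energy_def h_def[symmetric]
  proof (rule caccioppoli[where ?u2.0="\<lambda>i. conv f (partial i (partial i h))"])
    show "(\<Sum>i\<in>Basis. conv f (partial i (partial i h)) x) = - lam * conv f h x" if "x \<in> ball c R" for x
      by (rule conv_helmholtz[OF f h U[OF that]])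
  qed (use fi h h1 h2 lam R in \<open>auto intro: conv_test_function\<close>)
  finally show ?thesis .
qed

text \<open>The factor gained in step \<open>k\<close> is at most \<open>(k + 1)\<^sup>2 C\<^sup>2\<close>. The product of the factors is
\<open>(C\<^sup>m m!)\<^sup>2\<close>, the growth that characterises analytic functions.\<close>

lemma weighted_energy_bound:
  assumes f: "weak_helmholtz U lam f" and g: "test_function (ball 0 r) g"
    and U: "\<And>z. z \<in> ball c R \<Longrightarrow> ball z r \<subseteq> U"
    and lam: "lam \<ge> 0" and R: "R > 0" and v: "norm v = 1"
    and C: "C\<^sup>2 = 2 * lam * R ^ 4 + 16 * R\<^sup>2"
  shows "weighted_energy c R f v g m \<le> (C ^ m * fact m)\<^sup>2 * weighted_energy c R f v g 0"
proof (induction m)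
  case (Suc k)
  have nn: "0 \<le> weighted_energy c R f v g k"
    unfolding weighted_energy_def
    by (intro integral_nonneg_AE AE_I2 mult_nonneg_nonneg) (auto simp: ball_weight_nonneg)
  have k: "1 \<le> (real (k + 1))\<^sup>2" by (simp add: one_le_power)
  have "weighted_energy c R f v g (Suc k) \<le>
     (2 * lam * R ^ 4 + 16 * (real (k + 1))\<^sup>2 * R\<^sup>2) * weighted_energy c R f v g k"
    by (rule weighted_energy_Suc[OF f g U lam R v])
  also have "\<dots> \<le> ((real (k + 1))\<^sup>2 * C\<^sup>2) * weighted_energy c R f v g k"
  proof (rule mult_right_mono[OF _ nn])
    have "1 * (2 * lam * R ^ 4) \<le> (real (k + 1))\<^sup>2 * (2 * lam * R ^ 4)"
      using k lam by (intro mult_right_mono) auto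
    thus "2 * lam * R ^ 4 + 16 * (real (k + 1))\<^sup>2 * R\<^sup>2 \<le> (real (k + 1))\<^sup>2 * C\<^sup>2"
      unfolding C by (simp add: algebra_simps)
  qed
  also have "\<dots> \<le> ((real (k + 1))\<^sup>2 * C\<^sup>2) * ((C ^ k * fact k)\<^sup>2 * weighted_energy c R f v g 0)"
    by (intro mult_left_mono Suc) auto
  also have "\<dots> = (C ^ Suc k * fact (Suc k))\<^sup>2 * weighted_energy c R f v g 0"
  proof -
    have "C ^ Suc k * fact (Suc k) = real (k + 1) * C * (C ^ k * fact k)" by simp
    thus ?thesis by (simp only: power_mult_distrib mult.assoc)
  qed
  finally show ?case .
qed simp

lemma taylor_zero:
  fixes F :: "nat \<Rightarrow> real \<Rightarrow> real"
  assumes d: "\<And>m t. (F m has_real_derivative F (Suc m) t) (at t)"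
    and 0: "\<And>m. F m 0 = 0"
    and bound: "\<And>m t. 0 \<le> t \<Longrightarrow> t \<le> \<tau> \<Longrightarrow> \<bar>F m t\<bar> \<le> B * (A ^ m * fact m)"
    and A: "0 \<le> A" "A * \<tau> < 1" and t: "0 \<le> t" "t \<le> \<tau>"
  shows "F 0 t = 0"
proof -
  have "\<bar>F 0 t\<bar> \<le> \<bar>B\<bar> * (A * \<tau>) ^ m" if "m > 0" for m
  proof (cases "t = 0")
    case False
    with t have "0 < t" by simp
    from Maclaurin[OF this that, of F "F 0"] d obtain s where s: "0 < s" "s < t"
      "F 0 t = (\<Sum>k<m. F k 0 / fact k * t ^ k) + F m s / fact m * t ^ m" by auto
    hence "\<bar>F 0 t\<bar> = \<bar>F m s\<bar> / fact m * t ^ m" using 0 t by (simp add: abs_mult power_abs)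
    also have "\<dots> \<le> (\<bar>B\<bar> * (A ^ m * fact m)) / fact m * \<tau> ^ m"
    proof (intro mult_mono divide_right_mono power_mono)
      have "B * (A ^ m * fact m) \<le> \<bar>B\<bar> * (A ^ m * fact m)" using A by (intro mult_right_mono) auto
      thus "\<bar>F m s\<bar> \<le> \<bar>B\<bar> * (A ^ m * fact m)" using bound[of s m] s t by simp
    qed (use t A in auto)
    also have "\<dots> = \<bar>B\<bar> * (A * \<tau>) ^ m" by (simp add: power_mult_distrib)
    finally show ?thesis .
  qed (use 0 A t in auto)
  moreover have "(\<lambda>m. \<bar>B\<bar> * (A * \<tau>) ^ m) \<longlonglongrightarrow> \<bar>B\<bar> * 0"
    using A t by (intro tendsto_intros LIMSEQ_power_zero) auto
  ultimately have "\<bar>F 0 t\<bar> \<le> \<bar>B\<bar> * 0"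
    by (intro tendsto_lowerbound[where F=sequentially]) (auto intro!: eventually_mono[OF eventually_gt_at_top[of 0]])
  thus ?thesis by simp
qed

text \<open>The energy bounds control \<open>J = conv f g\<close> only in mean square, so Taylor's formula is applied to the
averages \<open>\<integral> w(x) J(p + s v - x) dx\<close>, where \<open>w\<close> lives on a small ball. All their derivatives vanish at
\<open>s = 0\<close>, because \<open>f\<close> vanishes near \<open>p\<close>. Taking \<open>w\<close> to be \<open>J\<close> itself near the target point turns the
conclusion into the vanishing of an integral of \<open>J\<^sup>2\<close>.\<close>

lemma conv_vanishes_at:
  assumes f: "weak_helmholtz U lam f" and g: "test_function (ball 0 r) g"
    and U: "\<And>z. z \<in> ball p R \<Longrightarrow> ball z r \<subseteq> U"
    and lam: "lam \<ge> 0" and R: "R > 0" and v: "norm v = 1"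
    and C: "C \<ge> 0" "C\<^sup>2 = 2 * lam * R ^ 4 + 16 * R\<^sup>2"
    and r: "r > 0" "r \<le> R / 4" and f0: "vanishes_on f (ball p (2 * r))"
    and t: "0 \<le> t" "t \<le> \<tau>" "\<tau> \<le> R / 4" "\<tau> * (4 * C / (3 * R\<^sup>2)) < 1"
  shows "conv f g (p + t *\<^sub>R v) = 0"
proof -
  have fi: "integrable lebesgue f" using f by (simp add: weak_helmholtz_def)
  define G where "G m = (partial v ^^ m) g" for m
  have G: "test_function (ball 0 r) (G m)" for m unfolding G_def by (rule test_function_partial_iterate[OF g])
  define J where "J m = conv f (G m)" for m
  have Jc: "continuous_on UNIV (J m)" for m unfolding J_def by (rule conv_test_function(1)[OF fi G])
  have Jd: "dir_deriv v (J m) (J (Suc m))" for m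
    using conv_test_function(2)[OF fi G[of m], of v] by (simp add: J_def G_def)
  have Jb: "\<exists>B. \<forall>x. \<bar>J m x\<bar> \<le> B" for m unfolding J_def by (rule conv_test_function(3)[OF fi G])
  define q where "q = p + t *\<^sub>R v"
  \<comment> \<open>With this choice the average at \<open>s = t\<close> equals the integral of \<open>w\<^sup>2\<close>.\<close>
  define w where "w x = indicator (ball 0 r) x * J 0 (q - x)" for x
  have refl: "continuous_on UNIV (\<lambda>x. h (z - x))" if "continuous_on UNIV h" for h :: "'a \<Rightarrow> real" and z
    by (rule continuous_on_compose2[OF that]) (auto intro!: continuous_intros)
  have wl: "integrable lborel w"
    unfolding w_def by (intro integrable_ball_continuous refl Jc)
  hence wi: "integrable lebesgue w" by (subst integrable_completion) auto
  have w2: "integrable lborel (\<lambda>x. (w x)\<^sup>2)"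
  proof -
    have "(\<lambda>x. (w x)\<^sup>2) = (\<lambda>x. indicator (ball 0 r) x * (J 0 (q - x))\<^sup>2)"
      by (auto simp: w_def power_mult_distrib indicator_def)
    thus ?thesis by (simp only:) (intro integrable_ball_continuous continuous_intros refl Jc)
  qed
  define I where "I m s = conv w (J m) (p + s *\<^sub>R v)" for m s
  define A where "A = 4 * C / (3 * R\<^sup>2)"
  define W where "W = (LBINT x. (w x)\<^sup>2)"
  define N where "N m = weighted_energy p R f v g m" for m
  have "I 0 t = 0"
  proof (rule taylor_zero[where F=I and A=A and \<tau>=\<tau>])
    show "(I m has_real_derivative I (Suc m) s) (at s)" for m s
    proof -
      obtain B0 B1 B2 where "\<And>x. \<bar>J m x\<bar> \<le> B0" "\<And>x. \<bar>J (Suc m) x\<bar> \<le> B1" "\<And>x. \<bar>J (Suc (Suc m)) x\<bar> \<le> B2"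
        using Jb by metis
      hence "dir_deriv v (conv w (J m)) (conv w (J (Suc m)))"
        by (intro dir_deriv_conv[OF wi Jc _ Jc _ _ Jd Jd])
      from dir_deriv_line[OF this, of p s] show ?thesis unfolding I_def .
    qed
    show "I m 0 = 0" for m
    proof -
      have "w x * J m (p - x) = 0" for x
      proof (cases "x \<in> ball 0 r")
        case True
        have "J m (p - x) = 0"
          unfolding J_def conv_def
        proof (rule integral_eq_zero_AE)
          show "AE y in lebesgue. f y * G m (p - x - y) = 0"
            using f0
          proof eventually_elim
            fix y assume y: "y \<in> ball p (2 * r) \<longrightarrow> f y = 0"
            show "f y * G m (p - x - y) = 0"
            proof (cases "y \<in> ball p (2 * r)")
              case False
              have "norm (p - y) \<le> norm (p - x - y) + norm x"
                using norm_triangle_ineq[of "p - x - y" x] by simp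
              moreover have "\<not> norm (p - y) < 2 * r" "norm x < r"
                using False True by (simp_all add: dist_norm)
              ultimately have "p - x - y \<notin> ball 0 r" unfolding mem_ball_0 by linarith
              hence "G m (p - x - y) = 0" using G[of m] unfolding test_function_def by (metis subsetD)
              thus ?thesis by simp
            qed (use y in auto)
          qed
        qed
        thus ?thesis by simp
      qed (simp add: w_def)
      thus ?thesis unfolding I_def conv_def by (intro integral_eq_zero_AE AE_I2) simp
    qed
    show "\<bar>I m s\<bar> \<le> ((W + N 0) / 2) * (A ^ m * fact m)" if s: "0 \<le> s" "s \<le> \<tau>" for m s
    proof -
      define a where "a = A ^ m * fact m"
      have "C > 0"
      proof -
        have "C\<^sup>2 > 0" using C lam R by (simp add: add_nonneg_pos)
        thus ?thesis using C(1) by (cases "C = 0") auto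
      qed
      hence a: "a > 0" using R by (simp add: a_def A_def)
      define z where "z = p + s *\<^sub>R v"
      let ?K = "(3 / 4 * R\<^sup>2) ^ (2 * m)"
      define e where "e x = indicator (ball p R) x * (ball_weight p R x ^ (2 * m) * (J m x)\<^sup>2)" for x
      have eint: "integrable lborel e"
        unfolding e_def J_def G_def by (rule weighted_energy_integrable[OF fi g])
      hence em: "e \<in> borel_measurable borel" by simp
      have enn: "e x \<ge> 0" for x by (simp add: e_def ball_weight_nonneg)
      have ez: "integrable lborel (\<lambda>x. e (z - x))"
        unfolding e_def
      proof -
        show "integrable lborel (\<lambda>x. indicator (ball p R) (z - x) * (ball_weight p R (z - x) ^ (2 * m) * (J m (z - x))\<^sup>2))"
        proof -
          have "(\<lambda>x. indicator (ball p R) (z - x) * (ball_weight p R (z - x) ^ (2 * m) * (J m (z - x))\<^sup>2))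
            = (\<lambda>x. indicator (ball (z - p) R) x * (ball_weight p R (z - x) ^ (2 * m) * (J m (z - x))\<^sup>2))"
            by (auto simp: fun_eq_iff indicator_def dist_norm algebra_simps norm_minus_commute)
          thus ?thesis
            by (simp only:) (intro integrable_ball_continuous continuous_intros refl[OF continuous_ball_weight] refl Jc)
        qed
      qed
      \<comment> \<open>The weight \<open>a\<close> in \<open>2 |w J| \<le> a w\<^sup>2 + J\<^sup>2/a\<close> balances the growth of the energies, so that the
          bound is linear in \<open>a\<close>. On the support of \<open>w\<close> the ball weight is at least \<open>3 R\<^sup>2/4\<close>.\<close>
      have pw: "\<bar>w x * J m (z - x)\<bar> \<le> (a * (w x)\<^sup>2 + e (z - x) / (?K * a)) / 2" for x
      proof (cases "x \<in> ball 0 r")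
        case False
        thus ?thesis using enn a R by (simp add: w_def)
      next
        case True
        have "norm (z - x - p) \<le> norm (s *\<^sub>R v) + norm x"
          using norm_triangle_ineq4[of "s *\<^sub>R v" x] by (simp add: z_def)
        also have "\<dots> \<le> R / 2" using True r t s v by auto
        finally have n: "norm (z - x - p) \<le> R / 2" .
        hence inb: "z - x \<in> ball p R" using R by (auto simp: dist_norm norm_minus_commute)
        have "(norm (z - x - p))\<^sup>2 \<le> (R / 2)\<^sup>2" using n by (intro power_mono) auto
        hence "3 / 4 * R\<^sup>2 \<le> ball_weight p R (z - x)"
          unfolding ball_weight_def by (intro max.coboundedI2) (simp add: power_divide)
        hence "?K \<le> ball_weight p R (z - x) ^ (2 * m)" by (intro power_mono) auto
        hence "?K * (J m (z - x))\<^sup>2 \<le> e (z - x)"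
          using inb by (simp add: e_def mult_right_mono)
        hence J2: "(J m (z - x))\<^sup>2 \<le> e (z - x) / ?K" using R by (simp add: field_simps)
        have "0 \<le> (a * \<bar>w x\<bar> - \<bar>J m (z - x)\<bar>)\<^sup>2" by simp
        hence "2 * (a * (\<bar>w x\<bar> * \<bar>J m (z - x)\<bar>)) \<le> a\<^sup>2 * (w x)\<^sup>2 + (J m (z - x))\<^sup>2"
          by (simp add: power2_diff power_mult_distrib algebra_simps)
        also have "\<dots> \<le> a\<^sup>2 * (w x)\<^sup>2 + e (z - x) / ?K" using J2 by simp
        finally have "2 * (a * (\<bar>w x\<bar> * \<bar>J m (z - x)\<bar>)) / a \<le> (a\<^sup>2 * (w x)\<^sup>2 + e (z - x) / ?K) / a"
          using a by (intro divide_right_mono) auto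
        moreover have "(a\<^sup>2 * (w x)\<^sup>2 + e (z - x) / ?K) / a = a * (w x)\<^sup>2 + e (z - x) / (?K * a)"
          using a by (simp add: power2_eq_square add_divide_distrib)
        moreover have "2 * (a * (\<bar>w x\<bar> * \<bar>J m (z - x)\<bar>)) / a = 2 * \<bar>w x * J m (z - x)\<bar>"
          using a by (simp add: abs_mult)
        ultimately show ?thesis by simp
      qed
      have Jm: "(\<lambda>x. w x * J m (z - x)) \<in> borel_measurable lborel"
        using borel_measurable_integrable[OF wl] borel_measurable_continuous_onI[OF refl[OF Jc]]
        by (intro borel_measurable_times) auto
      have "I m s = (LBINT x. w x * J m (z - x))"
        unfolding I_def conv_def z_def[symmetric] using Jm by (rule integral_completion)
      hence "\<bar>I m s\<bar> \<le> (LBINT x. \<bar>w x * J m (z - x)\<bar>)"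
        by (simp add: integral_abs_bound)
      also have "\<dots> \<le> (LBINT x. (a * (w x)\<^sup>2 + e (z - x) / (?K * a)) / 2)"
      proof (rule integral_mono)
        show i2: "integrable lborel (\<lambda>x. (a * (w x)\<^sup>2 + e (z - x) / (?K * a)) / 2)"
          using w2 ez by auto
        show "integrable lborel (\<lambda>x. \<bar>w x * J m (z - x)\<bar>)"
        proof (rule Bochner_Integration.integrable_bound[OF i2])
          show "(\<lambda>x. \<bar>w x * J m (z - x)\<bar>) \<in> borel_measurable lborel" using Jm by simp
          show "AE x in lborel. norm \<bar>w x * J m (z - x)\<bar> \<le> norm ((a * (w x)\<^sup>2 + e (z - x) / (?K * a)) / 2)"
            unfolding real_norm_def abs_abs by (intro AE_I2 order_trans[OF pw abs_ge_self])
        qed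
      qed (rule pw)
      also have "\<dots> = (a * W + (LBINT x. e (z - x)) / (?K * a)) / 2"
        using w2 ez by (simp add: W_def)
      also have "(LBINT x. e (z - x)) = N m"
        unfolding lborel_integral_reflect[OF em] by (simp add: N_def weighted_energy_def e_def[abs_def] J_def G_def)
      also have "N m / (?K * a) \<le> a * N 0"
      proof -
        have "N m \<le> (C ^ m * fact m)\<^sup>2 * N 0"
          unfolding N_def by (rule weighted_energy_bound[OF f g U lam R v C(2)])
        also have "C ^ m * fact m = (3 / 4 * R\<^sup>2) ^ m * a"
          using R by (simp add: a_def A_def power_mult_distrib[symmetric] flip: mult.assoc)
        finally have le: "N m \<le> ((3 / 4 * R\<^sup>2) ^ m * a)\<^sup>2 * N 0" .
        have K: "?K = (3 / 4 * R\<^sup>2) ^ m * (3 / 4 * R\<^sup>2) ^ m" by (simp only: power_even_eq power2_eq_square)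
        have "N m \<le> (a * N 0) * (?K * a)"
          unfolding K using le
          by (simp only: power2_eq_square ac_simps)
        thus ?thesis using a R by (simp add: divide_le_eq)
      qed
      finally show ?thesis using a by (simp add: a_def algebra_simps)
    qed
    show "0 \<le> A" using C R by (simp add: A_def)
    show "A * \<tau> < 1" using t by (simp add: A_def mult.commute)
  qed (use t in auto)
  moreover have "I 0 t = (LBINT x. (w x)\<^sup>2)"
  proof -
    have "(\<lambda>x. w x * J 0 (p + t *\<^sub>R v - x)) = (\<lambda>x. (w x)\<^sup>2)"
      by (auto simp: w_def q_def power2_eq_square indicator_def)
    moreover have "(LINT x|lebesgue. (w x)\<^sup>2) = (LBINT x. (w x)\<^sup>2)"
      using w2 by (intro integral_completion) auto
    ultimately show ?thesis by (simp add: I_def conv_def)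
  qed
  ultimately have "AE x in lborel. (w x)\<^sup>2 = 0"
    using integral_nonneg_eq_0_iff_AE[OF w2] by simp
  hence "AE x in lborel. \<not> (x \<in> ball 0 r \<and> J 0 (q - x) \<noteq> 0)"
    by eventually_elim (auto simp: w_def)
  moreover have op: "open {x. x \<in> ball 0 r \<and> J 0 (q - x) \<noteq> 0}"
    using open_Int[OF open_ball[of 0 r] open_Collect_neq[OF refl[OF Jc[of 0], of q] continuous_on_const[of _ 0]]]
    by (simp add: Int_def)
  ultimately have "{x. x \<in> ball 0 r \<and> J 0 (q - x) \<noteq> 0} \<in> null_sets lborel"
    by (subst AE_iff_null_sets) auto
  hence "negligible {x. x \<in> ball 0 r \<and> J 0 (q - x) \<noteq> 0}"
    by (simp add: negligible_iff_null_sets null_sets_completionI)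
  hence "{x. x \<in> ball 0 r \<and> J 0 (q - x) \<noteq> 0} = {}"
    using open_not_negligible[OF op] by blast
  hence "J 0 (q - 0) = 0" using r centre_in_ball[of 0 r] by blast
  thus ?thesis by (simp add: J_def G_def q_def)
qed

section \<open>Unique continuation\<close>

text \<open>The radius \<open>\<tau>\<close> depends on \<open>lam\<close> and \<open>R\<close> but not on the size \<open>\<delta>\<close> of the ball where \<open>f\<close> is known to
vanish. This uniformity is what makes the zero set relatively closed.\<close>

lemma helmholtz_zero_spreads:
  assumes f: "weak_helmholtz U lam f" and lam: "lam \<ge> 0" and R: "R > 0"
  shows "\<exists>\<tau>>0. \<forall>p q \<delta>. ball p (2 * R) \<subseteq> U \<and> \<delta> > 0 \<and> vanishes_on f (ball p \<delta>) \<and> dist p q \<le> \<tau>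
      \<longrightarrow> (\<exists>r>0. vanishes_on f (ball q r))"
proof -
  have fi: "integrable lebesgue f" using f by (simp add: weak_helmholtz_def)
  define C where "C = sqrt (2 * lam * R ^ 4 + 16 * R\<^sup>2)"
  have C2: "C\<^sup>2 = 2 * lam * R ^ 4 + 16 * R\<^sup>2" using lam R by (simp add: C_def)
  have C: "C > 0" using lam R by (simp add: C_def add_nonneg_pos)
  define \<tau> where "\<tau> = min (R / 4) (3 * R\<^sup>2 / (8 * C))"
  have \<tau>0: "\<tau> > 0" using C R by (simp add: \<tau>_def)
  have "\<tau> * (4 * C / (3 * R\<^sup>2)) \<le> (3 * R\<^sup>2 / (8 * C)) * (4 * C / (3 * R\<^sup>2))"
    using C R by (intro mult_right_mono) (auto simp: \<tau>_def)
  also have "\<dots> < 1" using C R by simp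
  finally have \<tau>: "\<tau> * (4 * C / (3 * R\<^sup>2)) < 1" "\<tau> \<le> R / 4" by (auto simp: \<tau>_def)
  have "\<exists>r>0. vanishes_on f (ball q r)"
    if pU: "ball p (2 * R) \<subseteq> U" and \<delta>: "\<delta> > 0" and f0: "vanishes_on f (ball p \<delta>)"
    and pq: "dist p q \<le> \<tau>" for p q \<delta>
  proof -
    define r where "r = min (\<delta> / 2) (R / 4)"
    have r: "r > 0" "r \<le> R / 4" "2 * r \<le> \<delta>" using \<delta> R by (auto simp: r_def)
    have U: "ball z r \<subseteq> U" if "z \<in> ball p R" for z
    proof -
      have "ball z r \<subseteq> ball p (2 * R)"
        unfolding ball_subset_ball_iff using that r R by (auto simp: dist_commute)
      thus ?thesis using pU by simp
    qed
    have f0': "vanishes_on f (ball p (2 * r))"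
      using f0 by eventually_elim (use r in auto)
    have "\<exists>t v. q = p + t *\<^sub>R v \<and> norm v = 1 \<and> 0 \<le> t \<and> t \<le> \<tau>"
    proof (cases "p = q")
      case True
      obtain i :: 'a where "i \<in> Basis" using nonempty_Basis by blast
      thus ?thesis using True \<tau>0 by (intro exI[of _ 0] exI[of _ i]) auto
    next
      case False
      thus ?thesis using pq
        by (intro exI[of _ "norm (q - p)"] exI[of _ "(q - p) /\<^sub>R norm (q - p)"]) (auto simp: dist_norm norm_minus_commute)
    qed
    then obtain t v where tv: "q = p + t *\<^sub>R v" "norm v = 1" "0 \<le> t" "t \<le> \<tau>" by blast
    have "vanishes_on f (ball q r)"
    proof (rule AE_eq_0_if_test_integrals_0[OF fi open_ball])
      fix \<psi> assume \<psi>: "test_function (ball q r) \<psi>"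
      have "test_function (ball 0 r) (\<lambda>x. \<psi> (q - x))"
        by (rule test_function_reflect[OF \<psi>]) (simp add: dist_norm norm_minus_commute)
      hence "conv f (\<lambda>x. \<psi> (q - x)) q = 0"
        unfolding tv(1)
        by (rule conv_vanishes_at[OF f _ U lam R tv(2) less_imp_le[OF C] C2 r(1,2) f0' tv(3,4) \<tau>(2,1)]) simp
      thus "(LINT x|lebesgue. f x * \<psi> x) = 0" by (simp add: conv_def)
    qed
    thus ?thesis using r by blast
  qed
  thus ?thesis using \<tau>0 by blast
qed

lemma helmholtz_unique_continuation:
  assumes f: "weak_helmholtz U lam f" and lam: "lam \<ge> 0" and U: "open U" "connected U"
    and W: "open W" "W \<noteq> {}" "W \<subseteq> U" and f0: "vanishes_on f W"
  shows "vanishes_on f U"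
proof -
  define Z where "Z = {x\<in>U. \<exists>r>0. vanishes_on f (ball x r)}"
  have ballZ: "U \<inter> ball x r \<subseteq> Z" if "vanishes_on f (ball x r)" for x r
  proof
    fix y assume y: "y \<in> U \<inter> ball x r"
    hence "y \<in> ball x r" by simp
    then obtain e where e: "e > 0" "ball y e \<subseteq> ball x r"
      using open_ball open_contains_ball by metis
    from that have "vanishes_on f (ball y e)"
      by eventually_elim (use e in auto)
    thus "y \<in> Z" using e y by (auto simp: Z_def)
  qed
  have oZ: "open Z"
    unfolding open_contains_ball
  proof
    fix x assume x: "x \<in> Z"
    then obtain r where r: "r > 0" "vanishes_on f (ball x r)" by (auto simp: Z_def)
    have "open (U \<inter> ball x r)" "x \<in> U \<inter> ball x r" using U r x by (auto simp: Z_def)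
    then obtain e where "e > 0" "ball x e \<subseteq> U \<inter> ball x r" using open_contains_ball by blast
    thus "\<exists>e>0. ball x e \<subseteq> Z" using ballZ[OF r(2)] by blast
  qed
  have oC: "open (U - Z)"
    unfolding open_contains_ball
  proof
    fix q assume q: "q \<in> U - Z"
    then obtain e where e: "e > 0" "ball q e \<subseteq> U" using U(1) open_contains_ball by blast
    define R where "R = e / 3"
    have R: "R > 0" using e by (simp add: R_def)
    obtain \<tau> where \<tau>: "\<tau> > 0" "\<forall>p q \<delta>. ball p (2 * R) \<subseteq> U \<and> \<delta> > 0 \<and> 
        vanishes_on f (ball p \<delta>) \<and> dist p q \<le> \<tau>
        \<longrightarrow> (\<exists>r>0. vanishes_on f (ball q r))"
      using helmholtz_zero_spreads[OF f lam R] by blast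
    have "ball q (min \<tau> R) \<subseteq> U - Z"
    proof
      fix p assume p: "p \<in> ball q (min \<tau> R)"
      have sub: "ball p (2 * R) \<subseteq> ball q e"
      proof -
        have "dist p q < R" using p by (simp add: dist_commute)
        thus ?thesis unfolding ball_subset_ball_iff by (simp add: R_def)
      qed
      have "p \<in> ball p (2 * R)" using R by simp
      hence "p \<in> U" using sub e by blast
      moreover have "p \<notin> Z"
      proof
        assume "p \<in> Z"
        then obtain \<delta> where \<delta>: "\<delta> > 0" "vanishes_on f (ball p \<delta>)" by (auto simp: Z_def)
        have "ball p (2 * R) \<subseteq> U" "dist p q \<le> \<tau>" using sub e p by (auto simp: dist_commute)
        with \<delta> \<tau>(2) have "\<exists>r>0. vanishes_on f (ball q r)" by blast
        thus False using q by (auto simp: Z_def)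
      qed
      ultimately show "p \<in> U - Z" by simp
    qed
    thus "\<exists>e>0. ball q e \<subseteq> U - Z" using \<tau>(1) R by (intro exI[of _ "min \<tau> R"]) auto
  qed
  have "W \<subseteq> Z"
  proof
    fix x assume x: "x \<in> W"
    then obtain e where e: "e > 0" "ball x e \<subseteq> W" using W open_contains_ball by blast
    from f0 have "vanishes_on f (ball x e)"
      by eventually_elim (use e in auto)
    thus "x \<in> Z" using ballZ[of x e] x W e by auto
  qed
  have "Z \<inter> U \<noteq> {}" using \<open>W \<subseteq> Z\<close> W by blast
  hence "(U - Z) \<inter> U = {}"
    using connectedD[OF U(2) oZ oC] by blast
  hence ZU: "\<exists>r>0. vanishes_on f (ball x r)" if "x \<in> U" for x
    using that by (auto simp: Z_def)
  let ?N = "{x\<in>U. f x \<noteq> 0}"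
  have "negligible ?N"
  proof (rule locally_negligible_alt[THEN iffD2], rule ballI)
    fix x assume x: "x \<in> ?N"
    obtain r where r: "r > 0" "vanishes_on f (ball x r)" using ZU x by blast
    obtain N where N: "negligible N" "\<And>y. y \<notin> N \<Longrightarrow> y \<in> ball x r \<longrightarrow> f y = 0"
      using AE_lebesgue_negligibleE[OF r(2)] by blast
    have "negligible (?N \<inter> ball x r)"
      by (rule negligible_subset[OF N(1)]) (use N(2) in fastforce)
    thus "\<exists>V. openin (top_of_set ?N) V \<and> x \<in> V \<and> negligible V"
      using x r by (intro exI[of _ "?N \<inter> ball x r"]) (auto intro: openin_open_Int)
  qed
  thus ?thesis
    by (intro AE_I'[of ?N]) (auto simp: negligible_iff_null_sets)
qed

lemma L2_on_integrable:
  assumes f: "L2_on U f" and U: "U \<in> sets lebesgue" "bounded U"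
  shows "integrable lebesgue (\<lambda>x. indicator U x * f x)"
proof (rule Bochner_Integration.integrable_bound)
  have "integrable lebesgue (indicator U :: 'a \<Rightarrow> real)"
    using bounded_set_imp_lmeasurable[OF U(2,1)]
    by (intro integrable_real_indicator) (auto simp: fmeasurable_def simp del: emeasure_completion)
  moreover have "integrable lebesgue (\<lambda>x. indicator U x * (f x)\<^sup>2)"
    using f by (simp add: L2_on_def set_integrable_def)
  ultimately show "integrable lebesgue (\<lambda>x. indicator U x + indicator U x * (f x)\<^sup>2)" by simp
  show "(\<lambda>x. indicator U x * f x) \<in> borel_measurable lebesgue"
    using f by (simp add: L2_on_def set_borel_measurable_def)
  have "\<bar>t\<bar> \<le> 1 + t\<^sup>2" for t :: real
  proof -
    have "0 \<le> (\<bar>t\<bar> - 1)\<^sup>2" by simp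
    hence "2 * \<bar>t\<bar> \<le> 1 + t\<^sup>2" by (simp add: power2_diff)
    thus ?thesis by simp
  qed
  thus "AE x in lebesgue. norm (indicator U x * f x) \<le> norm (indicator U x + indicator U x * (f x)\<^sup>2)"
    by (intro AE_I2) (auto simp: indicator_def)
qed

lemma weak_derivD:
  assumes "weak_deriv U i f g" "test_function U \<psi>"
  shows "(LINT x|lebesgue. (indicator U x * f x) * partial i \<psi> x) = - (LINT x|lebesgue. (indicator U x * g x) * \<psi> x)"
  using assms unfolding weak_deriv_def set_lebesgue_integral_def partial_def by (simp add: mult.assoc)

text \<open>Multiplying by the indicator extends the eigenfunction by \<open>0\<close> outside \<open>U\<close>. Boundedness of \<open>U\<close> makes
square integrable functions integrable.\<close>

lemma dirichlet_eigenfunction_weak_helmholtz: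
  fixes U :: "'a::euclidean_space set"
  assumes f: "dirichlet_eigenfunction U lam f" and U: "open U" "bounded U"
  shows "weak_helmholtz U lam (\<lambda>x. indicator U x * f x)"
proof -
  have Us: "U \<in> sets lebesgue" using U by auto
  obtain D D2 where D: "\<And>i. i \<in> Basis \<Longrightarrow> weak_deriv U i f (D i)"
    and D2: "\<And>i. i \<in> Basis \<Longrightarrow> weak_deriv U i (D i) (D2 i)"
    and eq: "AE x in lebesgue. x \<in> U \<longrightarrow> - (\<Sum>i\<in>Basis. D2 i x) = lam * f x"
    using f unfolding dirichlet_eigenfunction_def by blast
  have fi: "integrable lebesgue (\<lambda>x. indicator U x * f x)"
    using f U by (intro L2_on_integrable Us) (auto simp: dirichlet_eigenfunction_def H2_on_def)
  have D2i: "integrable lebesgue (\<lambda>x. indicator U x * D2 i x)" if "i \<in> Basis" for i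
    using D2[OF that] U by (intro L2_on_integrable Us) (auto simp: weak_deriv_def)
  note int = integrable_mult_test_function
  have "(LINT x|lebesgue. (indicator U x * f x) * (\<Sum>i\<in>Basis. partial i (partial i \<psi>) x)) =
      - lam * (LINT x|lebesgue. (indicator U x * f x) * \<psi> x)" if \<psi>: "test_function U \<psi>" for \<psi>
  proof -
    note \<psi>1 = test_function_partial[OF \<psi>] note \<psi>2 = test_function_partial[OF \<psi>1]
    have "(LINT x|lebesgue. (indicator U x * f x) * (\<Sum>i\<in>Basis. partial i (partial i \<psi>) x)) =
       (\<Sum>i\<in>Basis. LINT x|lebesgue. (indicator U x * f x) * partial i (partial i \<psi>) x)"
      unfolding sum_distrib_left by (intro Bochner_Integration.integral_sum int[OF fi \<psi>2])
    also have "\<dots> = (\<Sum>i\<in>Basis. LINT x|lebesgue. (indicator U x * D2 i x) * \<psi> x)"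
    proof (rule sum.cong)
      fix i :: 'a assume i: "i \<in> Basis"
      show "(LINT x|lebesgue. (indicator U x * f x) * partial i (partial i \<psi>) x) =
          (LINT x|lebesgue. (indicator U x * D2 i x) * \<psi> x)"
        by (simp only: weak_derivD[OF D[OF i] \<psi>1] weak_derivD[OF D2[OF i] \<psi>] minus_minus)
    qed simp
    also have "\<dots> = (LINT x|lebesgue. (\<Sum>i\<in>Basis. (indicator U x * D2 i x) * \<psi> x))"
      by (intro Bochner_Integration.integral_sum[symmetric] int[OF D2i \<psi>])
    also have "\<dots> = (LINT x|lebesgue. - lam * ((indicator U x * f x) * \<psi> x))"
    proof (rule Bochner_Integration.integral_cong_AE)
      show "(\<lambda>x. \<Sum>i\<in>Basis. (indicator U x * D2 i x) * \<psi> x) \<in> borel_measurable lebesgue"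
        using int[OF D2i \<psi>] by (intro borel_measurable_sum) auto
      show "(\<lambda>x. - lam * ((indicator U x * f x) * \<psi> x)) \<in> borel_measurable lebesgue"
        by (rule borel_measurable_integrable[OF integrable_mult_right[OF int[OF fi \<psi>]]])
      show "AE x in lebesgue. (\<Sum>i\<in>Basis. (indicator U x * D2 i x) * \<psi> x) = - lam * ((indicator U x * f x) * \<psi> x)"
        using eq
      proof eventually_elim
        fix x assume x: "x \<in> U \<longrightarrow> - (\<Sum>i\<in>Basis. D2 i x) = lam * f x"
        show "(\<Sum>i\<in>Basis. (indicator U x * D2 i x) * \<psi> x) = - lam * ((indicator U x * f x) * \<psi> x)"
        proof (cases "x \<in> U")
          case True
          hence "(\<Sum>i\<in>Basis. D2 i x) = - (lam * f x)" using x by simp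
          thus ?thesis using True by (simp flip: sum_distrib_right)
        qed simp
      qed
    qed
    finally show ?thesis by simp
  qed
  thus ?thesis using fi unfolding weak_helmholtz_def by blast
qed

lemma dirichlet_eigenfunction_unique_continuation:
  assumes f: "dirichlet_eigenfunction U lam f" and lam: "lam \<ge> 0"
    and U: "open U" "bounded U" "connected U"
    and W: "open W" "W \<noteq> {}" "W \<subseteq> U"
  shows "\<not> (vanishes_on f W)"
proof
  assume "vanishes_on f W"
  hence "AE x in lebesgue. x \<in> W \<longrightarrow> indicator U x * f x = 0" by eventually_elim auto
  from helmholtz_unique_continuation[OF dirichlet_eigenfunction_weak_helmholtz[OF f U(1,2)] lam U(1,3) W this]
  have "vanishes_on f U" by eventually_elim auto
  thus False using f unfolding dirichlet_eigenfunction_def by blast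
qed

section \<open>Weak derivatives in one variable\<close>

lemma test_function_real_support:
  assumes "test_function {0<..<H::real} f" and H: "H > 0"
  obtains \<alpha> \<beta> where "0 < \<alpha>" "\<alpha> \<le> \<beta>" "\<beta> < H" "\<And>x. x \<notin> {\<alpha>..\<beta>} \<Longrightarrow> f x = 0"
proof -
  obtain K where K: "compact K" "K \<subseteq> {0<..<H}" "\<And>x. x \<notin> K \<Longrightarrow> f x = 0"
    using assms(1) unfolding test_function_def by metis
  show ?thesis
  proof (cases "K = {}")
    case True
    thus ?thesis using H K by (intro that[of "H/2" "H/2"]) auto
  next
    case False
    obtain \<alpha> where \<alpha>: "\<alpha> \<in> K" "\<forall>x\<in>K. \<alpha> \<le> x" using compact_attains_inf[OF K(1) False] by blast
    obtain \<beta> where \<beta>: "\<beta> \<in> K" "\<forall>x\<in>K. x \<le> \<beta>" using compact_attains_sup[OF K(1) False] by blast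
    show ?thesis
    proof (rule that[of \<alpha> \<beta>])
      show "f x = 0" if "x \<notin> {\<alpha>..\<beta>}" for x
        using that \<alpha>(2) \<beta>(2) by (intro K(3)) auto
    qed (use \<alpha> \<beta> K(2) in force)+
  qed
qed

lemma test_function_combination:
  assumes "test_function U f" "test_function U g"
  shows "test_function U (\<lambda>x. f x + r * g x)"
proof -
  obtain K L where K: "compact K" "K \<subseteq> U" "\<And>x. x \<notin> K \<Longrightarrow> f x = 0" 
    and L: "compact L" "L \<subseteq> U" "\<And>x. x \<notin> L \<Longrightarrow> g x = 0"
    using assms unfolding test_function_def by metis
  have "smooth (\<lambda>x. f x + r * g x)"
    using assms unfolding test_function_def smooth_def by (auto intro!: Ck_add Ck_mult Ck_const)
  thus ?thesis
    unfolding test_function_def using K L by (intro conjI exI[of _ "K \<union> L"]) auto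
qed

text \<open>Mean value \<open>0\<close> is exactly what makes the primitive vanish again to the right of the support.\<close>

lemma test_function_antiderivative:
  assumes \<eta>: "test_function {0<..<H::real} \<eta>" and H: "H > 0" and 0: "integral {0..H} \<eta> = 0"
  obtains \<psi> where "test_function {0<..<H} \<psi>" "partial 1 \<psi> = \<eta>"
proof -
  obtain \<alpha> \<beta> where ab: "0 < \<alpha>" "\<alpha> \<le> \<beta>" "\<beta> < H" and supp: "\<And>x. x \<notin> {\<alpha>..\<beta>} \<Longrightarrow> \<eta> x = 0"
    using test_function_real_support[OF \<eta> H] by metis
  have s: "smooth \<eta>" by (rule test_function_smooth[OF \<eta>])
  have c: "continuous_on S \<eta>" for S
    by (rule continuous_on_subset[OF smooth_continuous[OF s]]) auto
  have i: "\<eta> integrable_on {x..y}" for x y by (rule integrable_continuous_real[OF c])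
  define \<psi> where "\<psi> x = integral {0..x} \<eta>" for x
  have left: "\<psi> x = 0" if "x < \<alpha>" for x
  proof -
    have "integral {0..x} \<eta> = integral {0..x} (\<lambda>_. 0)"
      by (rule Henstock_Kurzweil_Integration.integral_cong) (use that in \<open>auto intro: supp\<close>)
    thus ?thesis by (simp add: \<psi>_def)
  qed
  have right: "\<psi> x = 0" if "x > \<beta>" for x
  proof -
    have z: "integral {\<beta>..y} \<eta> = 0" for y
    proof -
      have "integral {\<beta>..y} \<eta> = integral {\<beta>..y} (\<lambda>_. 0)"
        by (rule integral_spike[of "{\<beta>}"]) (auto intro!: supp)
      thus ?thesis by simp
    qed
    have "integral {0..\<beta>} \<eta> + integral {\<beta>..y} \<eta> = integral {0..y} \<eta>" if "y \<ge> \<beta>" for y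
      using that ab i by (intro Henstock_Kurzweil_Integration.integral_combine) auto
    from this[of x] this[of H] show ?thesis using z ab 0 that by (simp add: \<psi>_def)
  qed
  have der: "(\<psi> has_real_derivative \<eta> x) (at x)" for x
  proof (cases "x < \<alpha>")
    case True
    have "((\<lambda>_. 0) has_real_derivative \<eta> x) (at x)" using True supp by auto
    thus ?thesis
      by (rule has_field_derivative_transform_within_open[of _ _ _ "{..<\<alpha>}"]) (use True left in auto)
  next
    case False
    have "(\<psi> has_real_derivative \<eta> x) (at x within {0..x+1})"
      unfolding \<psi>_def by (rule integral_has_real_derivative[OF c]) (use False ab in auto)
    moreover have "at x within {0..x+1} = at x"
      using False ab by (intro at_within_interior) auto
    ultimately show ?thesis by simp
  qed
  have hd: "(\<psi> has_derivative (\<lambda>i. \<eta> x * i)) (at x)" for x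
    using der[of x] by (simp add: has_field_derivative_def)
  have "Ck n \<psi>" for n
  proof (rule Ck_Suc_imp, rule Ck_SucI[OF hd])
    show "Ck n (\<lambda>x. \<eta> x * i)" for i :: real
      using s by (intro Ck_mult Ck_const) (auto simp: smooth_def)
  qed
  hence "test_function {0<..<H} \<psi>"
    unfolding test_function_def smooth_def using ab left right
    by (intro conjI exI[of _ "{\<alpha>..\<beta>}"]) auto
  moreover have "partial 1 \<psi> = \<eta>"
    using partial_eqI[OF hd, of 1] by auto
  ultimately show ?thesis by (rule that)
qed

lemma test_function_integral_eq:
  assumes "test_function {0<..<H::real} \<eta>"
  shows "(LINT x|lebesgue. \<eta> x) = integral {0..H} \<eta>" "integrable lborel \<eta>"
proof -
  have c: "continuous_on UNIV \<eta>" by (rule smooth_continuous[OF test_function_smooth[OF assms]])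
  have z: "\<eta> x = 0" if "x \<notin> {0<..<H}" for x
    using assms that unfolding test_function_def by blast
  show i: "integrable lborel \<eta>"
    by (rule integrable_cball_support[OF c, of 0 H]) (auto intro!: z)
  have "integral\<^sup>L lebesgue \<eta> = integral\<^sup>L lborel \<eta>"
    using i by (intro integral_completion) auto
  also have "\<dots> = integral UNIV \<eta>" by (rule integral_lborel[OF i, symmetric])
  also have "\<dots> = integral {0..H} \<eta>"
  proof (rule integral_spike_set)
    have "\<eta> x = 0" if "x \<notin> {0..H}" for x using that by (intro z) auto
    hence "{x \<in> UNIV - {0..H}. \<eta> x \<noteq> 0} = {}" by blast
    thus "negligible {x \<in> UNIV - {0..H}. \<eta> x \<noteq> 0}" by (simp only: negligible_empty)
  qed simp
  finally show "(LINT x|lebesgue. \<eta> x) = integral {0..H} \<eta>" .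
qed

text \<open>Every test function is the sum of the derivative of a test function and of a multiple of a fixed bump;
\<open>h\<close> minus a suitable constant annihilates both.\<close>

lemma du_bois_reymond:
  fixes h :: "real \<Rightarrow> real"
  assumes h: "integrable lebesgue h" and H: "H > 0"
    and 0: "\<And>\<psi>. test_function {0<..<H} \<psi> \<Longrightarrow> (LINT x|lebesgue. h x * partial 1 \<psi> x) = 0"
  obtains C where "AE x in lebesgue. x \<in> {0<..<H} \<longrightarrow> h x = C"
proof -
  define \<zeta> :: "real \<Rightarrow> real" where "\<zeta> = box_bump 1 (H/4) (3*H/4)"
  have \<zeta>: "test_function {0<..<H} \<zeta>"
    unfolding \<zeta>_def by (rule test_function_box_bump) (use H in auto)
  define k where "k = (LINT x|lebesgue. \<zeta> x)"
  have "k \<noteq> 0"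
  proof
    assume "k = 0"
    hence "integral {0..H} \<zeta> = 0" unfolding k_def test_function_integral_eq(1)[OF \<zeta>] .
    moreover have "continuous_on {0..H} \<zeta>"
      by (rule continuous_on_subset[OF smooth_continuous[OF test_function_smooth[OF \<zeta>]]]) auto
    moreover have "0 \<le> \<zeta> x" for x unfolding \<zeta>_def by (rule box_bump_bounds)
    ultimately have "\<forall>x\<in>{0..H}. \<zeta> x = 0"
      using integral_eq_0_iff[of 0 H \<zeta>] H by metis
    hence "\<zeta> (H/2) = 0" using H by simp
    moreover have "\<zeta> (H/2) > 0" unfolding \<zeta>_def by (rule box_bump_pos) (use H in auto)
    ultimately show False by simp
  qed
  define C where "C = (LINT x|lebesgue. h x * \<zeta> x) / k"
  have U: "integrable lebesgue (\<lambda>x. C * indicator {0<..<H} x)"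
    by (intro integrable_mult_right integrable_real_indicator) (use H in auto)
  have "AE x in lebesgue. x \<in> {0<..<H} \<longrightarrow> h x - C * indicator {0<..<H} x = 0"
  proof (rule AE_eq_0_if_test_integrals_0)
    show "integrable lebesgue (\<lambda>x. h x - C * indicator {0<..<H} x)" using h U by simp
    fix \<psi> assume \<psi>: "test_function {0<..<H} \<psi>"
    define j where "j = (LINT x|lebesgue. \<psi> x)"
    define \<eta> where "\<eta> x = \<psi> x + (- j / k) * \<zeta> x" for x
    have \<eta>: "test_function {0<..<H} \<eta>" unfolding \<eta>_def by (rule test_function_combination[OF \<psi> \<zeta>])
    have int: "integrable lebesgue \<phi>" if "test_function {0<..<H} \<phi>" for \<phi>
      using test_function_integral_eq(2)[OF that] by (subst integrable_completion) auto
    have "(LINT x|lebesgue. \<eta> x) = j + (- j / k) * k"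
      unfolding \<eta>_def j_def k_def using int[OF \<psi>] int[OF \<zeta>] by simp
    hence "integral {0..H} \<eta> = 0"
      unfolding test_function_integral_eq(1)[OF \<eta>] using \<open>k \<noteq> 0\<close> by simp
    then obtain \<Psi> where "test_function {0<..<H} \<Psi>" "partial 1 \<Psi> = \<eta>"
      using test_function_antiderivative[OF \<eta> H] by metis
    with 0[of \<Psi>] have "(LINT x|lebesgue. h x * \<eta> x) = 0" by simp
    moreover have "(LINT x|lebesgue. h x * \<eta> x) = (LINT x|lebesgue. h x * \<psi> x) + (- j / k) * (LINT x|lebesgue. h x * \<zeta> x)"
    proof -
      have "(LINT x|lebesgue. h x * \<eta> x) = (LINT x|lebesgue. h x * \<psi> x + (- j / k) * (h x * \<zeta> x))"
        by (simp add: \<eta>_def algebra_simps)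
      thus ?thesis
        using integrable_mult_test_function[OF h \<psi>] integrable_mult_test_function[OF h \<zeta>] by simp
    qed
    ultimately have "(LINT x|lebesgue. h x * \<psi> x) = C * j" by (simp add: C_def)
    moreover have "(LINT x|lebesgue. (C * indicator {0<..<H} x) * \<psi> x) = C * j"
    proof -
      have "(\<lambda>x. (C * indicator {0<..<H} x) * \<psi> x) = (\<lambda>x. C * \<psi> x)"
        using \<psi> by (auto simp: test_function_def indicator_def fun_eq_iff)
      thus ?thesis by (simp add: j_def)
    qed
    ultimately show "(LINT x|lebesgue. (h x - C * indicator {0<..<H} x) * \<psi> x) = 0"
      using integrable_mult_test_function[OF h \<psi>] integrable_mult_test_function[OF U \<psi>]
      by (simp add: left_diff_distrib)
  qed simp
  hence "AE x in lebesgue. x \<in> {0<..<H} \<longrightarrow> h x = C" by eventually_elim auto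
  thus ?thesis by (rule that)
qed

text \<open>Fubini: the primitive of \<open>g\<close> is only absolutely continuous, so the order of integration is exchanged
instead of applying a classical integration by parts.\<close>

lemma primitive_integral_by_parts:
  fixes g \<psi> :: "real \<Rightarrow> real"
  assumes g: "integrable lborel g" and \<psi>: "test_function {0<..<H} \<psi>" and H: "H > 0"
  shows "(LBINT x. (LBINT t. (if t \<le> x then g t else 0)) * partial 1 \<psi> x) = - (LBINT t. g t * \<psi> t)"
proof -
  let ?d = "partial 1 \<psi>"
  have d: "test_function {0<..<H} ?d" by (rule test_function_partial[OF \<psi>])
  have di: "integrable lborel ?d" by (rule test_function_integral_eq(2)[OF d])
  have [measurable]: "g \<in> borel_measurable borel" "?d \<in> borel_measurable borel"
    using g di by auto
  let ?F = "\<lambda>x t. (if t \<le> x then g t else 0) * ?d x"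
  have prod: "integrable (lborel \<Otimes>\<^sub>M lborel) (\<lambda>(x, t). ?d x * g t)"
  proof (rule lborel_pair.Fubini_integrable)
    show "(\<lambda>(x, t). ?d x * g t) \<in> borel_measurable (lborel \<Otimes>\<^sub>M lborel)" by measurable
    show "integrable lborel (\<lambda>x. LBINT y. norm (case (x, y) of (x, t) \<Rightarrow> ?d x * g t))"
      using di by (simp add: abs_mult)
    show "AE x in lborel. integrable lborel (\<lambda>y. case (x, y) of (x, t) \<Rightarrow> ?d x * g t)"
      using g by simp
  qed
  have int: "integrable (lborel \<Otimes>\<^sub>M lborel) (case_prod ?F)"
  proof (rule Bochner_Integration.integrable_bound[OF prod])
    show "case_prod ?F \<in> borel_measurable (lborel \<Otimes>\<^sub>M lborel)" by measurable
    show "AE z in lborel \<Otimes>\<^sub>M lborel. norm (case_prod ?F z) \<le> norm (case z of (x, t) \<Rightarrow> ?d x * g t)"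
      by (intro AE_I2) (auto simp: abs_mult)
  qed
  have inner: "(LBINT x. ?F x t) = - (g t * \<psi> t)" for t
  proof -
    have s: "smooth \<psi>" "smooth ?d" using test_function_smooth[OF \<psi>] test_function_smooth[OF d] by auto
    obtain \<alpha> \<beta> where ab: "0 < \<alpha>" "\<alpha> \<le> \<beta>" "\<beta> < H" and supp: "\<And>x. x \<notin> {\<alpha>..\<beta>} \<Longrightarrow> \<psi> x = 0"
      using test_function_real_support[OF \<psi> H] by metis
    define T where "T = max t H"
    have dz: "?d x = 0" if "x \<ge> H" for x using d that unfolding test_function_def by force
    have "(LBINT x. ?F x t) = (LBINT x. g t * (indicator {t..T} x *\<^sub>R ?d x))"
      by (rule Bochner_Integration.integral_cong) (auto simp: indicator_def T_def dz)
    also have "\<dots> = g t * (LBINT x. indicator {t..T} x *\<^sub>R ?d x)" by simp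
    also have "(LBINT x. indicator {t..T} x *\<^sub>R ?d x) = \<psi> T - \<psi> t"
    proof (rule integral_FTC_atLeastAtMost)
      show "(\<psi> has_vector_derivative ?d x) (at x within {t..T})" for x
      proof -
        have "(\<psi> has_derivative (\<lambda>v. partial v \<psi> x)) (at x)" by (rule smooth_has_derivative[OF s(1)])
        moreover have "(\<lambda>v. partial v \<psi> x) = (\<lambda>v. v *\<^sub>R ?d x)"
        proof
          fix v show "partial v \<psi> x = v *\<^sub>R ?d x"
            using linear_cmul[OF smooth_linear_partial[OF s(1)], of v 1 x] by simp
        qed
        ultimately have "(\<psi> has_vector_derivative ?d x) (at x)" by (simp only: has_vector_derivative_def)
        thus ?thesis by (rule has_vector_derivative_at_within)
      qed
      show "continuous_on {t..T} ?d" by (rule continuous_on_subset[OF smooth_continuous[OF s(2)]]) auto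
    qed (simp add: T_def)
    also have "\<psi> T = 0" using ab by (intro supp) (auto simp: T_def)
    finally show ?thesis by simp
  qed
  have "(LBINT x. (LBINT t. (if t \<le> x then g t else 0)) * ?d x) = (LBINT x. LBINT t. ?F x t)"
    by simp
  also have "\<dots> = (LBINT t. LBINT x. ?F x t)"
    by (rule lborel_pair.Fubini_integral[OF int, symmetric])
  finally show ?thesis by (simp add: inner)
qed

text \<open>\<open>f\<close> and the primitive \<open>G\<close> of \<open>g\<close> have the same weak derivative, hence differ by a constant.\<close>

lemma weak_deriv_primitive:
  fixes f g :: "real \<Rightarrow> real"
  assumes fg: "weak_deriv {0<..<H} 1 f g" and H: "H > 0"
  obtains F where "AE x in lebesgue. x \<in> {0<..<H} \<longrightarrow> f x = F x"
    "\<And>s t. 0 \<le> s \<Longrightarrow> s \<le> t \<Longrightarrow> t \<le> H \<Longrightarrow> F t - F s = integral {s..t} g"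
    "continuous_on {0..H} F" "g absolutely_integrable_on {0..H}"
proof -
  define g0 where "g0 x = indicator {0<..<H} x * g x" for x
  define f0 where "f0 x = indicator {0<..<H} x * f x" for x
  have g0: "integrable lebesgue g0" and f0: "integrable lebesgue f0"
    unfolding g0_def f0_def using fg by (auto intro!: L2_on_integrable simp: weak_deriv_def)
  have gabs: "g absolutely_integrable_on {0..H}"
  proof -
    have "g absolutely_integrable_on {0<..<H}" using g0 by (simp add: set_integrable_def g0_def[abs_def])
    moreover have "g absolutely_integrable_on {0<..<H} \<longleftrightarrow> g absolutely_integrable_on {0..H}"
      by (rule absolutely_integrable_spike_set_eq; rule negligible_subset[of "{0, H}"]) auto
    ultimately show ?thesis by simp
  qed
  have gint: "g integrable_on {s..t}" if "0 \<le> s" "t \<le> H" for s t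
    by (rule set_lebesgue_integral_eq_integral(1), rule set_integrable_subset[OF gabs]) (use that in auto)
  define G where "G x = integral {0..x} g" for x
  have Gc: "continuous_on {0..H} G" unfolding G_def by (rule indefinite_integral_continuous_1[OF gint]) auto
  from g0 obtain g1 where g1 [measurable]: "g1 \<in> borel_measurable borel" and g1i: "integrable lborel g1"
    and "integral\<^sup>L lborel g1 = integral\<^sup>L lebesgue g0" and ae: "AE x in lebesgue. g0 x = g1 x"
    by (rule lebesgue_integrable_borel_version)
  have g1l: "integrable lebesgue g1" using g1i by (subst integrable_completion) auto
  have G_eq: "(LBINT t. (if t \<le> x then g1 t else 0)) = G x" if x: "x \<in> {0<..<H}" for x
  proof -
    have "(LBINT t. (if t \<le> x then g1 t else 0)) = (LINT t|lebesgue. (if t \<le> x then g1 t else 0))"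
      by (rule integral_completion[symmetric]) measurable
    also have "\<dots> = (LINT t|lebesgue. indicator {0<..x} t *\<^sub>R g t)"
    proof (rule Bochner_Integration.integral_cong_AE)
      have "(\<lambda>t. if t \<le> x then g1 t else 0) \<in> borel_measurable lborel" by measurable
      thus "(\<lambda>t. if t \<le> x then g1 t else 0) \<in> borel_measurable lebesgue" by (auto intro: measurable_completion)
      have "set_integrable lebesgue {0<..x} g" by (rule set_integrable_subset[OF gabs]) (use x in auto)
      thus "(\<lambda>t. indicator {0<..x} t *\<^sub>R g t) \<in> borel_measurable lebesgue"
        unfolding set_integrable_def by (rule borel_measurable_integrable)
      show "AE t in lebesgue. (if t \<le> x then g1 t else 0) = indicator {0<..x} t *\<^sub>R g t"
        using ae by eventually_elim (use x in \<open>auto simp: g0_def indicator_def split: if_splits\<close>)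
    qed
    also have "\<dots> = integral {0<..x} g"
    proof -
      have "set_integrable lebesgue {0<..x} g" by (rule set_integrable_subset[OF gabs]) (use x in auto)
      from set_lebesgue_integral_eq_integral(2)[OF this] show ?thesis by (simp add: set_lebesgue_integral_def)
    qed
    also have "\<dots> = G x"
      unfolding G_def by (rule integral_spike_set; rule negligible_subset[of "{0}"]) auto
    finally show ?thesis .
  qed
  define h where "h x = f0 x - indicator {0<..<H} x * G x" for x
  have GI: "integrable lebesgue (\<lambda>x. indicator {0<..<H} x * G x)"
  proof -
    have "G absolutely_integrable_on {0<..<H}"
      by (rule set_integrable_subset[OF absolutely_integrable_continuous_real[OF Gc]]) auto
    thus ?thesis by (simp add: set_integrable_def)
  qed
  have hi: "integrable lebesgue h" unfolding h_def using f0 GI by simp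
  have "(LINT x|lebesgue. h x * partial 1 \<psi> x) = 0" if \<psi>: "test_function {0<..<H} \<psi>" for \<psi>
  proof -
    note d = test_function_partial[OF \<psi>, of 1]
    have "(LINT x|lebesgue. f0 x * partial 1 \<psi> x) = - (LINT x|lebesgue. g0 x * \<psi> x)"
      unfolding f0_def g0_def by (rule weak_derivD[OF fg \<psi>])
    also have "(LINT x|lebesgue. g0 x * \<psi> x) = (LINT x|lebesgue. g1 x * \<psi> x)"
    proof (rule Bochner_Integration.integral_cong_AE)
      show "AE x in lebesgue. g0 x * \<psi> x = g1 x * \<psi> x" using ae by eventually_elim simp
      show "(\<lambda>x. g0 x * \<psi> x) \<in> borel_measurable lebesgue" "(\<lambda>x. g1 x * \<psi> x) \<in> borel_measurable lebesgue"
        using integrable_mult_test_function[OF g0 \<psi>] integrable_mult_test_function[OF g1l \<psi>] by auto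
    qed
    also have "\<dots> = (LBINT x. g1 x * \<psi> x)"
      using g1 test_function_measurable[OF \<psi>] by (intro integral_completion borel_measurable_times) auto
    also have "\<dots> = - (LBINT x. (LBINT t. (if t \<le> x then g1 t else 0)) * partial 1 \<psi> x)"
      using primitive_integral_by_parts[OF g1i \<psi> H] by simp
    also have "(LBINT x. (LBINT t. (if t \<le> x then g1 t else 0)) * partial 1 \<psi> x) =
       (LINT x|lebesgue. (LBINT t. (if t \<le> x then g1 t else 0)) * partial 1 \<psi> x)"
    proof (rule integral_completion[symmetric])
      note [measurable] = test_function_measurable[OF d]
      show "(\<lambda>x. (LBINT t. (if t \<le> x then g1 t else 0)) * partial 1 \<psi> x) \<in> borel_measurable lborel"
        by measurable
    qed
    also have "\<dots> = (LINT x|lebesgue. (indicator {0<..<H} x * G x) * partial 1 \<psi> x)"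
    proof (rule Bochner_Integration.integral_cong)
      fix x
      show "(LBINT t. (if t \<le> x then g1 t else 0)) * partial 1 \<psi> x = (indicator {0<..<H} x * G x) * partial 1 \<psi> x"
        using G_eq[of x] d by (cases "x \<in> {0<..<H}") (auto simp: test_function_def)
    qed simp
    finally show ?thesis
      using integrable_mult_test_function[OF f0 d] integrable_mult_test_function[OF GI d]
      by (simp add: h_def left_diff_distrib)
  qed
  from du_bois_reymond[OF hi H this] obtain C where C: "AE x in lebesgue. x \<in> {0<..<H} \<longrightarrow> h x = C" by metis
  show ?thesis
  proof (rule that[of "\<lambda>x. C + G x"])
    show "AE x in lebesgue. x \<in> {0<..<H} \<longrightarrow> f x = C + G x"
      using C by eventually_elim (auto simp: h_def f0_def)
    show "(C + G t) - (C + G s) = integral {s..t} g" if "0 \<le> s" "s \<le> t" "t \<le> H" for s t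
    proof -
      have "integral {0..s} g + integral {s..t} g = integral {0..t} g"
        using that gint by (intro Henstock_Kurzweil_Integration.integral_combine) auto
      thus ?thesis by (simp add: G_def)
    qed
    show "continuous_on {0..H} (\<lambda>x. C + G x)" by (intro continuous_intros Gc)
  qed (rule gabs)
qed

section \<open>Bounded variation and a Gronwall inequality\<close>

text \<open>On a partition into \<open>N\<close> equal pieces the growth factors \<open>1 + \<Delta>T\<close> multiply up to at most
\<open>exp (T b - T a)\<close>, while the errors, each of the form variation times mesh, add up to something that tends
to \<open>0\<close> with the mesh.\<close>

lemma gronwall_bounded_variation:
  fixes f T :: "real \<Rightarrow> real"
  assumes ab: "a \<le> b" and T: "\<And>s t. a \<le> s \<Longrightarrow> s \<le> t \<Longrightarrow> t \<le> b \<Longrightarrow> T s \<le> T t"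
    and C: "C \<ge> 0" and f: "\<And>s. a \<le> s \<Longrightarrow> s \<le> b \<Longrightarrow> f s \<ge> 0"
    and step: "\<And>s t. a \<le> s \<Longrightarrow> s \<le> t \<Longrightarrow> t \<le> b \<Longrightarrow> 
      f t \<le> f s * (1 + (T t - T s)) + C * (T t - T s) * (t - s)"
  shows "f b \<le> exp (T b - T a) * f a"
proof -
  have bound: "f b \<le> exp (T b - T a) * (f a + C * ((b - a) / real N) * (T b - T a))" if N: "N > 0" for N :: nat
  proof -
    define d where "d = (b - a) / real N"
    define s where "s j = a + real j * d" for j
    have d: "d \<ge> 0" using ab by (simp add: d_def)
    have sN: "s N = b" using N by (simp add: s_def d_def)
    have sa: "a \<le> s j" for j using d by (simp add: s_def)
    have mono: "s i \<le> s j" if "i \<le> j" for i j using d that by (simp add: s_def mult_right_mono)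
    have sb: "s j \<le> b" if "j \<le> N" for j using mono[OF that] sN by simp
    have "j \<le> N \<Longrightarrow> f (s j) \<le> exp (T (s j) - T a) * (f a + C * d * (T (s j) - T a))" for j
    proof (induction j)
      case 0
      thus ?case by (simp add: s_def)
    next
      case (Suc j)
      let ?v = "T (s (Suc j)) - T (s j)" and ?w = "T (s j) - T a"
      have v: "?v \<ge> 0" and w: "?w \<ge> 0" using T sa sb Suc.prems mono[of j "Suc j"] by simp_all
      have fa: "f a \<ge> 0" using f ab by simp
      have IH: "f (s j) \<le> exp ?w * (f a + C * d * ?w)" using Suc by simp
      have "f (s (Suc j)) \<le> f (s j) * (1 + ?v) + C * ?v * (s (Suc j) - s j)"
        using step[of "s j" "s (Suc j)"] sa sb Suc.prems mono[of j "Suc j"] by simp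
      also have "s (Suc j) - s j = d" by (simp add: s_def algebra_simps)
      also have "f (s j) * (1 + ?v) \<le> (exp ?w * (f a + C * d * ?w)) * exp ?v"
        using IH f[of "s j"] sa sb Suc.prems v by (intro mult_mono) auto
      also have "(exp ?w * (f a + C * d * ?w)) * exp ?v = exp (?w + ?v) * (f a + C * d * ?w)"
        unfolding exp_add by (simp only: ac_simps)
      also have "C * ?v * d \<le> exp (?w + ?v) * (C * d * ?v)"
      proof -
        have "1 * (C * d * ?v) \<le> exp (?w + ?v) * (C * d * ?v)"
          using v w C d by (intro mult_right_mono) auto
        thus ?thesis by (simp add: algebra_simps)
      qed
      finally show ?case by (simp add: algebra_simps)
    qed
    from this[of N] show ?thesis by (simp add: sN d_def)
  qed
  have "(\<lambda>N. exp (T b - T a) * (f a + C * ((b - a) / real N) * (T b - T a))) \<longlonglongrightarrow> exp (T b - T a) * (f a + C * 0 * (T b - T a))"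
    by (intro tendsto_intros lim_const_over_n)
  hence "f b \<le> exp (T b - T a) * (f a + C * 0 * (T b - T a))"
    by (rule tendsto_lowerbound) (use bound in \<open>auto intro!: eventually_mono[OF eventually_gt_at_top[of 0]]\<close>)
  thus ?thesis by simp
qed

text \<open>On an interval where the variation is infinite, the default value \<open>0\<close> of \<open>real_of_ereal\<close> is taken; under a bound
on the total variation this does not happen.\<close>

definition variation_upto :: "(real \<Rightarrow> real) \<Rightarrow> real \<Rightarrow> real" where
  "variation_upto c y = real_of_ereal (total_variation {0<..y} c)"

lemma total_variation_nonneg: "0 \<le> total_variation S c"
  unfolding total_variation_def by (rule SUP_upper2[of "[]"]) (auto simp: zero_ereal_def)

lemma total_variation_mono: "S \<subseteq> S' \<Longrightarrow> total_variation S c \<le> total_variation S' c"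
  unfolding total_variation_def by (rule SUP_subset_mono) auto

lemma variation_sum_append:
  fixes c :: "real \<Rightarrow> real"
  shows "(\<Sum>i<length (xs @ [s, t]) - 1. \<bar>c ((xs @ [s, t]) ! Suc i) - c ((xs @ [s, t]) ! i)\<bar>)
    \<ge> (\<Sum>i<length xs - 1. \<bar>c (xs ! Suc i) - c (xs ! i)\<bar>) + \<bar>c t - c s\<bar>"
proof -
  let ?g = "\<lambda>i. \<bar>c ((xs @ [s, t]) ! Suc i) - c ((xs @ [s, t]) ! i)\<bar>"
  have "(\<Sum>i<length xs - 1. \<bar>c (xs ! Suc i) - c (xs ! i)\<bar>) = (\<Sum>i<length xs - 1. ?g i)"
    by (intro sum.cong) (auto simp: nth_append)
  also have "\<dots> \<le> (\<Sum>i<length xs. ?g i)"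
    by (intro sum_mono2) auto
  also have "?g (length xs) = \<bar>c t - c s\<bar>" by (simp add: nth_append)
  ultimately show ?thesis by simp
qed

lemma total_variation_increment:
  assumes "s \<le> t" "0 < s"
  shows "total_variation {0<..s} c + ereal \<bar>c t - c s\<bar> \<le> total_variation {0<..t} c"
proof -
  let ?I = "{xs. sorted xs \<and> set xs \<subseteq> {0<..s}}"
  have "ereal (\<Sum>i<length xs - 1. \<bar>c (xs ! Suc i) - c (xs ! i)\<bar>) + ereal \<bar>c t - c s\<bar> \<le> total_variation {0<..t} c"
    if "xs \<in> ?I" for xs
  proof -
    have "xs @ [s, t] \<in> {xs. sorted xs \<and> set xs \<subseteq> {0<..t}}"
      using that assms by (auto simp: sorted_append)
    thus ?thesis
      unfolding total_variation_def
      by (rule SUP_upper2) (use variation_sum_append[where c=c and xs=xs and s=s and t=t] in simp)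
  qed
  moreover have "?I \<noteq> {}" by (auto intro!: exI[of _ "[]"])
  ultimately show ?thesis
    unfolding total_variation_def[of "{0<..s}"]
    by (subst SUP_ereal_add_left[symmetric]) (auto intro!: SUP_least)
qed

lemma variation_upto_bounds:
  assumes V: "total_variation {0<..<H} c \<le> ereal V" and y: "y < H"
  shows "0 \<le> variation_upto c y" "variation_upto c y \<le> V"
    "total_variation {0<..y} c = ereal (variation_upto c y)"
proof -
  have le: "total_variation {0<..y} c \<le> ereal V"
    using y by (intro order_trans[OF total_variation_mono V]) auto
  show eq: "total_variation {0<..y} c = ereal (variation_upto c y)"
    using total_variation_nonneg[of "{0<..y}" c] le unfolding variation_upto_def
    by (cases "total_variation {0<..y} c") auto
  show "0 \<le> variation_upto c y" "variation_upto c y \<le> V"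
    using total_variation_nonneg[of "{0<..y}" c] le unfolding eq by auto
qed

lemma variation_upto_increment:
  assumes V: "total_variation {0<..<H} c \<le> ereal V" and "0 < s" "s \<le> t" "t < H"
  shows "\<bar>c t - c s\<bar> \<le> variation_upto c t - variation_upto c s"
  using total_variation_increment[of s t c] assms
    variation_upto_bounds(3)[OF V, of s] variation_upto_bounds(3)[OF V, of t]
  by simp

lemma integral_norm_bound_integral_off_negligible:
  fixes f :: "real \<Rightarrow> real"
  assumes f: "f integrable_on S" and g: "g integrable_on S" and N: "negligible N"
    and le: "\<And>x. x \<in> S - N \<Longrightarrow> norm (f x) \<le> g x"
  shows "norm (integral S f) \<le> integral S g"
proof -
  let ?f = "\<lambda>x. if x \<in> N then 0 else f x" and ?g = "\<lambda>x. if x \<in> N then 0 else g x"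
  have "norm (integral S ?f) \<le> integral S ?g"
  proof (rule integral_norm_bound_integral)
    show "?f integrable_on S" "?g integrable_on S"
      by (rule integrable_spike[OF f N], simp) (rule integrable_spike[OF g N], simp)
  qed (use le in auto)
  moreover have "integral S ?f = integral S f" "integral S ?g = integral S g"
    by (rule integral_spike[OF N], simp)+
  ultimately show ?thesis by simp
qed

text \<open>\<open>F\<close> and \<open>G\<close> are only Lipschitz, so the product cannot be differentiated at a given point. But the defect
\<open>D\<close> of the integrated product rule is quadratically small on short intervals, hence has derivative \<open>0\<close>
everywhere.\<close>

lemma product_indefinite_integral:
  fixes F G f g :: "real \<Rightarrow> real"
  assumes ab: "a \<le> b"
    and f: "f integrable_on {a..b}" and g: "g integrable_on {a..b}"
    and F: "\<And>s t. a \<le> s \<Longrightarrow> s \<le> t \<Longrightarrow> t \<le> b \<Longrightarrow> F t - F s = integral {s..t} f"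
    and G: "\<And>s t. a \<le> s \<Longrightarrow> s \<le> t \<Longrightarrow> t \<le> b \<Longrightarrow> G t - G s = integral {s..t} g"
    and N: "negligible N" "\<And>t. t \<in> {a..b} - N \<Longrightarrow> \<bar>f t\<bar> \<le> A" "\<And>t. t \<in> {a..b} - N \<Longrightarrow> \<bar>g t\<bar> \<le> B"
    and h: "(\<lambda>t. f t * G t + F t * g t) integrable_on {a..b}"
  shows "F b * G b - F a * G a = integral {a..b} (\<lambda>t. f t * G t + F t * g t)"
proof -
  define AB where "AB = \<bar>A\<bar> * \<bar>B\<bar>"
  have lip: "\<bar>K t - K s\<bar> \<le> \<bar>D\<bar> * (t - s)" if st: "a \<le> s" "s \<le> t" "t \<le> b" and k: "k integrable_on {a..b}"
      and K: "K t - K s = integral {s..t} k" and D: "\<And>t. t \<in> {a..b} - N \<Longrightarrow> \<bar>k t\<bar> \<le> D"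
    for s t D :: real and K k :: "real \<Rightarrow> real"
  proof -
    have "norm (integral {s..t} k) \<le> integral {s..t} (\<lambda>_. \<bar>D\<bar>)"
    proof (rule integral_norm_bound_integral_off_negligible[where N=N])
      show "k integrable_on {s..t}" using integrable_on_subinterval[OF k] st by simp
      show "norm (k x) \<le> \<bar>D\<bar>" if "x \<in> {s..t} - N" for x
        using D[of x] that st by simp
    qed (use N in auto)
    thus ?thesis using K st by (simp add: mult.commute)
  qed
  have lipF: "\<bar>F t - F s\<bar> \<le> \<bar>A\<bar> * (t - s)" and lipG: "\<bar>G t - G s\<bar> \<le> \<bar>B\<bar> * (t - s)"
    if "a \<le> s" "s \<le> t" "t \<le> b" for s t
    using lip[OF that f F[OF that] N(2)] lip[OF that g G[OF that] N(3)] by auto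
  define h where "h t = f t * G t + F t * g t" for t
  define D where "D t = F t * G t - F a * G a - integral {a..t} h" for t
  have hint: "h integrable_on {a..b}" using h unfolding h_def .
  have quad: "\<bar>D t - D s\<bar> \<le> (2 * AB) * (t - s)\<^sup>2" if st: "a \<le> s" "s \<le> t" "t \<le> b" for s t
  proof -
    have sub: "{s..t} \<subseteq> {a..b}" using st by auto
    note int = integrable_on_subinterval[OF f sub] integrable_on_subinterval[OF g sub] integrable_on_subinterval[OF hint sub]
    have "integral {a..s} h + integral {s..t} h = integral {a..t} h"
      using st integrable_on_subinterval[OF hint, of a t] by (intro Henstock_Kurzweil_Integration.integral_combine) auto
    hence "D t - D s = (F t - F s) * G t + F s * (G t - G s) - integral {s..t} h"
      by (simp add: D_def algebra_simps)
    also have "\<dots> = integral {s..t} f * G t + F s * integral {s..t} g - integral {s..t} h"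
      using F G st by simp
    also have "\<dots> = integral {s..t} (\<lambda>x. f x * G t + F s * g x - h x)"
      using int by (simp add: Henstock_Kurzweil_Integration.integral_diff Henstock_Kurzweil_Integration.integral_add 
          integrable_on_mult_left integrable_on_mult_right integrable_add)
    finally have "\<bar>D t - D s\<bar> = norm (integral {s..t} (\<lambda>x. f x * G t + F s * g x - h x))" by simp
    also have "\<dots> \<le> integral {s..t} (\<lambda>_. 2 * AB * (t - s))"
    proof (rule integral_norm_bound_integral_off_negligible[where N=N])
      show "(\<lambda>x. f x * G t + F s * g x - h x) integrable_on {s..t}"
        using int by (intro integrable_diff integrable_add integrable_on_mult_left integrable_on_mult_right)
      fix x assume x: "x \<in> {s..t} - N"
      have "f x * G t + F s * g x - h x = f x * (G t - G x) - g x * (F x - F s)"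
        by (simp add: h_def algebra_simps)
      also have "\<bar>\<dots>\<bar> \<le> \<bar>f x\<bar> * \<bar>G t - G x\<bar> + \<bar>g x\<bar> * \<bar>F x - F s\<bar>"
        by (metis abs_mult abs_triangle_ineq4)
      also have "\<dots> \<le> \<bar>A\<bar> * (\<bar>B\<bar> * (t - s)) + \<bar>B\<bar> * (\<bar>A\<bar> * (t - s))"
      proof (intro add_mono mult_mono)
        have "x \<in> {a..b} - N" using x st by auto
        thus "\<bar>f x\<bar> \<le> \<bar>A\<bar>" "\<bar>g x\<bar> \<le> \<bar>B\<bar>" using N(2,3)[of x] by linarith+
        have "\<bar>B\<bar> * (t - x) \<le> \<bar>B\<bar> * (t - s)" "\<bar>A\<bar> * (x - s) \<le> \<bar>A\<bar> * (t - s)"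
          using x by (auto intro: mult_left_mono)
        thus "\<bar>G t - G x\<bar> \<le> \<bar>B\<bar> * (t - s)" "\<bar>F x - F s\<bar> \<le> \<bar>A\<bar> * (t - s)" 
          using lipG[of x t] lipF[of s x] x st by force+
      qed (use st in auto)
      finally show "norm (f x * G t + F s * g x - h x) \<le> 2 * AB * (t - s)" by (simp add: AB_def algebra_simps)
    qed (use N in auto)
    also have "\<dots> = 2 * AB * (t - s)\<^sup>2" using st by (simp add: power2_eq_square)
    finally show ?thesis .
  qed
  have "D b = D a"
  proof (cases "a = b")
    case False
    have quad': "\<bar>D y - D x\<bar> \<le> 2 * AB * (y - x)\<^sup>2" if "x \<in> {a..b}" "y \<in> {a..b}" for x y
      using quad[of x y] quad[of y x] that by (cases "x \<le> y") (auto simp: power2_commute abs_minus_commute)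
    have "(D has_field_derivative 0) (at x within {a..b})" if x: "x \<in> {a..b}" for x
      by (rule has_derivative_if_quadratic_bound[where C="2 * AB"]) (use quad'[OF x] in auto)
    then obtain c where "\<forall>x\<in>{a..b}. D x = c"
      using has_field_derivative_zero_constant[of "{a..b}" D] by auto
    thus ?thesis using ab by auto
  qed simp
  thus ?thesis using ab by (simp add: D_def h_def[abs_def])
qed

section \<open>The oscillator with a coefficient of bounded variation\<close>

lemma integrable_continuous_mult:
  fixes W g :: "real \<Rightarrow> real"
  assumes "continuous_on {s..t} W" "g absolutely_integrable_on {s..t}"
  shows "(\<lambda>x. W x * g x) integrable_on {s..t}"
proof -
  have "(\<lambda>x. W x * g x) absolutely_integrable_on {s..t}"
  proof (rule absolutely_integrable_bounded_measurable_product_real)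
    show "W \<in> borel_measurable (lebesgue_on {s..t})"
      using assms(1) by (intro continuous_imp_measurable_on_sets_lebesgue) auto
    show "bounded (W ` {s..t})"
      by (intro compact_imp_bounded compact_continuous_image assms) auto
  qed (use assms in auto)
  thus ?thesis by (rule set_lebesgue_integral_eq_integral(1))
qed

text \<open>The equation \<open>U'' = - lam p U\<close> in integrated form, with \<open>W = U'\<close> and \<open>g = U''\<close>. The second derivative is
kept as a separate function since \<open>p\<close> jumps: it agrees with \<open>- lam p U\<close> outside the null set \<open>N\<close>.\<close>

locale bounded_variation_oscillator =
  fixes H cm V lam \<nu> \<kappa> P :: real and c p U W g :: "real \<Rightarrow> real" and N :: "real set"
  assumes H: "H > 0" and cm: "cm > 0" and lam: "lam > 0" and \<kappa>: "\<kappa> > 0"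
    and c_ge: "\<And>y. y \<in> {0<..<H} \<Longrightarrow> cm \<le> c y"
    and TV: "total_variation {0<..<H} c \<le> ereal V"
    and p: "\<And>y. p y = 1 / c y - \<nu>"
    and p_bounds: "\<And>y. y \<in> {0<..<H} \<Longrightarrow> \<kappa> \<le> p y" "\<And>y. y \<in> {0<..<H} \<Longrightarrow> p y \<le> P"
    and U_cont: "continuous_on {0..H} U" and W_cont: "continuous_on {0..H} W"
    and U_diff: "\<And>s t. 0 \<le> s \<Longrightarrow> s \<le> t \<Longrightarrow> t \<le> H \<Longrightarrow> U t - U s = integral {s..t} W"
    and W_diff: "\<And>s t. 0 \<le> s \<Longrightarrow> s \<le> t \<Longrightarrow> t \<le> H \<Longrightarrow> W t - W s = integral {s..t} g"
    and g_int: "g absolutely_integrable_on {0..H}"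
    and N: "negligible N" and g_eq: "\<And>t. t \<in> {0<..<H} - N \<Longrightarrow> g t = - lam * p t * U t"
begin

text \<open>Conserved when \<open>p\<close> is constant; a jump of \<open>p\<close> changes it by the jump times \<open>U\<^sup>2\<close>.\<close>

definition energy :: "real \<Rightarrow> real" where
  "energy y = (W y)\<^sup>2 / lam + p y * (U y)\<^sup>2"

text \<open>The normalisation makes a change of \<open>p\<close> cost a relative change of the energy of at most the increment of
this function, since \<open>\<kappa> U\<^sup>2\<close> is at most the energy.\<close>

definition scaled_variation :: "real \<Rightarrow> real" where
  "scaled_variation y = variation_upto c y / (cm\<^sup>2 * \<kappa>)"

lemma p_increment:
  assumes "0 < s" "s \<le> t" "t < H"
  shows "\<bar>p t - p s\<bar> \<le> \<kappa> * (scaled_variation t - scaled_variation s)"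
proof -
  have c: "cm \<le> c t" "cm \<le> c s" using c_ge assms by auto
  have "p t - p s = (c s - c t) / (c s * c t)" using c cm by (simp add: p field_simps)
  also have "\<bar>\<dots>\<bar> \<le> \<bar>c t - c s\<bar> / cm\<^sup>2"
    using c cm unfolding abs_divide power2_eq_square
    by (intro frac_le) (auto simp: abs_mult intro!: mult_mono)
  also have "\<dots> \<le> (variation_upto c t - variation_upto c s) / cm\<^sup>2"
    using variation_upto_increment[OF TV assms] by (intro divide_right_mono) auto
  also have "\<dots> = \<kappa> * (scaled_variation t - scaled_variation s)"
    using \<kappa> by (simp add: scaled_variation_def diff_divide_distrib[symmetric])
  finally show ?thesis .
qed

lemma scaled_variation_mono:
  "0 < s \<Longrightarrow> s \<le> t \<Longrightarrow> t < H \<Longrightarrow> scaled_variation s \<le> scaled_variation t"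
  using p_increment[of s t] \<kappa> abs_ge_zero[of "p t - p s"] 
  by (metis diff_ge_0_iff_ge order_trans zero_le_mult_iff not_less)

lemma scaled_variation_bounds:
  assumes "y < H" shows "0 \<le> scaled_variation y" "scaled_variation y \<le> V / (cm\<^sup>2 * \<kappa>)"
  using variation_upto_bounds[OF TV assms] cm \<kappa>
  by (auto simp: scaled_variation_def intro!: divide_right_mono divide_nonneg_pos)

lemma energy_nonneg: "y \<in> {0<..<H} \<Longrightarrow> 0 \<le> energy y"
  using p_bounds(1)[of y] \<kappa> lam by (auto simp: energy_def)

lemma kappa_U2_le_energy: 
  assumes "y \<in> {0<..<H}" shows "\<kappa> * (U y)\<^sup>2 \<le> energy y"
proof -
  have "\<kappa> * (U y)\<^sup>2 \<le> p y * (U y)\<^sup>2" using p_bounds(1)[OF assms] by (intro mult_right_mono) auto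
  thus ?thesis using lam by (simp add: energy_def add_increasing)
qed

lemma bounds: obtains B where "B > 0" "\<And>y. y \<in> {0..H} \<Longrightarrow> \<bar>U y\<bar> \<le> B" "\<And>y. y \<in> {0..H} \<Longrightarrow> \<bar>W y\<bar> \<le> B"
proof -
  obtain B1 B2 where "B1 \<ge> 0" "\<And>y. y \<in> {0..H} \<Longrightarrow> norm (U y) \<le> B1" "B2 \<ge> 0" "\<And>y. y \<in> {0..H} \<Longrightarrow> norm (W y) \<le> B2"
    using continuous_on_compact_bound[OF compact_Icc U_cont] continuous_on_compact_bound[OF compact_Icc W_cont] by metis
  thus ?thesis by (intro that[of "B1 + B2 + 1"]) force+
qed

lemma g_bound:
  assumes B: "\<And>y. y \<in> {0..H} \<Longrightarrow> \<bar>U y\<bar> \<le> B" and y: "y \<in> {0..H} - (N \<union> {0, H})"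
  shows "\<bar>g y\<bar> \<le> lam * P * B"
proof -
  have y': "y \<in> {0<..<H} - N" using y by auto
  have "\<bar>g y\<bar> = lam * p y * \<bar>U y\<bar>" 
    using g_eq[OF y'] p_bounds(1)[of y] \<kappa> lam y' by (simp add: abs_mult)
  also have "\<dots> \<le> lam * P * B"
    using p_bounds[of y] y' \<kappa> lam B[of y] by (intro mult_mono) auto
  finally show ?thesis .
qed

lemma g_int_sub: "0 \<le> s \<Longrightarrow> t \<le> H \<Longrightarrow> g absolutely_integrable_on {s..t}"
  by (rule set_integrable_subset[OF g_int]) auto

lemma continuous_sub: 
  assumes "0 \<le> s" "t \<le> H" shows "continuous_on {s..t} U" "continuous_on {s..t} W"
  using continuous_on_subset[OF U_cont] continuous_on_subset[OF W_cont] assms by auto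

lemma W2_diff:
  assumes "0 \<le> s" "s \<le> t" "t \<le> H"
  shows "(W t)\<^sup>2 - (W s)\<^sup>2 = integral {s..t} (\<lambda>x. 2 * (W x * g x))"
proof -
  obtain B where B: "\<And>y. y \<in> {0..H} \<Longrightarrow> \<bar>U y\<bar> \<le> B" using bounds by metis
  have "W t * W t - W s * W s = integral {s..t} (\<lambda>x. g x * W x + W x * g x)"
  proof (rule product_indefinite_integral[where N="N \<union> {0, H}" and A="lam * P * B" and B="lam * P * B"])
    show "g integrable_on {s..t}" "g integrable_on {s..t}"
      using g_int_sub[of s t] assms by (simp_all add: set_lebesgue_integral_eq_integral(1))
    have "(\<lambda>x. W x * g x) integrable_on {s..t}"
      by (intro integrable_continuous_mult continuous_sub g_int_sub) (use assms in auto)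
    thus "(\<lambda>x. g x * W x + W x * g x) integrable_on {s..t}"
      by (intro integrable_add) (simp_all add: mult.commute)
  qed (use assms W_diff g_bound[OF B] N in auto)
  thus ?thesis by (simp add: power2_eq_square mult.commute)
qed

lemma U2_diff:
  assumes "0 \<le> s" "s \<le> t" "t \<le> H"
  shows "(U t)\<^sup>2 - (U s)\<^sup>2 = integral {s..t} (\<lambda>x. 2 * (U x * W x))"
proof -
  obtain B where B: "\<And>y. y \<in> {0..H} \<Longrightarrow> \<bar>W y\<bar> \<le> B" using bounds by metis
  have "U t * U t - U s * U s = integral {s..t} (\<lambda>x. W x * U x + U x * W x)"
  proof (rule product_indefinite_integral[where N="{}" and A=B and B=B])
    show "W integrable_on {s..t}" "W integrable_on {s..t}"
      using assms by (intro integrable_continuous_real continuous_sub; simp)+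
    show "(\<lambda>x. W x * U x + U x * W x) integrable_on {s..t}"
      using assms by (intro integrable_continuous_real continuous_intros continuous_sub) auto
  qed (use assms U_diff B in auto)
  thus ?thesis by (simp add: power2_eq_square mult.commute)
qed

text \<open>With the coefficient frozen at the value \<open>q\<close>, the change of the energy is the integral of
\<open>2 U W (q - p)\<close>.\<close>

lemma energy_diff:
  assumes st: "0 < s" "s \<le> t" "t < H"
    and B: "\<And>y. y \<in> {0..H} \<Longrightarrow> \<bar>U y\<bar> \<le> B" "\<And>y. y \<in> {0..H} \<Longrightarrow> \<bar>W y\<bar> \<le> B"
    and q: "\<And>x. x \<in> {s..t} \<Longrightarrow> \<bar>q - p x\<bar> \<le> D"
  shows "\<bar>((W t)\<^sup>2 - (W s)\<^sup>2) / lam + q * ((U t)\<^sup>2 - (U s)\<^sup>2)\<bar> \<le> 2 * B\<^sup>2 * D * (t - s)"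
proof -
  have st': "0 \<le> s" "s \<le> t" "t \<le> H" using st by auto
  have int: "(\<lambda>x. W x * g x) integrable_on {s..t}" "(\<lambda>x. U x * W x) integrable_on {s..t}"
    using st' by (intro integrable_continuous_mult continuous_sub g_int_sub integrable_continuous_real continuous_intros; simp)+
  have "((W t)\<^sup>2 - (W s)\<^sup>2) / lam + q * ((U t)\<^sup>2 - (U s)\<^sup>2) =
     2 / lam * integral {s..t} (\<lambda>x. W x * g x) + 2 * q * integral {s..t} (\<lambda>x. U x * W x)"
    using W2_diff[OF st'] U2_diff[OF st'] by simp
  also have "\<dots> = integral {s..t} (\<lambda>x. 2 / lam * (W x * g x) + 2 * q * (U x * W x))"
    using Henstock_Kurzweil_Integration.integral_add[OF integrable_on_mult_right[OF int(1), of "2 / lam"]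
        integrable_on_mult_right[OF int(2), of "2 * q"]]
    by (simp only: Henstock_Kurzweil_Integration.integral_mult_right)
  finally have eq: "((W t)\<^sup>2 - (W s)\<^sup>2) / lam + q * ((U t)\<^sup>2 - (U s)\<^sup>2) = \<dots>" .
  have "norm (integral {s..t} (\<lambda>x. 2 / lam * (W x * g x) + 2 * q * (U x * W x))) \<le> integral {s..t} (\<lambda>_. 2 * B\<^sup>2 * D)"
  proof (rule integral_norm_bound_integral_off_negligible[OF _ _ N])
    show "(\<lambda>x. 2 / lam * (W x * g x) + 2 * q * (U x * W x)) integrable_on {s..t}"
      by (intro integrable_add integrable_on_mult_right int)
    fix x assume x: "x \<in> {s..t} - N"
    hence "x \<in> {0<..<H} - N" using st by auto
    from g_eq[OF this] have "2 / lam * (W x * g x) + 2 * q * (U x * W x) = 2 * ((U x * W x) * (q - p x))"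
      using lam by (simp add: field_simps)
    also have "norm \<dots> \<le> 2 * ((B * B) * D)"
    proof -
      have "\<bar>U x * W x\<bar> \<le> B * B" 
        unfolding abs_mult using B(1)[of x] B(2)[of x] x st by (intro mult_mono) auto
      hence "\<bar>U x * W x\<bar> * \<bar>q - p x\<bar> \<le> (B * B) * D"
        using q[of x] x by (intro mult_mono) auto
      thus ?thesis by (simp add: abs_mult)
    qed
    finally show "norm (2 / lam * (W x * g x) + 2 * q * (U x * W x)) \<le> 2 * B\<^sup>2 * D"
      by (simp add: power2_eq_square)
  qed auto
  thus ?thesis unfolding eq using st by (simp add: mult_ac)
qed

text \<open>Freezing the coefficient at \<open>p t\<close> leaves the jump term \<open>(p t - p s) (U s)\<^sup>2\<close>, which is controlled by the
energy at \<open>s\<close>; freezing it at \<open>p s\<close> exchanges the roles of the end points, which gives the estimate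
backwards in \<open>y\<close>.\<close>

lemma energy_step:
  assumes st: "0 < s" "s \<le> t" "t < H"
    and B: "\<And>y. y \<in> {0..H} \<Longrightarrow> \<bar>U y\<bar> \<le> B" "\<And>y. y \<in> {0..H} \<Longrightarrow> \<bar>W y\<bar> \<le> B"
  defines "v \<equiv> scaled_variation t - scaled_variation s"
  shows "energy t \<le> energy s * (1 + v) + (2 * B\<^sup>2 * \<kappa>) * v * (t - s)"
    and "energy s \<le> energy t * (1 + v) + (2 * B\<^sup>2 * \<kappa>) * v * (t - s)"
proof -
  have v: "v \<ge> 0" using scaled_variation_mono[OF st] by (simp add: v_def)
  have q: "\<bar>p t - p x\<bar> \<le> \<kappa> * v" "\<bar>p s - p x\<bar> \<le> \<kappa> * v" if "x \<in> {s..t}" for x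
  proof -
    have "\<bar>p t - p x\<bar> \<le> \<kappa> * (scaled_variation t - scaled_variation x)"
      using p_increment[of x t] that st by auto
    also have "\<dots> \<le> \<kappa> * v"
      using scaled_variation_mono[of s x] that st \<kappa> by (intro mult_left_mono) (auto simp: v_def)
    finally show "\<bar>p t - p x\<bar> \<le> \<kappa> * v" .
    have "\<bar>p x - p s\<bar> \<le> \<kappa> * (scaled_variation x - scaled_variation s)"
      using p_increment[of s x] that st by auto
    also have "\<dots> \<le> \<kappa> * v"
      using scaled_variation_mono[of x t] that st \<kappa> by (intro mult_left_mono) (auto simp: v_def)
    finally show "\<bar>p s - p x\<bar> \<le> \<kappa> * v" by (simp add: abs_minus_commute)
  qed
  have pq: "(p t - p s) * (U s)\<^sup>2 \<le> v * energy s" "(p s - p t) * (U t)\<^sup>2 \<le> v * energy t"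
  proof -
    have *: "d * (U y)\<^sup>2 \<le> v * energy y" if "d \<le> \<kappa> * v" "y \<in> {0<..<H}" for d y
    proof -
      have "d * (U y)\<^sup>2 \<le> v * (\<kappa> * (U y)\<^sup>2)"
        using mult_right_mono[OF that(1), of "(U y)\<^sup>2"] by (simp add: algebra_simps)
      also have "\<dots> \<le> v * energy y" using kappa_U2_le_energy[OF that(2)] v by (intro mult_left_mono)
      finally show ?thesis .
    qed
    show "(p t - p s) * (U s)\<^sup>2 \<le> v * energy s" using q(1)[of s] st by (intro *) auto
    show "(p s - p t) * (U t)\<^sup>2 \<le> v * energy t" using q(2)[of t] st by (intro *) auto
  qed
  have "energy t - energy s = (((W t)\<^sup>2 - (W s)\<^sup>2) / lam + p t * ((U t)\<^sup>2 - (U s)\<^sup>2)) + (p t - p s) * (U s)\<^sup>2"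
    by (simp add: energy_def diff_divide_distrib algebra_simps)
  moreover have "((W t)\<^sup>2 - (W s)\<^sup>2) / lam + p t * ((U t)\<^sup>2 - (U s)\<^sup>2) \<le> 2 * B\<^sup>2 * (\<kappa> * v) * (t - s)"
    using energy_diff[OF st B q(1)] by simp
  ultimately show "energy t \<le> energy s * (1 + v) + (2 * B\<^sup>2 * \<kappa>) * v * (t - s)"
    using pq(1) by (simp add: algebra_simps)
  have "energy s - energy t = - (((W t)\<^sup>2 - (W s)\<^sup>2) / lam + p s * ((U t)\<^sup>2 - (U s)\<^sup>2)) + (p s - p t) * (U t)\<^sup>2"
    by (simp add: energy_def diff_divide_distrib algebra_simps)
  moreover have "- (((W t)\<^sup>2 - (W s)\<^sup>2) / lam + p s * ((U t)\<^sup>2 - (U s)\<^sup>2)) \<le> 2 * B\<^sup>2 * (\<kappa> * v) * (t - s)"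
    using energy_diff[OF st B q(2)] by simp
  ultimately show "energy s \<le> energy t * (1 + v) + (2 * B\<^sup>2 * \<kappa>) * v * (t - s)"
    using pq(2) by (simp add: algebra_simps)
qed

lemma energy_comparable:
  assumes y: "y \<in> {0<..<H}" and z: "z \<in> {0<..<H}"
  shows "energy z \<le> exp (V / (cm\<^sup>2 * \<kappa>)) * energy y"
proof -
  obtain B where B: "B > 0" "\<And>y. y \<in> {0..H} \<Longrightarrow> \<bar>U y\<bar> \<le> B" "\<And>y. y \<in> {0..H} \<Longrightarrow> \<bar>W y\<bar> \<le> B"
    using bounds by metis
  have C: "0 \<le> 2 * B\<^sup>2 * \<kappa>" using \<kappa> by simp
  have le: "exp (scaled_variation t - scaled_variation s) * energy x \<le> exp (V / (cm\<^sup>2 * \<kappa>)) * energy x"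
    if "s < H" "t < H" "x \<in> {0<..<H}" for s t x
    using scaled_variation_bounds(1)[OF that(1)] scaled_variation_bounds(2)[OF that(2)] energy_nonneg[OF that(3)]
    by (intro mult_right_mono) auto
  show ?thesis
  proof (cases "y \<le> z")
    case True
    have "energy z \<le> exp (scaled_variation z - scaled_variation y) * energy y"
      by (rule gronwall_bounded_variation[OF True _ C])
         (use y z energy_step(1)[OF _ _ _ B(2,3)] scaled_variation_mono energy_nonneg in auto)
    thus ?thesis using le[of y z y] y z by auto
  next
    case False
    \<comment> \<open>Reflecting the interval turns the backward step into the form required by the Gronwall inequality.\<close>
    have "energy (- (- z)) \<le> exp (- scaled_variation (- (- z)) - (- scaled_variation (- (- y)))) * energy (- (- y))"
    proof (rule gronwall_bounded_variation[where f="\<lambda>x. energy (- x)" and T="\<lambda>x. - scaled_variation (- x)" and C="2 * B\<^sup>2 * \<kappa>"])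
      fix s t assume st: "- y \<le> s" "s \<le> t" "t \<le> - z"
      hence "0 < - t" "- t \<le> - s" "- s < H" using y z by auto
      from energy_step(2)[OF this B(2,3)]
      show "energy (- t) \<le> energy (- s) * (1 + (- scaled_variation (- t) - - scaled_variation (- s))) +
          2 * B\<^sup>2 * \<kappa> * (- scaled_variation (- t) - - scaled_variation (- s)) * (t - s)"
        by (simp add: algebra_simps)
    qed (use False y z C scaled_variation_mono energy_nonneg in auto)
    thus ?thesis using le[of z y y] y z by auto
  qed
qed

text \<open>Testing the equation with \<open>\<theta>\<^sup>2 U\<close>, where the polynomial cut-off \<open>\<theta>\<close> vanishes at both end points.\<close>

lemma weighted_derivative_bound:
  assumes ab: "0 \<le> a" "a < b" "b \<le> H"
  defines "\<theta> \<equiv> \<lambda>x. (x - a) * (b - x)"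
  shows "integral {a..b} (\<lambda>x. (\<theta> x)\<^sup>2 * (W x)\<^sup>2) \<le>
    (4 * (b - a)\<^sup>2 + 2 * lam * P * (b - a) ^ 4) * integral {a..b} (\<lambda>x. (U x)\<^sup>2)"
proof -
  obtain B where B: "B > 0" "\<And>y. y \<in> {0..H} \<Longrightarrow> \<bar>U y\<bar> \<le> B" "\<And>y. y \<in> {0..H} \<Longrightarrow> \<bar>W y\<bar> \<le> B"
    using bounds by metis
  have P: "P > 0" using p_bounds[of "H/2"] H \<kappa> by auto
  note cont = continuous_sub[OF ab(1,3)]
  define \<theta>' where "\<theta>' x = a + b - 2 * x" for x
  define Q where "Q x = (\<theta> x)\<^sup>2 * U x" for x
  define Q' where "Q' x = 2 * \<theta> x * \<theta>' x * U x + (\<theta> x)\<^sup>2 * W x" for x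
  have Q'c: "continuous_on {a..b} Q'"
    unfolding Q'_def \<theta>_def \<theta>'_def by (intro continuous_intros cont)
  have U_der: "(U has_real_derivative W x) (at x within {a..b})" if x: "x \<in> {a..b}" for x
  proof -
    have "((\<lambda>x. integral {a..x} W) has_real_derivative W x) (at x within {a..b})"
      by (rule integral_has_real_derivative[OF cont(2) x])
    hence "((\<lambda>x. U a + integral {a..x} W) has_real_derivative W x) (at x within {a..b})"
      by (auto intro!: derivative_eq_intros)
    thus ?thesis
    proof (rule has_field_derivative_transform_within[where d=1])
      show "U a + integral {a..y} W = U y" if "y \<in> {a..b}" for y
        using U_diff[of a y] that ab by simp
    qed (use x in auto)
  qed
  have Q_diff: "Q t - Q s = integral {s..t} Q'" if st: "a \<le> s" "s \<le> t" "t \<le> b" for s t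
  proof -
    have "(Q has_vector_derivative Q' x) (at x within {s..t})" if x: "x \<in> {s..t}" for x
    proof -
      have "(U has_real_derivative W x) (at x within {s..t})"
        by (rule has_field_derivative_subset[OF U_der]) (use x st in auto)
      hence "(Q has_real_derivative Q' x) (at x within {s..t})"
        unfolding Q_def Q'_def \<theta>_def \<theta>'_def
        by (auto intro!: derivative_eq_intros simp: power2_eq_square algebra_simps)
      thus ?thesis by (simp add: has_real_derivative_iff_has_vector_derivative)
    qed
    from fundamental_theorem_of_calculus[OF st(2) this] show ?thesis by (simp add: integral_unique)
  qed
  obtain A where A: "\<And>y. y \<in> {a..b} \<Longrightarrow> norm (Q' y) \<le> A"
    using continuous_on_compact_bound[OF compact_Icc Q'c] by blast
  have int: "(\<lambda>x. Q' x * W x + Q x * g x) integrable_on {a..b}"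
  proof (intro integrable_add)
    show "(\<lambda>x. Q' x * W x) integrable_on {a..b}"
      by (intro integrable_continuous_real continuous_intros cont Q'c)
    show "(\<lambda>x. Q x * g x) integrable_on {a..b}"
      unfolding Q_def \<theta>_def
      by (intro integrable_continuous_mult continuous_intros cont g_int_sub ab)
  qed
  have "Q b * W b - Q a * W a = integral {a..b} (\<lambda>x. Q' x * W x + Q x * g x)"
  proof (rule product_indefinite_integral[where N="N \<union> {0, H}" and A=A and B="lam * P * B"])
    show "Q' integrable_on {a..b}" by (rule integrable_continuous_real[OF Q'c])
    show "g integrable_on {a..b}"
      using g_int_sub[of a b] ab by (simp add: set_lebesgue_integral_eq_integral(1))
    show "\<bar>Q' t\<bar> \<le> A" if "t \<in> {a..b} - (N \<union> {0, H})" for t using A that by auto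
    show "\<bar>g t\<bar> \<le> lam * P * B" if "t \<in> {a..b} - (N \<union> {0, H})" for t
      using g_bound[OF B(2), of t] that ab by auto
  qed (use ab N Q_diff W_diff int in auto)
  hence zero: "integral {a..b} (\<lambda>x. Q' x * W x + Q x * g x) = 0" by (simp add: Q_def \<theta>_def)
  let ?w = "\<lambda>x. 2 * (\<theta>' x)\<^sup>2 + lam * P * (\<theta> x)\<^sup>2"
  let ?R = "\<lambda>x. ?w x * (U x)\<^sup>2 - (\<theta> x)\<^sup>2 * (W x)\<^sup>2 / 2"
  have "norm (integral {a..b} (\<lambda>x. 0::real)) \<le> integral {a..b} (\<lambda>x. (Q' x * W x + Q x * g x) + ?R x)"
  proof (rule integral_norm_bound_integral_off_negligible[where N="N \<union> {0, H}"])
    show "(\<lambda>x. (Q' x * W x + Q x * g x) + ?R x) integrable_on {a..b}"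
      unfolding \<theta>_def \<theta>'_def
      by (rule integrable_add[OF int]) (intro integrable_continuous_real continuous_intros cont; simp)
    fix x assume x: "x \<in> {a..b} - (N \<union> {0, H})"
    hence x': "x \<in> {0<..<H} - N" using ab by auto
    have "Q' x * W x + Q x * g x = 2 * (\<theta> x * W x) * (\<theta>' x * U x) + (\<theta> x * W x)\<^sup>2 - lam * p x * (\<theta> x)\<^sup>2 * (U x)\<^sup>2"
      using g_eq[OF x'] by (simp add: Q_def Q'_def power2_eq_square algebra_simps)
    moreover have "0 \<le> (\<theta> x * W x + 2 * (\<theta>' x * U x))\<^sup>2 / 2" by simp
    moreover have "lam * p x * ((\<theta> x)\<^sup>2 * (U x)\<^sup>2) \<le> lam * P * ((\<theta> x)\<^sup>2 * (U x)\<^sup>2)"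
      using p_bounds(2)[of x] x' lam by (intro mult_right_mono mult_left_mono) auto
    ultimately show "norm (0::real) \<le> (Q' x * W x + Q x * g x) + ?R x"
      by (simp add: power2_eq_square algebra_simps)
  qed (use N in auto)
  also have "\<dots> = integral {a..b} ?R"
  proof -
    have "?R integrable_on {a..b}"
      unfolding \<theta>_def \<theta>'_def by (intro integrable_continuous_real continuous_intros cont) simp
    thus ?thesis using int zero by (simp add: Henstock_Kurzweil_Integration.integral_add)
  qed
  also have "\<dots> = integral {a..b} (\<lambda>x. ?w x * (U x)\<^sup>2) - integral {a..b} (\<lambda>x. (\<theta> x)\<^sup>2 * (W x)\<^sup>2) / 2"
  proof -
    have "(\<lambda>x. ?w x * (U x)\<^sup>2) integrable_on {a..b}"
      "(\<lambda>x. (\<theta> x)\<^sup>2 * (W x)\<^sup>2 / 2) integrable_on {a..b}"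
      unfolding \<theta>_def \<theta>'_def by (intro integrable_continuous_real continuous_intros cont; simp)+
    thus ?thesis by (simp add: Henstock_Kurzweil_Integration.integral_diff)
  qed
  finally have "integral {a..b} (\<lambda>x. (\<theta> x)\<^sup>2 * (W x)\<^sup>2) \<le> 2 * integral {a..b} (\<lambda>x. ?w x * (U x)\<^sup>2)"
    by simp
  also have "integral {a..b} (\<lambda>x. ?w x * (U x)\<^sup>2) \<le> 
     integral {a..b} (\<lambda>x. (2 * (b - a)\<^sup>2 + lam * P * (b - a) ^ 4) * (U x)\<^sup>2)"
  proof (rule integral_le)
    show "(\<lambda>x. ?w x * (U x)\<^sup>2) integrable_on {a..b}"
      "(\<lambda>x. (2 * (b - a)\<^sup>2 + lam * P * (b - a) ^ 4) * (U x)\<^sup>2) integrable_on {a..b}"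
      unfolding \<theta>_def \<theta>'_def by (intro integrable_continuous_real continuous_intros cont)+
    fix x assume x: "x \<in> {a..b}"
    have "(\<theta>' x)\<^sup>2 \<le> (b - a)\<^sup>2"
      using x by (intro abs_le_square_iff[THEN iffD1]) (auto simp: \<theta>'_def)
    moreover have "(\<theta> x)\<^sup>2 \<le> ((b - a) * (b - a))\<^sup>2"
      using x ab unfolding \<theta>_def by (intro power_mono mult_mono mult_nonneg_nonneg) auto
    ultimately show "?w x * (U x)\<^sup>2 \<le> (2 * (b - a)\<^sup>2 + lam * P * (b - a) ^ 4) * (U x)\<^sup>2"
      using lam P by (intro mult_right_mono add_mono mult_left_mono) (auto simp: power4_eq_xxxx power2_eq_square algebra_simps)
  qed
  also have "\<dots> = (2 * (b - a)\<^sup>2 + lam * P * (b - a) ^ 4) * integral {a..b} (\<lambda>x. (U x)\<^sup>2)"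
    by (rule Henstock_Kurzweil_Integration.integral_mult_right)
  finally show ?thesis by (simp add: algebra_simps)
qed

text \<open>On \<open>(a, b)\<close> the energy is at least a fixed multiple of the energy at \<open>z\<close>; integrated against \<open>\<theta>\<^sup>2\<close> its derivative part
is controlled by the integral of \<open>U\<^sup>2\<close>, with a constant that stays bounded as \<open>lam\<close> grows because the
derivative enters the energy divided by \<open>lam\<close>.\<close>

lemma pointwise_observability:
  assumes ab: "0 \<le> a" "a < b" "b \<le> H" and lam0: "0 < lam0" "lam0 \<le> lam" and z: "z \<in> {0<..<H}"
  shows "exp (- V / (cm\<^sup>2 * \<kappa>)) * \<kappa> * integral {a..b} (\<lambda>x. ((x - a) * (b - x))\<^sup>2) * (U z)\<^sup>2
    \<le> (4 * (b - a)\<^sup>2 / lam0 + 3 * P * (b - a) ^ 4) * integral {a..b} (\<lambda>x. (U x)\<^sup>2)"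
proof -
  let ?I = "integral {a..b} (\<lambda>x. (U x)\<^sup>2)"
  let ?\<theta> = "\<lambda>x. (x - a) * (b - x)"
  have P: "P > 0" using p_bounds[of "H/2"] H \<kappa> by auto
  note cont = continuous_sub[OF ab(1,3)]
  define K where "K = exp (- V / (cm\<^sup>2 * \<kappa>)) * \<kappa> * (U z)\<^sup>2"
  have K: "K \<le> (W x)\<^sup>2 / lam + P * (U x)\<^sup>2" if x: "x \<in> {0<..<H}" for x
  proof -
    have "K = exp (- V / (cm\<^sup>2 * \<kappa>)) * (\<kappa> * (U z)\<^sup>2)" by (simp add: K_def)
    also have "\<dots> \<le> exp (- V / (cm\<^sup>2 * \<kappa>)) * energy z"
      using kappa_U2_le_energy[OF z] by (intro mult_left_mono) auto
    also have "\<dots> \<le> exp (- V / (cm\<^sup>2 * \<kappa>)) * (exp (V / (cm\<^sup>2 * \<kappa>)) * energy x)"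
      using energy_comparable[OF x z] by (intro mult_left_mono) auto
    also have "\<dots> = energy x" by (simp add: exp_minus flip: mult.assoc exp_add)
    also have "\<dots> \<le> (W x)\<^sup>2 / lam + P * (U x)\<^sup>2"
      unfolding energy_def using p_bounds(2)[OF x] by (intro add_left_mono mult_right_mono) auto
    finally show ?thesis .
  qed
  have int: "(\<lambda>x. (?\<theta> x)\<^sup>2 * (W x)\<^sup>2) integrable_on {a..b}" "(\<lambda>x. (U x)\<^sup>2) integrable_on {a..b}"
    by (intro integrable_continuous_real continuous_intros cont)+
  have "K * integral {a..b} (\<lambda>x. (?\<theta> x)\<^sup>2) = integral {a..b} (\<lambda>x. K * (?\<theta> x)\<^sup>2)" by simp
  also have "\<dots> \<le> integral {a..b} (\<lambda>x. 1 / lam * ((?\<theta> x)\<^sup>2 * (W x)\<^sup>2) + P * (b - a) ^ 4 * (U x)\<^sup>2)"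
  proof (rule integral_le)
    show "(\<lambda>x. K * (?\<theta> x)\<^sup>2) integrable_on {a..b}"
      by (intro integrable_continuous_real continuous_intros)
    show "(\<lambda>x. 1 / lam * ((?\<theta> x)\<^sup>2 * (W x)\<^sup>2) + P * (b - a) ^ 4 * (U x)\<^sup>2) integrable_on {a..b}"
      by (intro integrable_add integrable_on_mult_right int)
    fix x assume x: "x \<in> {a..b}"
    have \<theta>: "(?\<theta> x)\<^sup>2 \<le> (b - a) ^ 4"
    proof -
      have "(?\<theta> x)\<^sup>2 \<le> ((b - a) * (b - a))\<^sup>2"
        using x ab by (intro power_mono mult_mono mult_nonneg_nonneg) auto
      thus ?thesis by (simp add: power4_eq_xxxx power2_eq_square)
    qed
    have "K * (?\<theta> x)\<^sup>2 \<le> ((W x)\<^sup>2 / lam + P * (U x)\<^sup>2) * (?\<theta> x)\<^sup>2"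
    proof (cases "x = a \<or> x = b")
      case False
      thus ?thesis using K[of x] x ab by (intro mult_right_mono) auto
    qed auto
    also have "\<dots> = 1 / lam * ((?\<theta> x)\<^sup>2 * (W x)\<^sup>2) + P * (U x)\<^sup>2 * (?\<theta> x)\<^sup>2" by (simp add: distrib_right)
    also have "P * (U x)\<^sup>2 * (?\<theta> x)\<^sup>2 \<le> P * (U x)\<^sup>2 * (b - a) ^ 4"
      using \<theta> P by (intro mult_left_mono) auto
    finally show "K * (?\<theta> x)\<^sup>2 \<le> 1 / lam * ((?\<theta> x)\<^sup>2 * (W x)\<^sup>2) + P * (b - a) ^ 4 * (U x)\<^sup>2"
      by (simp add: mult_ac)
  qed
  also have "\<dots> = 1 / lam * integral {a..b} (\<lambda>x. (?\<theta> x)\<^sup>2 * (W x)\<^sup>2) + P * (b - a) ^ 4 * ?I"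
    using int by (subst Henstock_Kurzweil_Integration.integral_add) (auto intro: integrable_on_mult_right simp del: times_divide_eq_left)
  also have "\<dots> \<le> 1 / lam * ((4 * (b - a)\<^sup>2 + 2 * lam * P * (b - a) ^ 4) * ?I) + P * (b - a) ^ 4 * ?I"
    using weighted_derivative_bound[OF ab] lam by (intro add_right_mono mult_left_mono) auto
  also have "\<dots> = (4 * (b - a)\<^sup>2 / lam + 3 * P * (b - a) ^ 4) * ?I"
    using lam by (simp add: field_simps)
  also have "\<dots> \<le> (4 * (b - a)\<^sup>2 / lam0 + 3 * P * (b - a) ^ 4) * ?I"
    using lam0 int(2) by (intro mult_right_mono add_right_mono divide_left_mono Henstock_Kurzweil_Integration.integral_nonneg) auto
  finally show ?thesis by (simp add: K_def mult_ac)
qed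

end

section \<open>L2 norms of products\<close>

text \<open>The Lebesgue measure on the product space is the completion of the product measure, so the integrands
are first replaced by Borel functions that agree with them almost everywhere.\<close>

lemma lebesgue_integral_product:
  fixes F :: "'a::euclidean_space \<Rightarrow> real" and G :: "'b::euclidean_space \<Rightarrow> real"
  assumes F: "integrable lebesgue F" "\<And>x. 0 \<le> F x" and G: "integrable lebesgue G" "\<And>y. 0 \<le> G y"
  shows "(LINT z|lebesgue. F (fst z) * G (snd z)) = (LINT x|lebesgue. F x) * (LINT y|lebesgue. G y)"
proof -
  from F(1) obtain F1 where F1 [measurable]: "F1 \<in> borel_measurable borel" and Ft: "integrable lborel F1"
    "integral\<^sup>L lborel F1 = integral\<^sup>L lebesgue F" and Fae: "AE x in lebesgue. F x = F1 x"
    by (rule lebesgue_integrable_borel_version)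
  from G(1) obtain G1 where G1 [measurable]: "G1 \<in> borel_measurable borel" and Gt: "integrable lborel G1"
    "integral\<^sup>L lborel G1 = integral\<^sup>L lebesgue G" and Gae: "AE y in lebesgue. G y = G1 y"
    by (rule lebesgue_integrable_borel_version)
  let ?h = "\<lambda>z::'a \<times> 'b. F (fst z) * G (snd z)" and ?h1 = "\<lambda>z::'a \<times> 'b. F1 (fst z) * G1 (snd z)"
  have int: "integrable (lborel \<Otimes>\<^sub>M lborel) (\<lambda>(x, y). F1 x * G1 y)"
  proof (rule lborel_pair.Fubini_integrable)
    show "(\<lambda>(x, y). F1 x * G1 y) \<in> borel_measurable (lborel \<Otimes>\<^sub>M lborel)" by measurable
    show "integrable lborel (\<lambda>x. LBINT y. norm (case (x, y) of (x, y) \<Rightarrow> F1 x * G1 y))"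
      using Ft by (simp add: abs_mult)
    show "AE x in lborel. integrable lborel (\<lambda>y. case (x, y) of (x, y) \<Rightarrow> F1 x * G1 y)"
      using Gt by simp
  qed
  have h1i: "integrable lborel ?h1" using int by (simp add: lborel_prod case_prod_beta')
  have "integral\<^sup>L lborel ?h1 = (LBINT x. LBINT y. F1 x * G1 y)"
    using lborel_pair.integral_fst'[of "\<lambda>(x, y). F1 x * G1 y"] int by (simp add: lborel_prod case_prod_beta')
  also have "\<dots> = integral\<^sup>L lebesgue F * integral\<^sup>L lebesgue G" using Ft Gt by simp
  finally have val: "integral\<^sup>L lborel ?h1 = integral\<^sup>L lebesgue F * integral\<^sup>L lebesgue G" .
  obtain N1 where N1: "\<And>x. x \<in> space lborel - N1 \<Longrightarrow> F x = F1 x" "N1 \<in> null_sets lborel"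
    using AE_E3[OF Fae[unfolded AE_completion_iff]] by metis
  obtain N2 where N2: "\<And>x. x \<in> space lborel - N2 \<Longrightarrow> G x = G1 x" "N2 \<in> null_sets lborel"
    using AE_E3[OF Gae[unfolded AE_completion_iff]] by metis
  have "AE z in (lborel :: ('a \<times> 'b) measure). fst z \<notin> N1 \<and> snd z \<notin> N2"
    unfolding lborel_prod[symmetric]
  proof (rule lborel_pair.AE_pair_measure)
    have [measurable]: "N1 \<in> sets borel" "N2 \<in> sets borel" using N1 N2 by auto
    show "{z \<in> space (lborel \<Otimes>\<^sub>M lborel). fst z \<notin> N1 \<and> snd z \<notin> N2} \<in> sets (lborel \<Otimes>\<^sub>M lborel)" by measurable
    show "AE x in lborel. AE y in lborel. fst (x, y) \<notin> N1 \<and> snd (x, y) \<notin> N2"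
      using AE_not_in[OF N1(2)] AE_not_in[OF N2(2)] by auto
  qed
  hence ae: "AE z in lborel. ?h z = ?h1 z"
    by eventually_elim (use N1(1) N2(1) in auto)
  obtain N where N: "negligible N" "\<And>z. z \<notin> N \<Longrightarrow> ?h z = ?h1 z"
    using AE_lebesgue_negligibleE[OF AE_completion[OF ae]] by blast
  have hi: "(?h has_integral integral\<^sup>L lborel ?h1) UNIV"
    by (rule has_integral_spike[OF N(1) _ has_integral_integral_lborel[OF h1i]]) (use N(2) in auto)
  have "?h absolutely_integrable_on UNIV"
    by (rule nonnegative_absolutely_integrable_1) (use hi F G in \<open>auto simp: integrable_on_def\<close>)
  from set_lebesgue_integral_eq_integral(2)[OF this] have "integral\<^sup>L lebesgue ?h = integral UNIV ?h"
    by (simp add: set_lebesgue_integral_def)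
  also have "\<dots> = integral\<^sup>L lborel ?h1" using hi by (rule integral_unique)
  finally show ?thesis using val by simp
qed

lemma L2_norm_on_product:
  assumes "L2_on S f" "L2_on T g"
  shows "L2_norm_on (S \<times> T) (product_eigenfunction f g) = L2_norm_on S f * L2_norm_on T g"
proof -
  have "(LINT z:S \<times> T|lebesgue. (product_eigenfunction f g z)\<^sup>2) =
     (LINT z|lebesgue. (indicator S (fst z) * (f (fst z))\<^sup>2) * (indicator T (snd z) * (g (snd z))\<^sup>2))"
    unfolding set_lebesgue_integral_def product_eigenfunction_def
    by (rule Bochner_Integration.integral_cong) (auto simp: indicator_def power_mult_distrib split: prod.splits)
  also have "\<dots> = (LINT x|lebesgue. indicator S x * (f x)\<^sup>2) * (LINT y|lebesgue. indicator T y * (g y)\<^sup>2)"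
    by (rule lebesgue_integral_product) (use assms in \<open>auto simp: L2_on_def set_integrable_def\<close>)
  finally show ?thesis
    by (simp add: L2_norm_on_def set_lebesgue_integral_def real_sqrt_mult)
qed

lemma L2_on_subset:
  assumes "L2_on U f" "W \<subseteq> U" "W \<in> sets lebesgue" shows "L2_on W f"
proof -
  have eq: "(\<lambda>x. indicator W x *\<^sub>R h x) = (\<lambda>x. indicator W x *\<^sub>R (indicator U x *\<^sub>R h x))" for h :: "'a \<Rightarrow> real"
    using assms(2) by (auto simp: fun_eq_iff indicator_def)
  have "(\<lambda>x. indicator W x *\<^sub>R (indicator U x *\<^sub>R f x)) \<in> borel_measurable lebesgue"
    by (rule borel_measurable_scaleR[OF borel_measurable_indicator[OF assms(3)]])
       (use assms(1) in \<open>simp only: L2_on_def set_borel_measurable_def\<close>)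
  moreover have "set_integrable lebesgue W (\<lambda>x. (f x)\<^sup>2)"
    by (rule set_integrable_subset[OF _ assms(3,2)]) (use assms in \<open>simp add: L2_on_def\<close>)
  ultimately show ?thesis unfolding L2_on_def set_borel_measurable_def eq[of f] by simp
qed

lemma L2_norm_on_mono:
  assumes "L2_on U f" "W \<subseteq> U" "W \<in> sets lebesgue"
  shows "L2_norm_on W f \<le> L2_norm_on U f"
proof -
  have "(LINT x:W|lebesgue. (f x)\<^sup>2) \<le> (LINT x:U|lebesgue. (f x)\<^sup>2)"
    using L2_on_subset[OF assms] assms unfolding L2_on_def set_lebesgue_integral_def set_integrable_def
    by (intro integral_mono) (auto simp: indicator_def)
  thus ?thesis by (simp add: L2_norm_on_def)
qed

lemma L2_norm_on_eq_0_iff: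
  assumes "L2_on U f"
  shows "L2_norm_on U f = 0 \<longleftrightarrow> (vanishes_on f U)"
proof -
  have "integrable lebesgue (\<lambda>x. indicator U x *\<^sub>R (f x)\<^sup>2)"
    using assms by (simp add: L2_on_def set_integrable_def)
  hence "L2_norm_on U f = 0 \<longleftrightarrow> (AE x in lebesgue. indicator U x *\<^sub>R (f x)\<^sup>2 = 0)"
    unfolding L2_norm_on_def set_lebesgue_integral_def
    by (subst integral_nonneg_eq_0_iff_AE[symmetric]) auto
  also have "\<dots> \<longleftrightarrow> (vanishes_on f U)"
    by (intro AE_cong) (auto simp: indicator_def)
  finally show ?thesis .
qed

lemma L2_norm_on_nonneg: "0 \<le> L2_norm_on U f"
  unfolding L2_norm_on_def set_lebesgue_integral_def by simp

section \<open>Uniform lower bounds\<close>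

text \<open>If arbitrarily small values occurred, then, the values being positive, they would occur at arbitrarily
large indices and form a subsequence tending to \<open>0\<close>.\<close>

lemma positive_sequence_bounded_below:
  fixes \<rho> :: "nat \<Rightarrow> real"
  assumes pos: "\<And>k. k \<ge> 1 \<Longrightarrow> \<rho> k > 0"
    and sub: "\<And>r. strict_mono r \<Longrightarrow> \<not> (\<lambda>j. \<rho> (r j)) \<longlonglongrightarrow> 0"
  shows "\<exists>\<delta>>0. \<forall>k\<ge>1. \<delta> \<le> \<rho> k"
proof (rule ccontr)
  assume not: "\<not> ?thesis"
  have ex: "\<exists>k>n. \<rho> k < \<delta>" if "\<delta> > 0" for n \<delta>
  proof -
    define \<delta>' where "\<delta>' = Min (insert \<delta> (\<rho> ` {1..n}))"
    have "\<delta>' > 0" unfolding \<delta>'_def using that pos by (subst Min_gr_iff) auto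
    then obtain k where k: "k \<ge> 1" "\<rho> k < \<delta>'" using not by (auto simp: not_le)
    have "\<delta>' \<le> \<delta>" "\<And>i. i \<in> {1..n} \<Longrightarrow> \<delta>' \<le> \<rho> i" unfolding \<delta>'_def by (rule Min_le; simp)+
    with k show ?thesis by (intro exI[of _ k]) (force simp: not_less[symmetric])
  qed
  have "\<exists>r. \<forall>j. (\<rho> (r j) < 1 / real (Suc j) \<and> r j \<ge> 1) \<and> r j < r (Suc j)"
  proof (rule dependent_nat_choice)
    show "\<exists>x. \<rho> x < 1 / real (Suc 0) \<and> x \<ge> 1" using ex[of 1 0] by (auto simp: Suc_le_eq)
    fix x j
    show "\<exists>y. (\<rho> y < 1 / real (Suc (Suc j)) \<and> y \<ge> 1) \<and> x < y"
    proof -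
      obtain k where "k > x" "\<rho> k < 1 / real (Suc (Suc j))" using ex[of "1 / real (Suc (Suc j))" x] by auto
      thus ?thesis by (intro exI[of _ k]) auto
    qed
  qed
  then obtain r where r: "\<And>j. \<rho> (r j) < 1 / real (Suc j)" "\<And>j. r j \<ge> 1" "\<And>j. r j < r (Suc j)" by blast
  have "(\<lambda>j. \<rho> (r j)) \<longlonglongrightarrow> 0"
  proof (rule tendsto_sandwich[of "\<lambda>_. 0" _ _ "\<lambda>j. 1 / real (Suc j)"])
    show "(\<lambda>j. 1 / real (Suc j)) \<longlonglongrightarrow> 0" using LIMSEQ_inverse_real_of_nat by (simp add: inverse_eq_divide)
  qed (use pos r(1,2) in \<open>auto intro!: always_eventually less_imp_le\<close>)
  moreover have "strict_mono r" using r(3) by (simp add: strict_mono_Suc_iff)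
  ultimately show False using sub by blast
qed

lemma Ak_eigenfunction_oscillator:
  assumes u: "Ak_eigenfunction H c m lam u" and H: "H > 0" and cm: "cm > 0" and lam: "lam > 0" and \<kappa>: "\<kappa> > 0"
    and c_ge: "\<And>y. y \<in> {0<..<H} \<Longrightarrow> cm \<le> c y" and TV: "total_variation {0<..<H} c \<le> ereal V"
    and p_bounds: "\<And>y. y \<in> {0<..<H} \<Longrightarrow> \<kappa> \<le> 1 / c y - m\<^sup>2 / lam" 
      "\<And>y. y \<in> {0<..<H} \<Longrightarrow> 1 / c y - m\<^sup>2 / lam \<le> P"
  obtains U W g N where "AE y in lebesgue. y \<in> {0<..<H} \<longrightarrow> u y = U y"
    "bounded_variation_oscillator H cm V lam (m\<^sup>2 / lam) \<kappa> P c (\<lambda>y. 1 / c y - m\<^sup>2 / lam) U W g N"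
proof -
  obtain u' u'' where d: "weak_deriv {0<..<H} 1 u u'" "weak_deriv {0<..<H} 1 u' u''"
    and eq: "AE y in lebesgue. y \<in> {0<..<H} \<longrightarrow> c y * (m\<^sup>2 * u y - u'' y) = lam * u y"
    using u unfolding Ak_eigenfunction_def by blast
  obtain U where U: "AE x in lebesgue. x \<in> {0<..<H} \<longrightarrow> u x = U x"
    "\<And>s t. 0 \<le> s \<Longrightarrow> s \<le> t \<Longrightarrow> t \<le> H \<Longrightarrow> U t - U s = integral {s..t} u'"
    "continuous_on {0..H} U" "u' absolutely_integrable_on {0..H}"
    by (rule weak_deriv_primitive[OF d(1) H]) blast
  obtain W where W: "AE x in lebesgue. x \<in> {0<..<H} \<longrightarrow> u' x = W x"
    "\<And>s t. 0 \<le> s \<Longrightarrow> s \<le> t \<Longrightarrow> t \<le> H \<Longrightarrow> W t - W s = integral {s..t} u''"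
    "continuous_on {0..H} W" "u'' absolutely_integrable_on {0..H}"
    by (rule weak_deriv_primitive[OF d(2) H]) blast
  have ae: "AE x in lebesgue. x \<in> {0<..<H} \<longrightarrow>
      u x = U x \<and> u' x = W x \<and> c x * (m\<^sup>2 * u x - u'' x) = lam * u x"
    using U(1) W(1) eq by eventually_elim auto
  obtain N where neg: "negligible N" and N: "\<And>x. x \<notin> N \<Longrightarrow> x \<in> {0<..<H} \<longrightarrow>
      u x = U x \<and> u' x = W x \<and> c x * (m\<^sup>2 * u x - u'' x) = lam * u x"
    using AE_lebesgue_negligibleE[OF ae] by blast
  have u'W: "integral {s..t} u' = integral {s..t} W" if "0 \<le> s" "t \<le> H" for s t
  proof (rule integral_spike[where S="N \<union> {0, H}"])
    show "W x = u' x" if "x \<in> {s..t} - (N \<union> {0, H})" for x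
      using N[of x] that \<open>0 \<le> s\<close> \<open>t \<le> H\<close> by auto
  qed (use neg in auto)
  have "bounded_variation_oscillator H cm V lam (m\<^sup>2 / lam) \<kappa> P c (\<lambda>y. 1 / c y - m\<^sup>2 / lam) U W u'' N"
  proof
    show "U t - U s = integral {s..t} W" if "0 \<le> s" "s \<le> t" "t \<le> H" for s t
      using U(2)[OF that] u'W[OF that(1,3)] by simp
    show "u'' t = - lam * (1 / c t - m\<^sup>2 / lam) * U t" if t: "t \<in> {0<..<H} - N" for t
    proof -
      have c: "c t > 0" using c_ge[of t] cm t by auto
      have "c t * (m\<^sup>2 * U t - u'' t) = lam * U t" using N[of t] t by auto
      hence "m\<^sup>2 * U t - u'' t = lam * U t / c t" using c by (simp add: field_simps)
      hence "u'' t = m\<^sup>2 * U t - lam * U t / c t" by simp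
      also have "\<dots> = - lam * (1 / c t - m\<^sup>2 / lam) * U t" using c lam by (simp add: field_simps)
      finally show ?thesis .
    qed
  qed (use assms U W neg in auto)
  with U(1) show ?thesis by (rule that)
qed

lemma L2_norm_on_subinterval:
  assumes u: "L2_on {0<..<H::real} u" and uU: "AE y in lebesgue. y \<in> {0<..<H} \<longrightarrow> u y = U y"
    and st: "0 \<le> s" "t \<le> H"
  shows "(L2_norm_on {s<..<t} u)\<^sup>2 = integral {s..t} (\<lambda>y. (U y)\<^sup>2)"
proof -
  have sub: "{s<..<t} \<subseteq> {0<..<H}" using st by auto
  have "L2_on {s<..<t} u" by (rule L2_on_subset[OF u sub]) simp
  hence int: "set_integrable lebesgue {s<..<t} (\<lambda>y. (u y)\<^sup>2)" by (simp add: L2_on_def)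
  obtain N where neg: "negligible N" and N: "\<And>x. x \<notin> N \<Longrightarrow> x \<in> {0<..<H} \<longrightarrow> u x = U x"
    using AE_lebesgue_negligibleE[OF uU] by blast
  have "(L2_norm_on {s<..<t} u)\<^sup>2 = (LINT y:{s<..<t}|lebesgue. (u y)\<^sup>2)"
    unfolding L2_norm_on_def by (intro real_sqrt_pow2) (simp add: set_lebesgue_integral_def)
  also have "\<dots> = integral {s<..<t} (\<lambda>y. (u y)\<^sup>2)" by (rule set_lebesgue_integral_eq_integral(2)[OF int])
  also have "\<dots> = integral {s<..<t} (\<lambda>y. (U y)\<^sup>2)"
    by (rule integral_spike[OF neg]) (use N sub in auto)
  also have "\<dots> = integral {s..t} (\<lambda>y. (U y)\<^sup>2)"
    using integral_open_interval[of s t "\<lambda>y. (U y)\<^sup>2"] by (simp add: box_real)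
  finally show ?thesis .
qed

lemma Ak_eigenfunction_observability:
  fixes H cm cM \<epsilon> V a b lam0 :: real
  assumes H: "H > 0" and cm: "0 < cm" "cm < cM" and \<epsilon>: "\<epsilon> > 0"
    and ab: "a < b" "{a<..<b} \<subseteq> {0<..<H}" and lam0: "lam0 > 0"
  obtains \<delta> where "\<delta> > 0" "\<And>c m lam u. \<lbrakk>c \<in> K_class H cm cM V; lam \<ge> (cM + \<epsilon>) * m\<^sup>2; lam \<ge> lam0;
      Ak_eigenfunction H c m lam u\<rbrakk> \<Longrightarrow> \<delta> * (L2_norm_on {0<..<H} u)\<^sup>2 \<le> (L2_norm_on {a<..<b} u)\<^sup>2"
proof -
  have ab': "0 \<le> a" "b \<le> H" using ab greaterThanLessThan_subseteq_greaterThanLessThan[of a b 0 H] by auto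
  \<comment> \<open>The gap between \<open>1 / c \<ge> 1 / cM\<close> and \<open>m\<^sup>2 / lam \<le> 1 / (cM + \<epsilon>)\<close>.\<close>
  define \<kappa> where "\<kappa> = 1 / cM - 1 / (cM + \<epsilon>)"
  define P where "P = 1 / cm"
  define S where "S = integral {a..b} (\<lambda>x. ((x - a) * (b - x))\<^sup>2)"
  define K where "K = exp (- V / (cm\<^sup>2 * \<kappa>)) * \<kappa> * S"
  define M where "M = 4 * (b - a)\<^sup>2 / lam0 + 3 * P * (b - a) ^ 4"
  have \<kappa>: "\<kappa> > 0" unfolding \<kappa>_def using cm \<epsilon> by (simp add: divide_strict_left_mono)
  have "S > 0"
  proof -
    have c: "continuous_on {a..b} (\<lambda>x. ((x - a) * (b - x))\<^sup>2)" by (intro continuous_intros)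
    have "S \<noteq> 0"
    proof
      assume "S = 0"
      hence "\<forall>x\<in>{a..b}. ((x - a) * (b - x))\<^sup>2 = 0"
        using integral_eq_0_iff[OF c ab(1)] by (simp add: S_def)
      hence "(((a + b) / 2 - a) * (b - (a + b) / 2))\<^sup>2 = 0" by (rule bspec) (use ab(1) in simp)
      hence "(a + b) / 2 - a = 0 \<or> b - (a + b) / 2 = 0" by (simp only: power_eq_0_iff mult_eq_0_iff)
      thus False using ab(1) by auto
    qed
    moreover have "S \<ge> 0"
      unfolding S_def by (intro Henstock_Kurzweil_Integration.integral_nonneg integrable_continuous_real c) auto
    ultimately show ?thesis by simp
  qed
  hence K: "K > 0" using \<kappa> by (simp add: K_def)
  have M: "M > 0" unfolding M_def P_def using ab(1) lam0 cm by (intro add_pos_pos) auto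
  show ?thesis
  proof (rule that[of "K / (M * H)"])
    show "K / (M * H) > 0" using K M H by simp
    fix c m lam u
    assume c: "c \<in> K_class H cm cM V" and lam_ge: "lam \<ge> (cM + \<epsilon>) * m\<^sup>2" "lam \<ge> lam0"
      and u: "Ak_eigenfunction H c m lam u"
    have lam': "lam > 0" using lam_ge lam0 by simp
    have c': "cm \<le> c y" "c y \<le> cM" if "y \<in> {0<..<H}" for y using c that by (auto simp: K_class_def)
    have mlam: "m\<^sup>2 / lam \<le> 1 / (cM + \<epsilon>)"
      using lam_ge(1) lam' cm \<epsilon> by (simp add: field_simps)
    have p1: "\<kappa> \<le> 1 / c y - m\<^sup>2 / lam" if "y \<in> {0<..<H}" for y
    proof -
      have "1 / cM \<le> 1 / c y" using c'[OF that] cm by (intro divide_left_mono) auto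
      thus ?thesis using mlam by (simp add: \<kappa>_def)
    qed
    have p2: "1 / c y - m\<^sup>2 / lam \<le> P" if "y \<in> {0<..<H}" for y
    proof -
      have "1 / c y \<le> P" unfolding P_def using c'[OF that] cm by (intro divide_left_mono) auto
      moreover have "0 \<le> m\<^sup>2 / lam" using lam' by simp
      ultimately show ?thesis by linarith
    qed
    have TV: "total_variation {0<..<H} c \<le> ereal V" using c by (simp add: K_class_def)
    obtain U W g N where uU: "AE y in lebesgue. y \<in> {0<..<H} \<longrightarrow> u y = U y"
      and osc: "bounded_variation_oscillator H cm V lam (m\<^sup>2 / lam) \<kappa> P c (\<lambda>y. 1 / c y - m\<^sup>2 / lam) U W g N"
      by (rule Ak_eigenfunction_oscillator[OF u H cm(1) lam' \<kappa> c'(1) TV p1 p2]) blast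
    interpret bounded_variation_oscillator H cm V lam "m\<^sup>2 / lam" \<kappa> P c "\<lambda>y. 1 / c y - m\<^sup>2 / lam" U W g N
      by (rule osc)
    define I where "I = integral {a..b} (\<lambda>x. (U x)\<^sup>2)"
    have "norm (integral {0..H} (\<lambda>z. K * (U z)\<^sup>2)) \<le> integral {0..H} (\<lambda>z. M * I)"
    proof (rule integral_norm_bound_integral_off_negligible[where N="{0, H}"])
      show "(\<lambda>z. K * (U z)\<^sup>2) integrable_on {0..H}"
        by (intro integrable_continuous_real continuous_intros U_cont)
      fix z assume "z \<in> {0..H} - {0, H}"
      hence z: "z \<in> {0<..<H}" by auto
      have "K * (U z)\<^sup>2 \<le> M * I"
        using pointwise_observability[OF ab'(1) ab(1) ab'(2) lam0 lam_ge(2) z] by (simp add: K_def M_def I_def S_def)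
      thus "norm (K * (U z)\<^sup>2) \<le> M * I" using K by simp
    qed auto
    hence "K * integral {0..H} (\<lambda>z. (U z)\<^sup>2) \<le> M * H * I" using H by (simp add: mult_ac)
    moreover have L2: "L2_on {0<..<H} u" using u by (simp add: Ak_eigenfunction_def H2_on_def)
    ultimately have "K * (L2_norm_on {0<..<H} u)\<^sup>2 \<le> (M * H) * (L2_norm_on {a<..<b} u)\<^sup>2"
      using L2_norm_on_subinterval[OF L2 uU, of 0 H] L2_norm_on_subinterval[OF L2 uU ab']
      by (simp add: I_def)
    thus "K / (M * H) * (L2_norm_on {0<..<H} u)\<^sup>2 \<le> (L2_norm_on {a<..<b} u)\<^sup>2"
      using M H by (simp add: field_simps)
  qed
qed

theorem mainTheorem1:
  fixes \<Omega>' \<omega>' :: "'a::euclidean_space set"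
    and H cm cM \<epsilon> V a b :: real
    and \<mu> :: "nat \<Rightarrow> real"
    and \<phi> :: "nat \<Rightarrow> 'a \<Rightarrow> real"
  assumes "bounded_smooth_domain \<Omega>'"
    and "H > 0"
    and "dirichlet_eigensystem \<Omega>' \<mu> \<phi>"
    and "0 < cm" and "cm < cM" and "\<epsilon> > 0" and "V > 0"
    and "a < b" and "{a<..<b} \<subseteq> {0<..<H}"
    and "open \<omega>'" and "\<omega>' \<noteq> {}" and "\<omega>' \<subseteq> \<Omega>'"
    and "\<omega>' \<noteq> \<Omega>' \<Longrightarrow> non_concentrating \<Omega>' \<omega>' \<phi>"
  shows "\<exists>f\<omega>>0. \<forall>c\<in>K_class H cm cM V. \<forall>(k, lam)\<in>spectral_pairs H \<mu> cM \<epsilon> c. \<forall>u.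
    normalized_Ak_eigenfunction H c (\<mu> k) lam u \<longrightarrow>
      (let v = product_eigenfunction (\<phi> k) u;
           ratio = L2_norm_on (\<omega>' \<times> {a<..<b}) v / L2_norm_on (\<Omega>' \<times> {0<..<H}) v
       in f\<omega> \<le> ratio \<and> ratio \<le> 1)"
proof -
  have \<Omega>: "open \<Omega>'" "bounded \<Omega>'" "connected \<Omega>'"
    using assms(1) by (auto simp: bounded_smooth_domain_def)
  have \<omega>m: "\<omega>' \<in> sets lebesgue" using assms(10) by auto
  have eig: "dirichlet_eigenfunction \<Omega>' ((\<mu> k)\<^sup>2) (\<phi> k)" if "k \<ge> 1" for k
    using assms(3) that unfolding dirichlet_eigensystem_def by blast
  have \<phi>L2: "L2_on \<Omega>' (\<phi> k)" if "k \<ge> 1" for k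
    using eig[OF that] by (simp add: dirichlet_eigenfunction_def H2_on_def)
  have \<phi>pos: "L2_norm_on \<Omega>' (\<phi> k) > 0" if "k \<ge> 1" for k
    using eig[OF that] L2_norm_on_eq_0_iff[OF \<phi>L2[OF that]] L2_norm_on_nonneg[of \<Omega>' "\<phi> k"]
    by (simp add: dirichlet_eigenfunction_def less_le)
  have \<phi>\<omega>pos: "L2_norm_on \<omega>' (\<phi> k) > 0" if "k \<ge> 1" for k
    using dirichlet_eigenfunction_unique_continuation[OF eig[OF that] zero_le_power2 \<Omega> assms(10-12)]
      L2_norm_on_eq_0_iff[OF L2_on_subset[OF \<phi>L2[OF that] assms(12) \<omega>m]] L2_norm_on_nonneg[of \<omega>' "\<phi> k"]
    by (simp add: less_le)
  have "\<exists>\<delta>>0. \<forall>k\<ge>1. \<delta> \<le> (L2_norm_on \<omega>' (\<phi> k))\<^sup>2 / (L2_norm_on \<Omega>' (\<phi> k))\<^sup>2"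
  proof (cases "\<omega>' = \<Omega>'")
    case True
    thus ?thesis using \<phi>pos by (intro exI[of _ 1]) (auto simp: less_imp_neq[THEN not_sym])
  next
    case False
    show ?thesis
    proof (rule positive_sequence_bounded_below)
      show "0 < (L2_norm_on \<omega>' (\<phi> k))\<^sup>2 / (L2_norm_on \<Omega>' (\<phi> k))\<^sup>2" if "k \<ge> 1" for k
        using \<phi>pos[OF that] \<phi>\<omega>pos[OF that] by simp
    qed (use assms(13)[OF False] in \<open>auto simp: non_concentrating_def\<close>)
  qed
  then obtain \<delta>1 where \<delta>1: "\<delta>1 > 0" 
    "\<And>k. k \<ge> 1 \<Longrightarrow> \<delta>1 \<le> (L2_norm_on \<omega>' (\<phi> k))\<^sup>2 / (L2_norm_on \<Omega>' (\<phi> k))\<^sup>2" by blast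
  have \<mu>pos: "\<mu> 1 > 0" and \<mu>mono: "\<And>k. k \<ge> 1 \<Longrightarrow> \<mu> k \<le> \<mu> (Suc k)"
    using assms(3) unfolding dirichlet_eigensystem_def by auto
  have \<mu>ge: "\<mu> 1 \<le> \<mu> k" if "k \<ge> 1" for k
    using that
  proof (induction k rule: dec_induct)
    case (step n)
    thus ?case using \<mu>mono[of n] by simp
  qed simp
  \<comment> \<open>A lower bound for all \<open>lam\<close> in question, as \<open>\<mu> 1\<close> is the smallest of the \<open>\<mu> k\<close>.\<close>
  define lam0 where "lam0 = (cM + \<epsilon>) * (\<mu> 1)\<^sup>2"
  have lam0: "lam0 > 0" unfolding lam0_def using assms(4-6) \<mu>pos by (intro mult_pos_pos) auto
  obtain \<delta>2 where \<delta>2: "\<delta>2 > 0" "\<And>c m lam u. \<lbrakk>c \<in> K_class H cm cM V; lam \<ge> (cM + \<epsilon>) * m\<^sup>2; lam \<ge> lam0;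
      Ak_eigenfunction H c m lam u\<rbrakk> \<Longrightarrow> \<delta>2 * (L2_norm_on {0<..<H} u)\<^sup>2 \<le> (L2_norm_on {a<..<b} u)\<^sup>2"
    by (rule Ak_eigenfunction_observability[OF assms(2,4,5,6,8,9) lam0, of V]) blast
  define f\<omega> where "f\<omega> = sqrt (\<delta>1 * \<delta>2)"
  let ?ratio = "\<lambda>k u. L2_norm_on (\<omega>' \<times> {a<..<b}) (product_eigenfunction (\<phi> k) u) /
    L2_norm_on (\<Omega>' \<times> {0<..<H}) (product_eigenfunction (\<phi> k) u)"
  have key: "f\<omega> \<le> ?ratio k u \<and> ?ratio k u \<le> 1"
    if c: "c \<in> K_class H cm cM V" and k: "k \<ge> 1" and lam: "lam \<ge> (cM + \<epsilon>) * (\<mu> k)\<^sup>2"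
      and u: "Ak_eigenfunction H c (\<mu> k) lam u" for c k lam u
  proof -
    have uL2: "L2_on {0<..<H} u" using u by (simp add: Ak_eigenfunction_def H2_on_def)
    have abL2: "L2_on {a<..<b} u" by (rule L2_on_subset[OF uL2 assms(9)]) simp
    have upos: "L2_norm_on {0<..<H} u > 0"
      using u L2_norm_on_eq_0_iff[OF uL2] L2_norm_on_nonneg[of "{0<..<H}" u]
      by (simp add: Ak_eigenfunction_def less_le)
    have "lam0 \<le> (cM + \<epsilon>) * (\<mu> k)\<^sup>2"
      unfolding lam0_def using assms(4-6) \<mu>ge[OF k] \<mu>pos by (intro mult_left_mono power_mono) auto
    hence "\<delta>2 * (L2_norm_on {0<..<H} u)\<^sup>2 \<le> (L2_norm_on {a<..<b} u)\<^sup>2"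
      using lam by (intro \<delta>2(2)[OF c lam _ u]) simp
    hence r2: "\<delta>2 \<le> (L2_norm_on {a<..<b} u)\<^sup>2 / (L2_norm_on {0<..<H} u)\<^sup>2"
      using upos by (simp add: field_simps)
    define R where "R = (L2_norm_on \<omega>' (\<phi> k) / L2_norm_on \<Omega>' (\<phi> k)) * (L2_norm_on {a<..<b} u / L2_norm_on {0<..<H} u)"
    have R0: "0 \<le> R" unfolding R_def by (intro mult_nonneg_nonneg divide_nonneg_nonneg L2_norm_on_nonneg)
    have "\<delta>1 * \<delta>2 \<le> ((L2_norm_on \<omega>' (\<phi> k))\<^sup>2 / (L2_norm_on \<Omega>' (\<phi> k))\<^sup>2) * ((L2_norm_on {a<..<b} u)\<^sup>2 / (L2_norm_on {0<..<H} u)\<^sup>2)"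
      using \<delta>1(2)[OF k] r2 \<delta>1(1) \<delta>2(1) by (intro mult_mono) auto
    also have "\<dots> = R\<^sup>2" by (simp add: R_def power_mult_distrib power_divide)
    finally have "f\<omega> \<le> R" unfolding f\<omega>_def using R0 real_le_lsqrt by blast
    moreover have "R \<le> 1"
    proof -
      have "L2_norm_on \<omega>' (\<phi> k) / L2_norm_on \<Omega>' (\<phi> k) \<le> 1"
        using L2_norm_on_mono[OF \<phi>L2[OF k] assms(12) \<omega>m] \<phi>pos[OF k] by simp
      moreover have "L2_norm_on {a<..<b} u / L2_norm_on {0<..<H} u \<le> 1"
        using L2_norm_on_mono[OF uL2 assms(9)] upos by simp
      ultimately show ?thesis unfolding R_def
        by (intro mult_le_one divide_nonneg_nonneg L2_norm_on_nonneg)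
    qed
    moreover have "?ratio k u = R"
      unfolding R_def L2_norm_on_product[OF \<phi>L2[OF k] uL2]
        L2_norm_on_product[OF L2_on_subset[OF \<phi>L2[OF k] assms(12) \<omega>m] abL2]
      by simp
    ultimately show ?thesis by simp
  qed
  have "f\<omega> > 0" using \<delta>1(1) \<delta>2(1) by (simp add: f\<omega>_def)
  thus ?thesis
    unfolding Let_def spectral_pairs_def normalized_Ak_eigenfunction_def using key by blast
qed

end
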